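(* Let $W$ be an irreducible finite Coxeter group (finite real reflection group) with complexified reflection representation $V\cong\mathbb{C}^N$ and reflection arrangement $\mathcal{A}$, and let $m\colon\mathcal{A}\to\mathbb{N}$ be a $W$-invariant multiplicity function with $m_H\ge1$ for all $H\in\mathcal{A}$. Let $y_1,\dots,y_N$ be homogeneous basic invariants with $\deg y_1\le\dots\le\deg y_N$, let $T=\mathbb{C}[y_1,\dots,y_{N-1}]$, and let $\mathcal{D}=\partial_{y_N}$ be K. Saito's primitive derivation. Then $\mathcal{D}\colon Q_m^{V^*}\to Q_{m-1}^{V^*}$ is a $T$-isomorphism, i.e. an isomorphism of $T$-modules.
   Context: $\mathbb{N}=\{0,1,2,\dots\}$. $SV^*=\mathbb{C}[x_1,\dots,x_N]$ where $x_1,\dots,x_N$ is a basis of $V^*$; $W$ acts on it by $(wf)(x)=f(w^{-1}x)$. $\mathcal{A}$ is the set of reflection hyperplanes; for $H\in\mathcal{A}$, $\alpha_H\in V^*$ satisfies $H=\ker\alpha_H$, $s_H$ is the reflection in $H$, $m_H=m(H)$. Quasi-invariants: $Q_m$ is the set of $p\in SV^*$ such that $(1-s_H)p$ is divisible by $\alpha_H^{2m_H}$ for all $H\in\mathcal{A}$. $Q_{m-1}$ is the same space for the multiplicity function $H\mapsto m_H-1$. $Q_m$ is a $W$-module, and $Q_m^{V^*}\subseteq Q_m$ denotes the isotypic component of the irreducible $W$-module $V^*$ (here $V^*\cong V$). Basic invariants $y_1,\dots,y_N$ are algebraically independent homogeneous generators of $(SV^* )^W$. $\mathcal{D}=\partial_{y_N}$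 is the derivation of the field $\mathbb{C}(x_1,\dots,x_N)$ determined by $\mathcal{D}(y_i)=\delta_{iN}$, $1\le i\le N$. *)

theory Defs
  imports
    "HOL-Analysis.Analysis"
    "HOL-Library.Poly_Mapping"
    "HOL-Computational_Algebra.Fraction_Field"
begin

section \<open>Polynomials and rational functions over the complex numbers\<close>

text \<open>
  \<open>'v mpoly\<close> is the polynomial ring over the complex numbers in variables indexed by \<open>'v\<close>. A linear
  order on \<open>'v\<close> is needed only because the library proves \<open>'v mpoly\<close> to be a domain (and hence
  provides its field of fractions) under that sort constraint.
\<close>

type_synonym 'v mpoly = "('v \<Rightarrow>\<^sub>0 nat) \<Rightarrow>\<^sub>0 complex"

definition Const :: "complex \<Rightarrow> 'v mpoly" where
  "Const c = Poly_Mapping.single 0 c"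

definition Var :: "'v \<Rightarrow> 'v mpoly" where
  "Var i = Poly_Mapping.single (Poly_Mapping.single i 1) 1"

definition pscale :: "complex \<Rightarrow> 'v mpoly \<Rightarrow> 'v mpoly" where
  "pscale c p = Const c * p"

global_interpretation mpoly: vector_space pscale
  by unfold_locales
    (simp_all add: pscale_def Const_def distrib_left distrib_right single_add mult_single
      flip: mult.assoc)

definition vars :: "'v mpoly \<Rightarrow> 'v set" where
  "vars p = (\<Union>k\<in>Poly_Mapping.keys p. Poly_Mapping.keys k)"

definition subst :: "('v \<Rightarrow> 'u mpoly) \<Rightarrow> 'v mpoly \<Rightarrow> 'u mpoly" where
  "subst \<sigma> p = (\<Sum>k\<in>Poly_Mapping.keys p.
     Const (Poly_Mapping.lookup p k) *
     (\<Prod>i\<in>Poly_Mapping.keys k. \<sigma> i ^ Poly_Mapping.lookup k i))"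

definition mon_degree :: "('v \<Rightarrow>\<^sub>0 nat) \<Rightarrow> nat" where
  "mon_degree k = (\<Sum>i\<in>Poly_Mapping.keys k. Poly_Mapping.lookup k i)"

definition total_degree :: "'v mpoly \<Rightarrow> nat" where
  "total_degree p = Max (insert 0 (mon_degree ` Poly_Mapping.keys p))"

definition homogeneous :: "'v mpoly \<Rightarrow> bool" where
  "homogeneous p \<longleftrightarrow> (\<forall>k\<in>Poly_Mapping.keys p. mon_degree k = total_degree p)"

text \<open>The subalgebra generated by the \<open>y i\<close> with \<open>i \<in> I\<close>.\<close>

definition generated_algebra :: "('i \<Rightarrow> 'v mpoly) \<Rightarrow> 'i set \<Rightarrow> 'v mpoly set" where
  "generated_algebra y I = {subst y P | P. vars P \<subseteq> I}"

definition algebraically_independent :: "('i \<Rightarrow> 'v mpoly) \<Rightarrow> 'i set \<Rightarrow> bool" where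
  "algebraically_independent y I \<longleftrightarrow> (\<forall>P. vars P \<subseteq> I \<and> subst y P = 0 \<longrightarrow> P = 0)"

definition to_frac :: "'a::idom \<Rightarrow> 'a fract" where
  "to_frac p = Fract p 1"

definition derivation :: "('v::linorder mpoly fract \<Rightarrow> 'v mpoly fract) \<Rightarrow> bool" where
  "derivation D \<longleftrightarrow>
     (\<forall>f g. D (f + g) = D f + D g) \<and>
     (\<forall>f g. D (f * g) = D f * g + f * D g) \<and>
     (\<forall>c. D (to_frac (Const c)) = 0)"

section \<open>Finite real reflection groups\<close>

text \<open>
  Groups of linear automorphisms of the real space are given by matrices in an arbitrary basis.
\<close>

definition matrix_group :: "(real^'n^'n) set \<Rightarrow> bool" where
  "matrix_group G \<longleftrightarrow>
     mat 1 \<in> G \<and> (\<forall>g\<in>G. \<forall>h\<in>G. g ** h \<in> G) \<and> (\<forall>g\<in>G. invertible g \<and> matrix_inv g \<in> G)"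

definition is_reflection :: "real^'n^'n \<Rightarrow> bool" where
  "is_reflection s \<longleftrightarrow> s ** s = mat 1 \<and> dim {v. s *v v = v} = CARD('n) - 1"

definition reflections :: "(real^'n^'n) set \<Rightarrow> (real^'n^'n) set" where
  "reflections W = {s \<in> W. is_reflection s}"

text \<open>
  The condition \<open>W \<noteq> {mat 1}\<close> only excludes the trivial group on a line, which acts irreducibly but
  is not the reflection representation of an irreducible Coxeter group.
\<close>

definition irreducible_reflection_group :: "(real^'n^'n) set \<Rightarrow> bool" where
  "irreducible_reflection_group W \<longleftrightarrow>
     finite W \<and> matrix_group W \<and>
     (\<forall>G. matrix_group G \<and> reflections W \<subseteq> G \<longrightarrow> W \<subseteq> G) \<and>
     W \<noteq> {mat 1} \<and>
     (\<forall>U. subspace U \<and> (\<forall>w\<in>W. \<forall>u\<in>U. w *v u \<in> U) \<longrightarrow> U = {0} \<or> U = UNIV)"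

definition complexify :: "real^'n^'n \<Rightarrow> complex^'n^'n" where
  "complexify w = (\<chi> i j. complex_of_real (w $ i $ j))"

definition mirror :: "real^'n^'n \<Rightarrow> (complex^'n) set" where
  "mirror s = {v. complexify s *v v = v}"

definition arrangement :: "(real^'n^'n) set \<Rightarrow> (complex^'n) set set" where
  "arrangement W = mirror ` reflections W"

definition invariant_multiplicity ::
    "(real^'n^'n) set \<Rightarrow> ((complex^'n) set \<Rightarrow> nat) \<Rightarrow> bool" where
  "invariant_multiplicity W m \<longleftrightarrow>
     (\<forall>w\<in>W. \<forall>H\<in>arrangement W. m ((*v) (complexify w) ` H) = m H)"

text \<open>The action \<open>(w f)(x) = f(w\<^sup>-\<^sup>1 x)\<close>, where \<open>Var i\<close> is the \<open>i\<close>-th coordinate function.\<close>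

definition act :: "real^'n^'n \<Rightarrow> 'n mpoly \<Rightarrow> 'n mpoly" where
  "act w = subst (\<lambda>i. \<Sum>j\<in>UNIV. Const (complex_of_real (matrix_inv w $ i $ j)) * Var j)"

definition linear_form :: "complex^'n \<Rightarrow> 'n mpoly" where
  "linear_form a = (\<Sum>i\<in>UNIV. Const (a $ i) * Var i)"

definition linear_form_kernel :: "complex^'n \<Rightarrow> (complex^'n) set" where
  "linear_form_kernel a = {v. (\<Sum>i\<in>UNIV. a $ i * v $ i) = 0}"

text \<open>The space \<open>V\<^sup>*\<close>, as the degree one part of the polynomial ring.\<close>

definition dual_space :: "('n::finite) mpoly set" where
  "dual_space = range linear_form"

section \<open>Quasi-invariants and isotypic components\<close>

text \<open>
  For \<open>H\<close> in the arrangement, exactly one reflection \<open>s\<close> of a finite group \<open>W\<close> has mirror \<open>H\<close>, and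
  the linear form with kernel \<open>H\<close> is unique up to a nonzero factor.
\<close>

definition quasi_invariants ::
    "(real^'n^'n) set \<Rightarrow> ((complex^'n) set \<Rightarrow> nat) \<Rightarrow> 'n mpoly set" where
  "quasi_invariants W m =
     {p. \<forall>H\<in>arrangement W. \<forall>s\<in>reflections W. \<forall>a.
           mirror s = H \<and> linear_form_kernel a = H \<longrightarrow>
           linear_form a ^ (2 * m H) dvd p - act s p}"

definition submodule_of :: "(real^'n^'n) set \<Rightarrow> 'n mpoly set \<Rightarrow> 'n mpoly set \<Rightarrow> bool" where
  "submodule_of W M U \<longleftrightarrow> U \<subseteq> M \<and> mpoly.subspace U \<and> (\<forall>w\<in>W. \<forall>u\<in>U. act w u \<in> U)"

definition isomorphic_modules :: "(real^'n^'n) set \<Rightarrow> 'n mpoly set \<Rightarrow> 'n mpoly set \<Rightarrow> bool" where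
  "isomorphic_modules W E U \<longleftrightarrow>
     (\<exists>\<phi>. bij_betw \<phi> E U \<and>
          (\<forall>e\<in>E. \<forall>e'\<in>E. \<phi> (e + e') = \<phi> e + \<phi> e') \<and>
          (\<forall>c. \<forall>e\<in>E. \<phi> (pscale c e) = pscale c (\<phi> e)) \<and>
          (\<forall>w\<in>W. \<forall>e\<in>E. \<phi> (act w e) = act w (\<phi> e)))"

text \<open>For an irreducible \<open>W\<close>-module \<open>E\<close>, the sum of all submodules of \<open>M\<close> isomorphic to \<open>E\<close>.\<close>

definition isotypic_component ::
    "(real^'n^'n) set \<Rightarrow> 'n mpoly set \<Rightarrow> 'n mpoly set \<Rightarrow> 'n mpoly set" where
  "isotypic_component W E M =
     mpoly.span (\<Union>{U. submodule_of W M U \<and> isomorphic_modules W E U})"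

section \<open>Basic invariants and the primitive derivation\<close>

definition invariants :: "(real^'n^'n) set \<Rightarrow> 'n mpoly set" where
  "invariants W = {p. \<forall>w\<in>W. act w p = p}"

definition basic_invariants :: "(real^'n^'n) set \<Rightarrow> (nat \<Rightarrow> 'n mpoly) \<Rightarrow> bool" where
  "basic_invariants W y \<longleftrightarrow>
     (\<forall>i\<in>{1..CARD('n)}. homogeneous (y i)) \<and>
     algebraically_independent y {1..CARD('n)} \<and>
     generated_algebra y {1..CARD('n)} = invariants W"

definition primitive_derivation ::
    "(nat \<Rightarrow> 'n::{finite,linorder} mpoly) \<Rightarrow> ('n mpoly fract \<Rightarrow> 'n mpoly fract) \<Rightarrow> bool" where
  "primitive_derivation y D \<longleftrightarrow>
     derivation D \<and>
     (\<forall>i\<in>{1..CARD('n)}. D (to_frac (y i)) = (if i = CARD('n) then 1 else 0))"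

text \<open>
  Isomorphisms of modules over a subring \<open>T\<close> of \<open>'a\<close>, for modules contained in \<open>'a\<close>.
\<close>

definition is_module_over :: "'a::comm_ring_1 set \<Rightarrow> 'a set \<Rightarrow> bool" where
  "is_module_over T M \<longleftrightarrow>
     0 \<in> M \<and> (\<forall>f\<in>M. \<forall>g\<in>M. f + g \<in> M) \<and> (\<forall>t\<in>T. \<forall>f\<in>M. t * f \<in> M)"

definition module_isomorphism ::
    "'a::comm_ring_1 set \<Rightarrow> ('a \<Rightarrow> 'a) \<Rightarrow> 'a set \<Rightarrow> 'a set \<Rightarrow> bool" where
  "module_isomorphism T D M M' \<longleftrightarrow>
     is_module_over T M \<and> is_module_over T M' \<and>
     (\<forall>f\<in>M. \<forall>g\<in>M. D (f + g) = D f + D g) \<and>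
     (\<forall>t\<in>T. \<forall>f\<in>M. D (t * f) = t * D f) \<and>
     bij_betw D M M'"

end

theory Submission
  imports Defs "HOL-Computational_Algebra.Polynomial"
begin

text \<open>
  Write \<open>J\<close> for the Jacobian of the basic invariants; up to a constant it is the product of the linear forms
  \<open>\<alpha>\<^sub>H\<close>, and by Cramer's rule \<open>J D\<close> is a derivation of the polynomial ring. An equivariant linear map \<open>p\<close>
  from \<open>V\<^sup>*\<close> to the polynomials takes values in \<open>Q\<^sub>m\<close> iff \<open>\<alpha>\<^sub>H\<close> divides \<open>p(\<alpha>\<^sub>H)\<close> to the order \<open>2m\<^sub>H + 1\<close>, and since
  \<open>D(\<alpha>\<^sub>H)\<close> has a pole along every mirror, \<open>D\<close> lowers this order by exactly two. Hence it is enough that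
  \<open>D\<close> is injective on the equivariant maps and reaches all of them.

  Injectivity: \<open>D\<close> has a pole somewhere, since otherwise it would be a derivation of the polynomial ring
  of negative degree. Surjectivity: in terms of the gradients of the basic invariants, with Gram matrix \<open>G\<close>, one has to
  solve a linear differential system \<open>\<partial>a G + a B = c\<close> in \<open>y\<^sub>N\<close>, where \<open>B\<close> and \<open>\<partial>G\<close> do not involve \<open>y\<^sub>N\<close>. The
  coefficient matrices \<open>n \<partial>G + B\<close> of the leading terms have homogeneous determinants of degree at most
  \<open>2|\<A>| - N h \<le> 0\<close>, where \<open>h = deg y\<^sub>N\<close>; so these are constants, and they do not vanish by injectivity.

  The inequality \<open>2|\<A>| \<le> N h\<close> comes from a Coxeter element \<open>c\<close>, of order \<open>p\<close> say. The coordinates of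
  a regular vector with respect to the roots change sign \<open>2N\<close> times in total at each step along the \<open>c\<close>-orbits.
  By a discrete Sturm--Hurwitz argument some orbit carries a frequency \<open>l\<close> with \<open>p/|l| \<ge> 2|\<A>|/N\<close>, so that
  \<open>exp(2\<pi>il/p)\<close> is an eigenvalue of \<open>c\<close>, and then \<open>p\<close> divides \<open>l deg y\<^sub>i\<close> for some \<open>i\<close>.
\<close>

text \<open>The pole of D along every mirror cannot be read off at the start: if the mirrors form
  more than one orbit, the degree argument yields a pole along some mirror only. One pole suffices
  for injectivity, because an equivariant map that vanishes on one root is zero. Injectivity
  together with the degree bound makes \<open>det B\<close> a nonzero constant, and this forces the
  pole along all other mirrors. Only then can orders be compared exactly, as the surjectivity onto
  Q_{m-1} requires. The shape of the differential system comes from degrees. D lowers degrees by h,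
  and the (i,j) entry of G has degree d_i + d_j - 2 < 2h; so G is at most linear in y_N, and the
  entries of B, which already contain one derivative, are free of y_N. The determinants have to be
  constants and not merely nonzero, since the coefficients of the powers of y_N must be found as
  polynomials in the other invariants, not as fractions. Passing from single polynomials to maps on
  the dual space turns membership in Q_m into one order per mirror, that of the value at the
  root.\<close>

definition ringhom :: "('a::comm_ring_1 \<Rightarrow> 'b::comm_ring_1) \<Rightarrow> bool" where
  "ringhom f \<longleftrightarrow> f 1 = 1 \<and> (\<forall>x y. f (x + y) = f x + f y) \<and> (\<forall>x y. f (x * y) = f x * f y)"

context
  fixes f :: "'a::comm_ring_1 \<Rightarrow> 'b::comm_ring_1"
  assumes f: "ringhom f"
begin

lemma ringhom_1: "f 1 = 1"
  and ringhom_add: "f (x + y) = f x + f y"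
  and ringhom_mult: "f (x * y) = f x * f y"
  using f by (auto simp: ringhom_def)

lemma ringhom_0: "f 0 = 0"
  using ringhom_add[of 0 0] by simp

lemma ringhom_uminus: "f (- x) = - f x"
  using ringhom_add[of x "- x"] ringhom_0 by (simp add: eq_neg_iff_add_eq_0 add.commute)

lemma ringhom_diff: "f (x - y) = f x - f y"
  using ringhom_add[of x "- y"] ringhom_uminus by simp

lemma ringhom_power: "f (x ^ n) = f x ^ n"
  by (induction n) (auto simp: ringhom_1 ringhom_mult)

lemma ringhom_sum: "f (sum g I) = (\<Sum>i\<in>I. f (g i))"
  by (induction I rule: infinite_finite_induct) (auto simp: ringhom_0 ringhom_add)

lemma ringhom_prod: "f (prod g I) = (\<Prod>i\<in>I. f (g i))"
  by (induction I rule: infinite_finite_induct) (auto simp: ringhom_1 ringhom_mult)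

lemma ringhom_of_nat: "f (of_nat n) = of_nat n"
  by (induction n) (auto simp: ringhom_0 ringhom_1 ringhom_add)

lemma ringhom_of_int: "f (of_int n) = of_int n"
  by (cases n rule: int_diff_cases) (auto simp: ringhom_diff ringhom_of_nat)

lemma ringhom_det: "f (det M) = det (\<chi> i j. f (M $ i $ j))"
  by (simp add: det_def ringhom_sum ringhom_mult ringhom_of_int ringhom_prod)

lemmas ringhom_simps = ringhom_0 ringhom_1 ringhom_add ringhom_mult ringhom_uminus ringhom_diff
  ringhom_power ringhom_sum ringhom_prod ringhom_of_nat ringhom_of_int

end

lemma ringhom_compose: "ringhom f \<Longrightarrow> ringhom g \<Longrightarrow> ringhom (\<lambda>x. f (g x))"
  by (auto simp: ringhom_def)

section \<open>Constants, and polynomials inside their field of fractions\<close>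

lemma ringhom_Const: "ringhom Const"
  by (auto simp: ringhom_def Const_def single_add mult_single)

lemmas Const_simps = ringhom_simps[OF ringhom_Const]

lemma Const_inject [simp]: "Const a = Const b \<longleftrightarrow> a = b"
  unfolding Const_def by (metis lookup_single_eq)

lemma Const_eq_0_iff [simp]: "Const a = 0 \<longleftrightarrow> a = 0"
  by (metis Const_inject Const_simps(1))

lemma ringhom_to_frac: "ringhom (to_frac :: 'a::idom \<Rightarrow> _)"
  by (auto simp: ringhom_def to_frac_def One_fract_def)

lemmas to_frac_simps = ringhom_simps[OF ringhom_to_frac]

lemma to_frac_inject [simp]: "to_frac a = to_frac b \<longleftrightarrow> a = b"
  by (simp add: to_frac_def eq_fract)

lemma to_frac_eq_0_iff [simp]: "to_frac a = 0 \<longleftrightarrow> a = 0"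
  by (metis to_frac_inject to_frac_simps(1))

text \<open>Updating at a fresh key is adding a single term, so the update induction becomes
  additive and loses its freshness condition.\<close>

lemma poly_mapping_add_induct [case_names zero single add]:
  fixes p :: "'a \<Rightarrow>\<^sub>0 'b::comm_monoid_add"
  assumes "P 0" "\<And>k c. P (Poly_Mapping.single k c)" "\<And>p q. P p \<Longrightarrow> P q \<Longrightarrow> P (p + q)"
  shows "P p"
proof (induction p rule: update_induct)
  case const
  then show ?case by (fact assms)
next
  case (update f a b)
  have "Poly_Mapping.update a b f = f + Poly_Mapping.single a b"
    using update(1) by (intro poly_mapping_eqI)
      (auto simp: lookup_update lookup_add lookup_single not_in_keys_iff_lookup_eq_zero when_def)
  then show ?case using assms update by metis
qed

lemma Var_power: "Var i ^ n = Poly_Mapping.single (Poly_Mapping.single i n) 1"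
  by (induction n) (auto simp: Var_def mult_single simp flip: single_add)

text \<open>Constants and variables generate the ring; ring homomorphisms and derivations can
  therefore be compared on generators.\<close>

lemma mpoly_induct [case_names Const Var add mult]:
  fixes p :: "'v mpoly"
  assumes C: "\<And>c. P (Const c)" and V: "\<And>i. P (Var i)"
    and A: "\<And>p q. P p \<Longrightarrow> P q \<Longrightarrow> P (p + q)" and M: "\<And>p q. P p \<Longrightarrow> P q \<Longrightarrow> P (p * q)"
  shows "P p"
proof (induction p rule: poly_mapping_add_induct)
  case zero
  then show ?case using C[of 0] by (simp add: Const_def)
next
  case (add p q)
  then show ?case by (rule A)
next
  case (single k c)
  have P1: "P 1" using C[of 1] by (simp add: Const_simps)
  have "P (Poly_Mapping.single k 1)"
  proof (induction k rule: poly_mapping_add_induct)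
    case zero
    then show ?case using P1 by simp
  next
    case (add k l)
    then show ?case using M by (force simp: mult_single)
  next
    case (single i n)
    have "P (Var i ^ n)"
      by (induction n) (auto intro: P1 M V)
    then show ?case by (simp add: Var_power)
  qed
  then have "P (Const c * Poly_Mapping.single k 1)"
    by (intro M C)
  then show ?case by (simp add: Const_def mult_single)
qed

section \<open>Evaluation homomorphisms\<close>

text \<open>The target ring and the image of the constants are parameters: \<open>subst\<close> is
  the case \<open>h = Const\<close>, and a map to univariate polynomials over the polynomial ring
  later measures total degrees.\<close>

definition poly_eval :: "(complex \<Rightarrow> 'a::comm_ring_1) \<Rightarrow> ('v \<Rightarrow> 'a) \<Rightarrow> 'v mpoly \<Rightarrow> 'a" where
  "poly_eval h \<sigma> p = (\<Sum>k\<in>Poly_Mapping.keys p.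
     h (Poly_Mapping.lookup p k) * (\<Prod>i\<in>Poly_Mapping.keys k. \<sigma> i ^ Poly_Mapping.lookup k i))"

lemma subst_eq_poly_eval: "subst = poly_eval Const"
  by (intro ext) (simp add: subst_def poly_eval_def)

context
  fixes h :: "complex \<Rightarrow> 'a::comm_ring_1" and \<sigma> :: "'v \<Rightarrow> 'a"
  assumes h: "ringhom h"
begin

lemma poly_eval_add: "poly_eval h \<sigma> (p + q) = poly_eval h \<sigma> p + poly_eval h \<sigma> q"
  unfolding poly_eval_def
  by (rule setsum_keys_plus_distrib) (auto simp: ringhom_simps[OF h] algebra_simps)

lemma poly_eval_0: "poly_eval h \<sigma> 0 = 0"
  by (simp add: poly_eval_def)

lemma poly_eval_single:
  "poly_eval h \<sigma> (Poly_Mapping.single k c)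
     = h c * (\<Prod>i\<in>Poly_Mapping.keys k. \<sigma> i ^ Poly_Mapping.lookup k i)"
  by (simp add: poly_eval_def ringhom_simps[OF h])

lemma poly_eval_Const: "poly_eval h \<sigma> (Const c) = h c"
  unfolding Const_def poly_eval_single by simp

lemma poly_eval_Var: "poly_eval h \<sigma> (Var i) = \<sigma> i"
  unfolding Var_def poly_eval_single by (simp add: ringhom_simps[OF h])

lemma monomial_add:
  fixes k l :: "'v \<Rightarrow>\<^sub>0 nat"
  shows "(\<Prod>i\<in>Poly_Mapping.keys (k + l). \<sigma> i ^ Poly_Mapping.lookup (k + l) i)
    = (\<Prod>i\<in>Poly_Mapping.keys k. \<sigma> i ^ Poly_Mapping.lookup k i) *
      (\<Prod>i\<in>Poly_Mapping.keys l. \<sigma> i ^ Poly_Mapping.lookup l i)"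
proof -
  let ?U = "Poly_Mapping.keys k \<union> Poly_Mapping.keys l"
  have *: "(\<Prod>i\<in>Poly_Mapping.keys m. \<sigma> i ^ Poly_Mapping.lookup m i)
      = (\<Prod>i\<in>?U. \<sigma> i ^ Poly_Mapping.lookup m i)" if "Poly_Mapping.keys m \<subseteq> ?U" for m
    using that by (intro prod.mono_neutral_left) (auto simp: in_keys_iff)
  show ?thesis
    by (subst (1 2 3) *) (auto simp: keys_add lookup_add power_add prod.distrib in_keys_iff)
qed

lemma poly_eval_mult: "poly_eval h \<sigma> (p * q) = poly_eval h \<sigma> p * poly_eval h \<sigma> q"
proof (induction p rule: poly_mapping_add_induct)
  case (single k c)
  show ?case
  proof (induction q rule: poly_mapping_add_induct)
    case (single l d)
    show ?case
      by (simp add: mult_single poly_eval_single monomial_add ringhom_simps[OF h])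
  qed (auto simp: poly_eval_add distrib_left poly_eval_0)
qed (auto simp: poly_eval_add distrib_right poly_eval_0)

lemma ringhom_poly_eval: "ringhom (poly_eval h \<sigma>)"
  using poly_eval_Const[of 1]
  by (auto simp: ringhom_def poly_eval_add poly_eval_mult Const_simps ringhom_simps[OF h])

end

lemma ringhom_subst: "ringhom (subst \<sigma>)"
  by (simp add: subst_eq_poly_eval ringhom_poly_eval ringhom_Const)

lemmas subst_simps = ringhom_simps[OF ringhom_subst]

lemma subst_Const [simp]: "subst \<sigma> (Const c) = Const c"
  by (simp add: subst_eq_poly_eval poly_eval_Const ringhom_Const)

lemma subst_Var [simp]: "subst \<sigma> (Var i) = \<sigma> i"
  by (simp add: subst_eq_poly_eval poly_eval_Var ringhom_Const)

lemma ringhom_eqI: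
  fixes p :: "'v mpoly"
  assumes "ringhom f" "ringhom g" "\<And>c. f (Const c) = g (Const c)" "\<And>i. f (Var i) = g (Var i)"
  shows "f p = g p"
  using assms by (induction p rule: mpoly_induct) (auto simp: ringhom_simps)

lemma subst_subst: "subst \<sigma> (subst \<tau> p) = subst (\<lambda>i. subst \<sigma> (\<tau> i)) p"
  by (rule ringhom_eqI[of "\<lambda>p. subst \<sigma> (subst \<tau> p)"])
    (auto simp: ringhom_compose ringhom_subst)

lemma subst_Var_id [simp]: "subst Var p = p"
  by (rule ringhom_eqI[of "subst Var" "\<lambda>p. p"]) (auto simp: ringhom_subst, simp add: ringhom_def)

lemma subst_cong:
  assumes "\<And>i. i \<in> vars p \<Longrightarrow> \<sigma> i = \<tau> i"
  shows "subst \<sigma> p = subst \<tau> p"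
proof -
  have "\<sigma> i = \<tau> i" if "k \<in> Poly_Mapping.keys p" "i \<in> Poly_Mapping.keys k" for i k
    using that by (intro assms) (auto simp: vars_def)
  then show ?thesis by (simp add: subst_def)
qed

text \<open>Modulo \<open>l\<close> the substitution and the identity are ring homomorphisms that
  agree on variables.\<close>

lemma dvd_diff_subst:
  fixes l :: "'v mpoly"
  assumes "\<And>i. l dvd Var i - \<tau> i"
  shows "l dvd p - subst \<tau> p"
proof (induction p rule: mpoly_induct)
  case (add p q)
  have "p + q - subst \<tau> (p + q) = (p - subst \<tau> p) + (q - subst \<tau> q)"
    by (simp add: subst_simps)
  then show ?case using add by (simp only: dvd_add)
next
  case (mult p q)
  have "p * q - subst \<tau> (p * q) = (p - subst \<tau> p) * q + subst \<tau> p * (q - subst \<tau> q)"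
    by (simp add: subst_simps algebra_simps)
  then show ?case using mult by (simp only: dvd_add dvd_mult dvd_mult2)
qed (auto simp: assms)

section \<open>Partial derivatives\<close>

text \<open>The subtraction of exponents is truncated, but where the exponent of \<open>i\<close> is
  zero the factor \<open>of_nat (lookup k i)\<close> removes the term.\<close>

definition pd :: "'v \<Rightarrow> 'v mpoly \<Rightarrow> 'v mpoly" where
  "pd i p = (\<Sum>k\<in>Poly_Mapping.keys p.
     Poly_Mapping.single (k - Poly_Mapping.single i 1)
       (of_nat (Poly_Mapping.lookup k i) * Poly_Mapping.lookup p k))"

lemma pd_add: "pd i (p + q) = pd i p + pd i q"
  unfolding pd_def by (rule setsum_keys_plus_distrib) (auto simp: single_add algebra_simps)

lemma pd_single: "pd i (Poly_Mapping.single k c)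
    = Poly_Mapping.single (k - Poly_Mapping.single i 1) (of_nat (Poly_Mapping.lookup k i) * c)"
  by (simp add: pd_def)

lemma pd_Const [simp]: "pd i (Const c) = 0"
  by (simp add: Const_def pd_single)

lemma pd_0 [simp]: "pd i 0 = 0"
  by (simp add: pd_def)

lemma pd_Var: "pd i (Var j) = (if i = j then 1 else 0)"
  by (auto simp: Var_def pd_single lookup_single)

lemma pd_mult: "pd i (p * q) = pd i p * q + p * pd i q"
proof (induction p rule: poly_mapping_add_induct)
  case (single k c)
  show ?case
  proof (induction q rule: poly_mapping_add_induct)
    case (single l d)
    let ?e = "Poly_Mapping.single i (1::nat)"
    have *: "(m - ?e) + n = m + n - ?e" if "Poly_Mapping.lookup m i \<noteq> 0" for m n
      using that by (intro poly_mapping_eqI)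
        (auto simp: lookup_add minus_poly_mapping.rep_eq lookup_single when_def)
    have "Poly_Mapping.single (k + l - ?e) (of_nat (Poly_Mapping.lookup k i) * c * d)
        = Poly_Mapping.single (k - ?e + l) (of_nat (Poly_Mapping.lookup k i) * c * d)"
      by (cases "Poly_Mapping.lookup k i = 0") (simp_all add: * del: One_nat_def)
    moreover have "Poly_Mapping.single (k + l - ?e) (of_nat (Poly_Mapping.lookup l i) * c * d)
        = Poly_Mapping.single (k + (l - ?e)) (of_nat (Poly_Mapping.lookup l i) * c * d)"
      using *[of l k] by (cases "Poly_Mapping.lookup l i = 0") (simp_all add: add.commute del: One_nat_def)
    ultimately show ?case
      by (simp add: mult_single pd_single lookup_add ring_distribs single_add mult_ac add.commute[of _ l])
  qed (auto simp: pd_add algebra_simps)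
qed (auto simp: pd_add algebra_simps)

lemma pd_uminus: "pd i (- p) = - pd i p"
  using pd_add[of i p "-p"] by (simp add: eq_neg_iff_add_eq_0 add.commute)

lemma pd_diff: "pd i (p - q) = pd i p - pd i q"
  using pd_add[of i p "-q"] by (simp add: pd_uminus)

lemma pd_sum: "pd i (sum g I) = (\<Sum>j\<in>I. pd i (g j))"
  by (induction I rule: infinite_finite_induct) (auto simp: pd_add)

lemma pd_1 [simp]: "pd i 1 = 0"
  using pd_Const[of i 1] by (simp add: Const_simps del: pd_Const)

text \<open>Stated along a ring homomorphism \<open>\<phi>\<close>, so that it covers the chain
  rules for \<open>pd\<close> and \<open>prim\<close> after a substitution as well as the
  restriction of a derivation of the field of fractions to polynomials.\<close>

lemma derivation_chain:
  fixes \<delta> :: "'v::finite mpoly \<Rightarrow> 'k::comm_ring_1"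
  assumes add: "\<And>p q. \<delta> (p + q) = \<delta> p + \<delta> q"
    and mult: "\<And>p q. \<delta> (p * q) = \<delta> p * \<phi> q + \<phi> p * \<delta> q"
    and const: "\<And>c. \<delta> (Const c) = 0"
    and \<phi>: "ringhom \<phi>"
  shows "\<delta> p = (\<Sum>i\<in>UNIV. \<phi> (pd i p) * \<delta> (Var i))"
proof (induction p rule: mpoly_induct)
  case (Const c)
  then show ?case by (simp add: const ringhom_simps[OF \<phi>])
next
  case (Var j)
  have "(\<Sum>i\<in>UNIV. \<phi> (pd i (Var j)) * \<delta> (Var i)) = (\<Sum>i\<in>UNIV. if i = j then \<delta> (Var j) else 0)"
    by (intro sum.cong) (auto simp: pd_Var ringhom_simps[OF \<phi>])
  then show ?case by simp
next
  case (add p q)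
  then show ?case
    by (simp add: assms pd_add ringhom_simps[OF \<phi>] distrib_right sum.distrib)
next
  case (mult p q)
  show ?case
    by (simp add: assms(2) pd_mult ringhom_simps[OF \<phi>] distrib_right sum.distrib mult
        sum_distrib_left sum_distrib_right algebra_simps)
qed

lemma derivation_power:
  fixes \<delta> :: "'a::comm_ring_1 \<Rightarrow> 'a"
  assumes "\<And>p q. \<delta> (p * q) = \<delta> p * q + p * \<delta> q"
  shows "\<delta> (p ^ n) = of_nat n * p ^ (n - 1) * \<delta> p"
proof (induction n)
  case 0
  have "\<delta> 1 = \<delta> 1 + \<delta> 1" using assms[of 1 1] by simp
  then show ?case by simp
next
  case (Suc n)
  then show ?case by (cases n) (auto simp: assms algebra_simps)
qed

lemma pd_subst: "pd i (subst \<sigma> p) = (\<Sum>j\<in>UNIV. subst \<sigma> (pd j p) * pd i (\<sigma> j))"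
  for p :: "'v::finite mpoly"
  using derivation_chain[of "\<lambda>p. pd i (subst \<sigma> p)" "subst \<sigma>" p]
  by (simp add: subst_simps pd_add pd_mult ringhom_subst)

section \<open>Homogeneous polynomials\<close>

text \<open>
  Homogeneity is expressed by the torus action; integer weights make the statement that there is no
  nonzero polynomial of negative degree available without case distinctions.
\<close>

definition hom :: "int \<Rightarrow> 'v mpoly \<Rightarrow> bool" where
  "hom d p \<longleftrightarrow> (\<forall>t. t \<noteq> 0 \<longrightarrow> subst (\<lambda>i. Const t * Var i) p = Const (t powi d) * p)"

lemma lookup_Const_mult: "Poly_Mapping.lookup (Const c * p) k = c * Poly_Mapping.lookup p k"
proof (induction p rule: poly_mapping_add_induct)
  case (single l d)
  then show ?case by (simp add: Const_def mult_single lookup_single when_def)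
qed (auto simp: algebra_simps lookup_add)

lemma mon_degree_add: "mon_degree (k + l) = mon_degree k + mon_degree l"
proof -
  have *: "mon_degree m = (\<Sum>i\<in>Poly_Mapping.keys k \<union> Poly_Mapping.keys l. Poly_Mapping.lookup m i)"
    if "Poly_Mapping.keys m \<subseteq> Poly_Mapping.keys k \<union> Poly_Mapping.keys l" for m
    unfolding mon_degree_def using that by (intro sum.mono_neutral_left) (auto simp: in_keys_iff)
  show ?thesis
    by (subst (1 2 3) *) (auto simp: keys_add lookup_add sum.distrib in_keys_iff)
qed

lemma subst_scale_single:
  "subst (\<lambda>i. Const t * Var i) (Poly_Mapping.single k c) = Const (t ^ mon_degree k) * Poly_Mapping.single k c"
proof -
  have 1: "subst (\<lambda>i. Const t * Var i) (Poly_Mapping.single k 1) = Const (t ^ mon_degree k) * Poly_Mapping.single k 1"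
  proof (induction k rule: poly_mapping_add_induct)
    case zero
    then show ?case by (simp add: subst_simps mon_degree_def Const_simps)
  next
    case (single i n)
    have "subst (\<lambda>i. Const t * Var i) (Var i ^ n) = Const (t ^ n) * Var i ^ n"
      by (simp add: subst_simps power_mult_distrib Const_simps)
    then show ?case by (simp add: Var_power mon_degree_def)
  next
    case (add p q)
    have "subst (\<lambda>i. Const t * Var i) (Poly_Mapping.single p 1 * Poly_Mapping.single q 1)
        = Const (t ^ mon_degree (p + q)) * (Poly_Mapping.single p 1 * Poly_Mapping.single q 1)"
      unfolding subst_simps add by (simp add: mon_degree_add power_add Const_simps algebra_simps)
    then show ?case by (simp add: mult_single)
  qed
  have "Poly_Mapping.single k c = Const c * Poly_Mapping.single k 1"
    by (simp add: Const_def mult_single)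
  then show ?thesis using 1 by (simp add: subst_simps mult.left_commute)
qed

lemma lookup_subst_scale:
  "Poly_Mapping.lookup (subst (\<lambda>i. Const t * Var i) p) k = t ^ mon_degree k * Poly_Mapping.lookup p k"
proof (induction p rule: poly_mapping_add_induct)
  case (single l c)
  then show ?case
    by (auto simp: subst_scale_single lookup_Const_mult lookup_single when_def)
qed (auto simp: subst_simps lookup_add algebra_simps)

lemma homogeneous_imp_hom: "homogeneous p \<Longrightarrow> hom (int (total_degree p)) p"
  unfolding hom_def
proof (intro allI impI poly_mapping_eqI)
  fix t :: complex and k
  assume "homogeneous p" "t \<noteq> 0"
  then show "Poly_Mapping.lookup (subst (\<lambda>i. Const t * Var i) p) k
      = Poly_Mapping.lookup (Const (t powi int (total_degree p)) * p) k"
    by (cases "k \<in> Poly_Mapping.keys p")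
      (auto simp: homogeneous_def lookup_Const_mult lookup_subst_scale in_keys_iff)
qed

text \<open>The scalar t = 2 already separates degrees, since powers of 2 with distinct integer
  exponents differ; taking norms moves the comparison to the reals, where monotonicity
  applies.\<close>

lemma hom_lookup:
  assumes "hom d p" "Poly_Mapping.lookup p k \<noteq> 0"
  shows "d = int (mon_degree k)"
proof -
  have "(2::complex) ^ mon_degree k = 2 powi d"
    using assms(1)[unfolded hom_def, rule_format, of 2] lookup_subst_scale[of 2 p k] assms(2)
    by (simp add: lookup_Const_mult)
  then have "norm ((2::complex) powi int (mon_degree k)) = norm ((2::complex) powi d)"
    by simp
  then have *: "(2::real) powi int (mon_degree k) = 2 powi d"
    unfolding norm_power_int by simp
  show ?thesis
  proof (rule linorder_cases[of d "int (mon_degree k)"])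
    assume "d < int (mon_degree k)"
    then have "(2::real) powi d < 2 powi int (mon_degree k)"
      by (rule power_int_strict_increasing) simp
    with * show ?thesis by simp
  next
    assume "int (mon_degree k) < d"
    then have "(2::real) powi int (mon_degree k) < 2 powi d"
      by (rule power_int_strict_increasing) simp
    with * show ?thesis by simp
  qed
qed

lemma hom_negative: "hom d p \<Longrightarrow> d < 0 \<Longrightarrow> p = 0"
  using hom_lookup[of d p] by (intro poly_mapping_eqI) force

lemma hom_degree_0:
  assumes "hom 0 p"
  obtains c where "p = Const c"
proof
  show "p = Const (Poly_Mapping.lookup p 0)"
  proof (intro poly_mapping_eqI)
    fix k
    have "k = 0" if "Poly_Mapping.lookup p k \<noteq> 0"
    proof (intro poly_mapping_eqI)
      fix j
      have "mon_degree k = 0" using hom_lookup[OF assms that] by simp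
      then show "Poly_Mapping.lookup k j = Poly_Mapping.lookup 0 j"
        by (cases "j \<in> Poly_Mapping.keys k") (auto simp: mon_degree_def in_keys_iff)
    qed
    then show "Poly_Mapping.lookup p k = Poly_Mapping.lookup (Const (Poly_Mapping.lookup p 0)) k"
      by (auto simp: Const_def lookup_single when_def)
  qed
qed

lemma hom_unique:
  assumes "hom d p" "hom e p" "p \<noteq> 0"
  shows "d = e"
proof -
  obtain k where "Poly_Mapping.lookup p k \<noteq> 0"
    using assms(3) poly_mapping_eqI[of p 0] by auto
  then show ?thesis using assms(1,2) hom_lookup by metis
qed

lemma hom_0 [simp]: "hom d 0"
  by (simp add: hom_def subst_simps)

lemma hom_Const: "hom 0 (Const c)"
  by (simp add: hom_def Const_simps)

lemma hom_Var: "hom 1 (Var i)"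
  by (simp add: hom_def)

lemma hom_add: "hom d p \<Longrightarrow> hom d q \<Longrightarrow> hom d (p + q)"
  by (simp add: hom_def subst_simps algebra_simps)

lemma hom_sum: "(\<And>i. i \<in> I \<Longrightarrow> hom d (g i)) \<Longrightarrow> hom d (sum g I)"
  by (induction I rule: infinite_finite_induct) (auto simp: hom_add)

lemma hom_mult: "hom d p \<Longrightarrow> hom e q \<Longrightarrow> hom (d + e) (p * q)"
  by (simp add: hom_def subst_simps power_int_add Const_simps algebra_simps)

lemma hom_Const_mult: "hom d p \<Longrightarrow> hom d (Const c * p)"
  using hom_mult[OF hom_Const] by fastforce

lemma hom_prod: "(\<And>i. i \<in> I \<Longrightarrow> hom (d i) (g i)) \<Longrightarrow> hom (\<Sum>i\<in>I. d i) (\<Prod>i\<in>I. g i)"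
  using hom_Const[of 1]
  by (induction I rule: infinite_finite_induct) (auto simp: hom_mult Const_simps)

text \<open>Cancelling in the scaling identity gives a degree to every quotient, in particular to
  quotients by the Jacobian; such a degree may come out negative, and then the quotient is
  zero.\<close>

lemma hom_cancel:
  fixes p :: "'v::linorder mpoly"
  assumes "hom d p" "hom (d + e) (p * q)" "p \<noteq> 0"
  shows "hom e q"
  unfolding hom_def
proof (intro allI impI)
  fix t :: complex assume t: "t \<noteq> 0"
  let ?s = "subst (\<lambda>i. Const t * Var i)"
  have "Const (t powi d) * p * ?s q = Const (t powi d) * p * (Const (t powi e) * q)"
    using assms(1,2) t by (simp add: hom_def subst_simps power_int_add Const_simps algebra_simps)
  moreover have "Const (t powi d) * p \<noteq> 0"
    using assms(3) t by simp
  ultimately show "?s q = Const (t powi e) * q"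
    using mult_left_cancel by blast
qed

text \<open>Differentiate the scaling identity by the chain rule and cancel t.\<close>

lemma hom_pd:
  fixes p :: "'v::{finite,linorder} mpoly"
  assumes "hom d p"
  shows "hom (d - 1) (pd i p)"
  unfolding hom_def
proof (intro allI impI)
  fix t :: complex assume t: "t \<noteq> 0"
  let ?s = "subst (\<lambda>i. Const t * Var i)"
  have "Const t * ?s (pd i p) = (\<Sum>j\<in>UNIV. if j = i then ?s (pd j p) * Const t else 0)"
    by (simp add: mult.commute)
  also have "\<dots> = (\<Sum>j\<in>UNIV. ?s (pd j p) * pd i (Const t * Var j))"
    by (intro sum.cong refl) (auto simp: pd_mult pd_Var)
  also have "\<dots> = pd i (?s p)"
    by (simp only: pd_subst)
  also have "\<dots> = Const (t powi d) * pd i p"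
    using assms t by (simp add: hom_def pd_mult)
  also have "t powi d = t * t powi (d - 1)"
    using power_int_add_1'[of t "d - 1"] t by simp
  finally have "Const t * ?s (pd i p) = Const t * (Const (t powi (d - 1)) * pd i p)"
    by (simp add: Const_simps mult.assoc)
  moreover have "Const t \<noteq> (0::'v mpoly)" using t by simp
  ultimately show "?s (pd i p) = Const (t powi (d - 1)) * pd i p"
    using mult_left_cancel by blast
qed

text \<open>Every term of the Leibniz expansion meets each row and each column once, so all terms
  have the same total weight.\<close>

lemma hom_det:
  fixes M :: "'v mpoly ^ 'n ^ 'n"
  assumes "\<And>i j. hom (a i + b j) (M $ i $ j)"
  shows "hom (sum a UNIV + sum b UNIV) (det M)"
proof -
  have "hom (sum a UNIV + sum b UNIV) (of_int (sign p) * (\<Prod>i\<in>UNIV. M $ i $ p i))"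
    if "p permutes (UNIV :: 'n set)" for p
  proof -
    have "sum b UNIV = (\<Sum>i\<in>UNIV. b (p i))"
      using sum.permute[OF that, of b] by simp
    then have "hom (sum a UNIV + sum b UNIV) (\<Prod>i\<in>UNIV. M $ i $ p i)"
      using hom_prod[of UNIV "\<lambda>i. a i + b (p i)" "\<lambda>i. M $ i $ p i"] assms by (simp add: sum.distrib)
    then show ?thesis
      using hom_Const_mult[of _ _ "of_int (sign p)"] by (simp add: Const_simps)
  qed
  then show ?thesis unfolding det_def by (intro hom_sum) auto
qed

section \<open>Linear forms\<close>

lemma subst_linear_form: "subst \<sigma> (linear_form a) = (\<Sum>i\<in>UNIV. Const (a $ i) * \<sigma> i)"
  by (simp add: linear_form_def subst_simps)

lemma linear_form_add: "linear_form (a + b) = linear_form a + linear_form b"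
  by (simp add: linear_form_def Const_simps distrib_right sum.distrib)

lemma linear_form_diff: "linear_form (a - b) = linear_form a - linear_form b"
  by (simp add: linear_form_def Const_simps left_diff_distrib sum_subtractf)

lemma linear_form_scale: "linear_form (c *s a) = Const c * linear_form a"
  by (simp add: linear_form_def Const_simps sum_distrib_left mult.assoc)

lemma linear_form_0 [simp]: "linear_form 0 = 0"
  by (simp add: linear_form_def Const_simps)

lemma pd_linear_form: "pd i (linear_form a) = Const (a $ i)"
proof -
  have "pd i (linear_form a) = (\<Sum>j\<in>UNIV. if j = i then Const (a $ i) else 0)"
    unfolding linear_form_def pd_sum by (intro sum.cong) (auto simp: pd_mult pd_Var)
  then show ?thesis by simp
qed

lemma linear_form_inject [simp]: "linear_form a = linear_form b \<longleftrightarrow> a = b"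
  by (metis Const_inject pd_linear_form vec_eq_iff)

lemma linear_form_eq_0_iff [simp]: "linear_form a = 0 \<longleftrightarrow> a = 0"
  by (metis linear_form_0 linear_form_inject)

lemma hom_linear_form: "hom 1 (linear_form a)"
  unfolding linear_form_def by (intro hom_sum hom_Const_mult hom_Var)

lemma linear_form_axis: "linear_form (axis i 1) = Var i"
proof -
  have "linear_form (axis i 1) = (\<Sum>j\<in>UNIV. if j = i then Var j else 0)"
    unfolding linear_form_def by (intro sum.cong) (auto simp: axis_def Const_simps)
  then show ?thesis by simp
qed

text \<open>Solves the equation \<open>linear_form a = 0\<close> for the variable \<open>i0\<close>,
  so that substituting is reduction modulo \<open>linear_form a\<close>; this makes sense when
  \<open>a $ i0 \<noteq> 0\<close>.\<close>

definition kill :: "complex^'v \<Rightarrow> 'v \<Rightarrow> 'v \<Rightarrow> 'v mpoly" where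
  "kill a i0 i = (if i = i0 then Var i - Const (1 / a $ i0) * linear_form a else Var i)"

lemma subst_kill_linear_form:
  assumes "a $ i0 \<noteq> 0"
  shows "subst (kill a i0) (linear_form b)
    = linear_form b - Const (b $ i0 / a $ i0) * linear_form a"
proof -
  have "subst (kill a i0) (linear_form b)
      = (\<Sum>i\<in>UNIV. Const (b $ i) * Var i - (if i = i0 then Const (b $ i0 / a $ i0) * linear_form a else 0))"
    unfolding subst_linear_form
    by (intro sum.cong) (auto simp: kill_def right_diff_distrib divide_inverse Const_simps mult.assoc)
  then show ?thesis by (simp add: sum_subtractf linear_form_def)
qed

lemma linear_form_dvd_iff:
  assumes "a $ i0 \<noteq> 0"
  shows "linear_form a dvd p \<longleftrightarrow> subst (kill a i0) p = 0"
proof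
  assume "linear_form a dvd p"
  then show "subst (kill a i0) p = 0"
    using assms by (auto simp: dvd_def subst_simps subst_kill_linear_form Const_simps)
next
  assume *: "subst (kill a i0) p = 0"
  have "linear_form a dvd p - subst (kill a i0) p"
    by (rule dvd_diff_subst) (auto simp: kill_def)
  then show "linear_form a dvd p" using * by simp
qed

text \<open>The multiples of the form are the kernel of a ring homomorphism into a domain.\<close>

lemma prime_elem_linear_form:
  fixes a :: "complex^'v::{finite,linorder}"
  assumes "a \<noteq> 0"
  shows "prime_elem (linear_form a)"
proof -
  obtain i0 where i0: "a $ i0 \<noteq> 0" using assms by (auto simp: vec_eq_iff)
  show ?thesis
    unfolding prime_elem_def linear_form_dvd_iff[of a, OF i0]
    using assms by (simp add: subst_simps)
qed

lemma linear_form_dvd_linear_form: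
  fixes a :: "complex^'v::finite"
  assumes "a \<noteq> 0"
  shows "linear_form a dvd linear_form b \<longleftrightarrow> (\<exists>c. b = c *s a)"
proof
  obtain i0 where i0: "a $ i0 \<noteq> 0" using assms by (auto simp: vec_eq_iff)
  assume "linear_form a dvd linear_form b"
  then have "linear_form b = linear_form ((b $ i0 / a $ i0) *s a)"
    using i0 by (simp add: linear_form_dvd_iff[OF i0] subst_kill_linear_form linear_form_scale)
  then show "\<exists>c. b = c *s a" by auto
qed (auto simp: linear_form_scale)

text \<open>Repeated division stops because each step lowers the total degree.\<close>

lemma linear_form_multiplicity:
  fixes f :: "'v::{finite,linorder} mpoly"
  assumes "a \<noteq> 0" "f \<noteq> 0"
  obtains k g where "f = linear_form a ^ k * g" "\<not> linear_form a dvd g"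
proof -
  \<comment> \<open>\<open>h\<close> sends each variable x to x T for a new variable T. The degree
    in T is the total degree, and T = 1 recovers the polynomial, so \<open>h\<close> loses
    nothing.\<close>
  define h :: "'v mpoly \<Rightarrow> 'v mpoly poly" where
    "h = poly_eval (\<lambda>c. [:Const c:]) (\<lambda>i. [:0, Var i:])"
  have C: "ringhom (\<lambda>c. [:Const c:] :: 'v mpoly poly)"
    by (auto simp: ringhom_def Const_simps)
  have h: "ringhom h" unfolding h_def by (intro ringhom_poly_eval C)
  have hp: "poly (h p) 1 = p" for p
  proof (rule ringhom_eqI[of "\<lambda>p. poly (h p) 1" "\<lambda>p. p"])
    show "ringhom (\<lambda>p. poly (h p) 1)" using h by (auto simp: ringhom_def)
  qed (auto simp: ringhom_def h_def poly_eval_Const[OF C] poly_eval_Var[OF C])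
  have "h (linear_form a) = (\<Sum>i\<in>UNIV. h (Const (a $ i)) * h (Var i))"
    unfolding linear_form_def by (simp add: ringhom_simps[OF h])
  also have "\<dots> = (\<Sum>i\<in>UNIV. [:0, Const (a $ i) * Var i:])"
    by (simp add: h_def poly_eval_Const[OF C] poly_eval_Var[OF C] mult.commute)
  also have "\<dots> = [:0, linear_form a:]"
    by (intro poly_eqI) (auto simp: coeff_sum coeff_pCons linear_form_def split: nat.split)
  finally have ha: "h (linear_form a) = [:0, linear_form a:]" .
  have deg: "degree (h (linear_form a * g)) = Suc (degree (h g))" if "g \<noteq> 0" for g
  proof -
    have "h g \<noteq> 0" using hp[of g] that by auto
    then show ?thesis using assms(1) by (simp add: ringhom_mult[OF h] ha degree_mult_eq)
  qed
  have "\<exists>k g. f = linear_form a ^ k * g \<and> \<not> linear_form a dvd g" using assms(2)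
  proof (induction "degree (h f)" arbitrary: f rule: less_induct)
    case less
    show ?case
    proof (cases "linear_form a dvd f")
      case False
      then show ?thesis by (intro exI[of _ 0] exI[of _ f]) auto
    next
      case True
      then obtain g where g: "f = linear_form a * g" by (auto simp: dvd_def)
      with less.prems have "g \<noteq> 0" by auto
      with g deg[of g] less.hyps[of g] obtain k g' where
        "g = linear_form a ^ k * g'" "\<not> linear_form a dvd g'" by auto
      then show ?thesis using g by (intro exI[of _ "Suc k"] exI[of _ g']) (auto simp: mult.assoc)
    qed
  qed
  then show ?thesis using that by blast
qed

section \<open>Real covectors as complex linear forms\<close>

definition cvec :: "real^'n \<Rightarrow> complex^'n" where
  "cvec a = (\<chi> i. complex_of_real (a $ i))"

abbreviation lin :: "real^'n \<Rightarrow> 'n mpoly" where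
  "lin a \<equiv> linear_form (cvec a)"

lemma cvec_add: "cvec (a + b) = cvec a + cvec b"
  and cvec_diff: "cvec (a - b) = cvec a - cvec b"
  and cvec_scale: "cvec (c *\<^sub>R a) = complex_of_real c *s cvec a"
  and cvec_0 [simp]: "cvec 0 = 0"
  by (auto simp: cvec_def vec_eq_iff)

lemma cvec_nth [simp]: "cvec a $ i = complex_of_real (a $ i)"
  by (simp add: cvec_def)

lemma cvec_inject [simp]: "cvec a = cvec b \<longleftrightarrow> a = b"
  by (auto simp: cvec_def vec_eq_iff)

lemma cvec_eq_0_iff [simp]: "cvec a = 0 \<longleftrightarrow> a = 0"
  by (metis cvec_0 cvec_inject)

lemma lin_dvd_lin:
  fixes a :: "real^'n::finite"
  assumes "a \<noteq> 0"
  shows "lin a dvd lin b \<longleftrightarrow> (\<exists>c. b = c *\<^sub>R a)"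
proof
  assume "lin a dvd lin b"
  then obtain c where c: "cvec b = c *s cvec a"
    using assms by (subst (asm) linear_form_dvd_linear_form) auto
  then have "complex_of_real (b $ i) = c * complex_of_real (a $ i)" for i
    by (metis cvec_nth vector_smult_component)
  \<comment> \<open>The factor \<open>c\<close> is complex, but both vectors are real, so its real
    part serves as well.\<close>
  then have "Re (complex_of_real (b $ i)) = Re (c * complex_of_real (a $ i))" for i
    by simp
  then have "b $ i = Re c * a $ i" for i
    by simp
  then show "\<exists>c. b = c *\<^sub>R a" by (auto simp: vec_eq_iff)
next
  assume "\<exists>c. b = c *\<^sub>R a"
  then show "lin a dvd lin b" by (auto simp: cvec_scale linear_form_scale)
qed

section \<open>Linear algebra\<close>

text \<open>Two different parameters in \<open>V\<close> would put first \<open>z\<close> and then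
  \<open>x\<close> into \<open>V\<close>.\<close>

lemma finite_line_meets_subspace:
  fixes x z :: "'a::real_vector"
  assumes "subspace V" "\<not> (x \<in> V \<and> z \<in> V)"
  shows "finite {t. x + t *\<^sub>R z \<in> V}"
proof (rule ccontr)
  assume inf: "infinite {t. x + t *\<^sub>R z \<in> V}"
  then obtain t where t: "x + t *\<^sub>R z \<in> V" using not_finite_existsD by blast
  have "infinite ({t. x + t *\<^sub>R z \<in> V} - {t})" using inf by simp
  then obtain u where u: "x + u *\<^sub>R z \<in> V" "u \<noteq> t"
    using infinite_imp_nonempty by blast
  have "(x + u *\<^sub>R z) - (x + t *\<^sub>R z) \<in> V" using t u(1) assms(1) by (rule_tac subspace_diff)
  moreover have "(x + u *\<^sub>R z) - (x + t *\<^sub>R z) = (u - t) *\<^sub>R z"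
    by (simp add: scaleR_left_diff_distrib)
  ultimately have "inverse (u - t) *\<^sub>R ((u - t) *\<^sub>R z) \<in> V"
    using subspace_scale[OF assms(1)] by metis
  then have z: "z \<in> V" using u(2) by simp
  have "(x + t *\<^sub>R z) - t *\<^sub>R z \<in> V" using t z assms(1) by (intro subspace_diff subspace_scale)
  then show False using z assms(2) by simp
qed

lemma finite_line_meets_subspaces:
  fixes x z :: "'a::real_vector"
  assumes "finite F" "\<And>V. V \<in> F \<Longrightarrow> subspace V \<and> \<not> (x \<in> V \<and> z \<in> V)"
  shows "\<exists>t. t \<noteq> 0 \<and> (\<forall>V\<in>F. x + t *\<^sub>R z \<notin> V)"
proof -
  have "finite (insert 0 (\<Union>V\<in>F. {t. x + t *\<^sub>R z \<in> V}))"
    using assms finite_line_meets_subspace by auto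
  then obtain t :: real where "t \<notin> insert 0 (\<Union>V\<in>F. {t. x + t *\<^sub>R z \<in> V})"
    using ex_new_if_finite[OF infinite_UNIV_char_0] by blast
  then show ?thesis by auto
qed

text \<open>If the vector \<open>x\<close> that avoids the earlier subspaces lies in the new one,
  take \<open>y\<close> outside the new one: almost every point of the line through \<open>y\<close>
  in direction \<open>x\<close> avoids all of them.\<close>

lemma subspace_avoids_subspaces:
  fixes X :: "'a::real_vector set"
  assumes "finite F" "subspace X" "\<And>U. U \<in> F \<Longrightarrow> subspace U \<and> \<not> X \<subseteq> U"
  shows "\<exists>x\<in>X. \<forall>U\<in>F. x \<notin> U"
  using assms
proof (induction F rule: finite_induct)
  case empty
  then show ?case using subspace_0 by auto
next
  case (insert U F)
  then obtain x where x: "x \<in> X" "\<forall>U\<in>F. x \<notin> U" by blast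
  obtain y where y: "y \<in> X" "y \<notin> U" using insert.prems by blast
  show ?case
  proof (cases "x \<in> U")
    case True
    obtain t where t: "\<forall>V\<in>F. y + t *\<^sub>R x \<notin> V"
      using finite_line_meets_subspaces[of F y x] insert x by blast
    have "y + t *\<^sub>R x \<notin> U"
    proof
      assume "y + t *\<^sub>R x \<in> U"
      then have "(y + t *\<^sub>R x) - t *\<^sub>R x \<in> U"
        using True insert.prems(2)[of U] by (intro subspace_diff subspace_scale) auto
      then show False using y by simp
    qed
    then show ?thesis
      using t x(1) y(1) \<open>subspace X\<close> by (intro bexI[of _ "y + t *\<^sub>R x"]) (auto intro: subspace_add subspace_scale)
  next
    case False
    then show ?thesis using x by blast
  qed
qed

text \<open>Any \<open>z\<close> is a multiple of the difference of \<open>x + t z\<close> and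
  \<open>x\<close>, both generic. This supplies bases in general position.\<close>

lemma subspace_avoiding_span:
  fixes X :: "'a::real_vector set"
  assumes "finite F" "subspace X" "\<And>U. U \<in> F \<Longrightarrow> subspace U \<and> \<not> X \<subseteq> U"
  shows "X \<subseteq> span (X - \<Union>F)"
proof
  fix z assume z: "z \<in> X"
  obtain x where x: "x \<in> X" "\<forall>U\<in>F. x \<notin> U" using subspace_avoids_subspaces[OF assms] by blast
  then obtain t where t: "t \<noteq> 0" "\<forall>V\<in>F. x + t *\<^sub>R z \<notin> V"
    using finite_line_meets_subspaces[of F x z] assms by blast
  have "x + t *\<^sub>R z \<in> X" using x(1) z assms(2) by (intro subspace_add subspace_scale)
  then have "inverse t *\<^sub>R ((x + t *\<^sub>R z) - x) \<in> span (X - \<Union>F)"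
    using x t by (intro span_scale span_diff span_base) auto
  then show "z \<in> span (X - \<Union>F)" using t by simp
qed

lemma det_basis_nonzero:
  fixes h :: "'n \<Rightarrow> real^'n"
  assumes "span (range h) = UNIV"
  shows "det (\<chi> i. h i) \<noteq> 0"
proof -
  have "rows (\<chi> i. h i) = range h" by (auto simp: rows_def row_def vec_lambda_eta)
  then have "\<exists>B. B ** (\<chi> i. h i) = mat 1"
    using assms by (simp add: matrix_left_invertible_span_rows)
  then show ?thesis
    using invertible_det_nz invertible_left_inverse by blast
qed

lemma spanning_set_basis:
  fixes S :: "(real^'n) set"
  assumes "span S = UNIV"
  obtains M :: "real^'n^'n" where "\<And>i. M $ i \<in> S" "det M \<noteq> 0"
proof -
  obtain B where B: "B \<subseteq> S" "independent B" "S \<subseteq> span B" by (rule maximal_independent_subset)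
  then have sB: "span B = UNIV" using assms span_minimal[OF B(3) subspace_span] by auto
  have "card B = CARD('n)"
    using dim_eq_card[of B UNIV] B(2) sB by simp
  moreover have "finite B" using B(2) independent_imp_finite by blast
  ultimately obtain h :: "'n \<Rightarrow> _" where h: "bij_betw h UNIV B"
    using bij_betw_iff_card[of "UNIV :: 'n set" B] by auto
  have "det (\<chi> i. h i) \<noteq> 0" using det_basis_nonzero[of h] h sB by (simp add: bij_betw_def)
  then show ?thesis using that[of "\<chi> i. h i"] h B(1) by (auto simp: bij_betw_def)
qed

text \<open>Adapted to one reflection: it serves for the determinant of a reflection and, with rows
  in general position, for the order of the Jacobian along a mirror.\<close>

lemma hyperplane_basis:
  fixes r v :: "real^'n"
  assumes "v \<bullet> r \<noteq> 0" "S \<subseteq> {x. x \<bullet> r = 0}" "{x. x \<bullet> r = 0} \<subseteq> span S"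
  obtains M :: "real^'n^'n" and i0 where "M $ i0 = v" "\<And>i. i \<noteq> i0 \<Longrightarrow> M $ i \<in> S" "det M \<noteq> 0"
proof -
  obtain B where B: "B \<subseteq> S" "independent B" "S \<subseteq> span B" by (rule maximal_independent_subset)
  have r: "r \<noteq> 0" using assms(1) by auto
  have sub: "subspace {x. x \<bullet> r = 0}" using subspace_hyperplane[of r] by (simp add: inner_commute)
  have sB: "span B = {x. x \<bullet> r = 0}"
  proof
    show "span B \<subseteq> {x. x \<bullet> r = 0}" using B(1) assms(2) by (intro span_minimal sub) auto
    show "{x. x \<bullet> r = 0} \<subseteq> span B" using assms(3) span_minimal[OF B(3) subspace_span] by auto
  qed
  have v: "v \<notin> span B" using sB assms(1) by simp
  have fB: "finite B" using B(2) independent_imp_finite by blast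
  have ind: "independent (insert v B)" using v B(2) by (rule independent_insertI)
  have s: "span (insert v B) = UNIV"
  proof -
    have "x \<in> span (insert v B)" for x
    proof -
      have "x - ((x \<bullet> r) / (v \<bullet> r)) *\<^sub>R v \<in> span B"
        using assms(1) by (simp add: sB inner_diff_left)
      then have "x - ((x \<bullet> r) / (v \<bullet> r)) *\<^sub>R v \<in> span (insert v B)"
        by (rule set_mp[OF span_mono, rotated]) auto
      then have "(x - ((x \<bullet> r) / (v \<bullet> r)) *\<^sub>R v) + ((x \<bullet> r) / (v \<bullet> r)) *\<^sub>R v \<in> span (insert v B)"
        by (rule span_add) (intro span_scale span_base, simp)
      then show ?thesis by simp
    qed
    then show ?thesis by auto
  qed
  have "card (insert v B) = CARD('n)"
    using dim_eq_card[of "insert v B" UNIV] ind s by simp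
  then obtain h :: "'n \<Rightarrow> _" where h: "bij_betw h UNIV (insert v B)"
    using bij_betw_iff_card[of "UNIV :: 'n set" "insert v B"] fB by auto
  have d: "det (\<chi> i. h i) \<noteq> 0" using det_basis_nonzero[of h] h s by (simp add: bij_betw_def)
  have "v \<in> range h" using h by (auto simp: bij_betw_def)
  then obtain i0 where i0: "h i0 = v" by auto
  have "h i \<in> S" if "i \<noteq> i0" for i
  proof -
    have "h i \<noteq> h i0" using that h by (auto simp: bij_betw_def inj_on_def)
    moreover have "h i \<in> insert v B" using h by (auto simp: bij_betw_def)
    ultimately show ?thesis using i0 B(1) by auto
  qed
  then show ?thesis using that[of "\<chi> i. h i" i0] i0 d by auto
qed

lemma matrix_inv_left: "invertible w \<Longrightarrow> matrix_inv w ** w = mat 1"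
  and matrix_inv_right: "invertible w \<Longrightarrow> w ** matrix_inv w = mat 1"
  unfolding invertible_def matrix_inv_def
  by (drule someI_ex, simp)+

lemma matrix_inv_unique:
  fixes w :: "'a::field^'n^'n"
  assumes "v ** w = mat 1"
  shows "matrix_inv w = v"
proof -
  have "invertible w" using assms invertible_left_inverse by blast
  have "matrix_inv w = (v ** w) ** matrix_inv w" using assms by simp
  also have "\<dots> = v ** (w ** matrix_inv w)" by (simp add: matrix_mul_assoc)
  finally show ?thesis using matrix_inv_right[OF \<open>invertible w\<close>] by simp
qed

section \<open>Reflections\<close>

text \<open>The fixed space is a hyperplane, so 1 - s has rank one, and s^2 = 1 forces the
  normalisation \<open>a \<bullet> r = 2\<close>.\<close>

lemma reflection_form:
  fixes s :: "real^'n^'n"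
  assumes "is_reflection s"
  obtains r a where "a \<bullet> r = 2" "\<And>v. s *v v = v - (a \<bullet> v) *\<^sub>R r"
proof -
  have s2: "s *v (s *v v) = v" for v
    using assms by (simp add: is_reflection_def matrix_vector_mul_assoc)
  have sub: "subspace {v. s *v v = v}"
    by (auto simp: subspace_def matrix_vector_right_distrib matrix_vector_mult_scaleR)
  have "dim {v. s *v v = v} = DIM(real^'n) - 1"
    using assms by (simp add: is_reflection_def)
  then obtain a where a: "a \<noteq> 0" "span {v. s *v v = v} = {x. a \<bullet> x = 0}"
    by (rule lowdim_eq_hyperplane)
  then have fixed: "s *v v = v \<longleftrightarrow> a \<bullet> v = 0" for v
    using span_eq_iff[of "{v. s *v v = v}"] sub by auto
  \<comment> \<open>Normalised so that v - s v = (a . v) r holds at v = a, a complement of the fixed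
    hyperplane.\<close>
  define r where "r = (1 / (a \<bullet> a)) *\<^sub>R (a - s *v a)"
  have form: "s *v v = v - (a \<bullet> v) *\<^sub>R r" for v
  proof -
    let ?u = "v - ((a \<bullet> v) / (a \<bullet> a)) *\<^sub>R a"
    have "s *v ?u = ?u" using a(1) by (subst fixed) (simp add: inner_diff_right)
    then have "s *v v - ((a \<bullet> v) / (a \<bullet> a)) *\<^sub>R (s *v a) = ?u"
      by (simp add: matrix_vector_mult_diff_distrib matrix_vector_mult_scaleR)
    then show ?thesis by (simp add: r_def scaleR_diff_right algebra_simps)
  qed
  have "(a \<bullet> a) *\<^sub>R ((2 - a \<bullet> r) *\<^sub>R r) = 0"
  proof -
    have "s *v (a - (a \<bullet> a) *\<^sub>R r) = a" using s2[of a] form[of a] by simp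
    then have "a - (a \<bullet> a) *\<^sub>R r - (a \<bullet> (a - (a \<bullet> a) *\<^sub>R r)) *\<^sub>R r = a" by (simp only: form)
    then show ?thesis by (simp add: inner_diff_right algebra_simps scaleR_2)
  qed
  moreover have "r \<noteq> 0"
    using fixed[of a] form[of a] a(1) by auto
  ultimately have "a \<bullet> r = 2" using a(1) by simp
  then show ?thesis using form that by blast
qed

text \<open>The pair is determined only up to replacing (a, r) by (c a, r / c); one choice is fixed
  once and for all.\<close>

definition root_data :: "real^'n^'n \<Rightarrow> (real^'n) \<times> (real^'n)" where
  "root_data s = (SOME (a, r). a \<bullet> r = 2 \<and> (\<forall>v. s *v v = v - (a \<bullet> v) *\<^sub>R r))"

text \<open>\<open>root_form s\<close> is the linear form vanishing on the mirror, \<open>coroot s\<close> the vector that \<open>s\<close> negates.\<close>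

definition root_form :: "real^'n^'n \<Rightarrow> real^'n" where "root_form s = fst (root_data s)"
definition coroot :: "real^'n^'n \<Rightarrow> real^'n" where "coroot s = snd (root_data s)"

lemma root_coroot:
  assumes "is_reflection s"
  shows "root_form s \<bullet> coroot s = 2" "s *v v = v - (root_form s \<bullet> v) *\<^sub>R coroot s"
proof -
  obtain r a where "a \<bullet> r = 2" "\<And>v. s *v v = v - (a \<bullet> v) *\<^sub>R r"
    using reflection_form[OF assms] by blast
  then have "\<exists>x. case x of (a, r) \<Rightarrow> a \<bullet> r = 2 \<and> (\<forall>v. s *v v = v - (a \<bullet> v) *\<^sub>R r)"
    by (intro exI[of _ "(a, r)"]) auto
  from someI_ex[OF this] show "root_form s \<bullet> coroot s = 2" "s *v v = v - (root_form s \<bullet> v) *\<^sub>R coroot s"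
    by (auto simp: root_data_def[symmetric] root_form_def coroot_def split: prod.splits)
qed

lemma root_nonzero: "is_reflection s \<Longrightarrow> root_form s \<noteq> 0"
  and coroot_nonzero: "is_reflection s \<Longrightarrow> coroot s \<noteq> 0"
  using root_coroot(1) by force+

lemma reflection_nth:
  assumes "is_reflection s"
  shows "s $ i $ j = (if i = j then 1 else 0) - coroot s $ i * root_form s $ j"
proof -
  have "s $ i $ j = (s *v axis j 1) $ i"
    by (simp add: matrix_vector_mult_basis column_def)
  also have "\<dots> = (if i = j then 1 else 0) - coroot s $ i * root_form s $ j"
    unfolding root_coroot(2)[OF assms] inner_axis by (simp add: axis_def)
  finally show ?thesis .
qed

lemma reflection_inv: "is_reflection s \<Longrightarrow> matrix_inv s = s"
  by (intro matrix_inv_unique) (simp add: is_reflection_def)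

lemma reflectionI:
  fixes g :: "real^'n^'n"
  assumes "a \<bullet> r = 2" "\<And>v. g *v v = v - (a \<bullet> v) *\<^sub>R r"
  shows "is_reflection g"
proof -
  have nz: "a \<noteq> 0" "r \<noteq> 0" using assms(1) by auto
  have "g *v (g *v v) = v" for v
    by (simp add: assms inner_diff_right)
  then have "g ** g = mat 1"
    by (simp add: matrix_eq flip: matrix_vector_mul_assoc)
  moreover have "{v. g *v v = v} = {v. a \<bullet> v = 0}"
    using nz by (auto simp: assms)
  ultimately show ?thesis
    using dim_hyperplane[OF nz(1)] by (simp add: is_reflection_def)
qed

text \<open>In a basis made of the coroot and of vectors on the mirror, \<open>s\<close> changes the
  sign of one row and keeps the others.\<close>

lemma det_reflection:
  fixes s :: "real^'n^'n"
  assumes "is_reflection s"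
  shows "det s = -1"
proof -
  let ?X = "{x. x \<bullet> root_form s = 0}"
  have "coroot s \<bullet> root_form s \<noteq> 0" using root_coroot(1)[OF assms] by (simp add: inner_commute)
  then obtain M :: "real^'n^'n" and i0 where
    M: "M $ i0 = coroot s" "\<And>i. i \<noteq> i0 \<Longrightarrow> M $ i \<in> ?X" "det M \<noteq> 0"
    by (rule hyperplane_basis[OF _ order_refl span_superset]) blast
  have "M ** transpose s = (\<chi> i. s *v (M $ i))"
    by (simp add: vec_eq_iff matrix_matrix_mult_def matrix_vector_mult_def transpose_def mult.commute)
  also have "\<dots> = (\<chi> i. if i = i0 then (-1) *s (M $ i0) else M $ i)"
  proof (rule vec_eq_iff[THEN iffD2], rule)
    fix i
    show "(\<chi> i. s *v (M $ i)) $ i = (\<chi> i. if i = i0 then (-1) *s (M $ i0) else M $ i) $ i"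
    proof (cases "i = i0")
      case True
      have "s *v coroot s = - coroot s"
        unfolding root_coroot(2)[OF assms] by (simp add: root_coroot(1)[OF assms] scaleR_2)
      moreover have "(-1) *s coroot s = - coroot s" by (simp add: vec_eq_iff)
      ultimately show ?thesis using True M(1) by simp
    next
      case False
      then show ?thesis using M(2)[of i] by (simp add: root_coroot(2)[OF assms] inner_commute)
    qed
  qed
  finally have *: "M ** transpose s = (\<chi> i. if i = i0 then (-1) *s (M $ i0) else M $ i)" .
  have M0: "(\<chi> i. if i = i0 then M $ i0 else M $ i) = M"
    by (simp add: vec_eq_iff)
  have "det M * det s = - det M"
    using det_mul[of M "transpose s"] det_row_mul[of i0 "-1" "\<lambda>i. M $ i0" "\<lambda>i. M $ i"] M0
    unfolding * by simp
  then have "det M * (det s + 1) = 0" by (simp add: distrib_left)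
  then show ?thesis using M(3) by (simp add: eq_neg_iff_add_eq_0)
qed

lemma mirror_eq:
  fixes s :: "real^'n^'n"
  assumes "is_reflection s"
  shows "mirror s = linear_form_kernel (cvec (root_form s))"
proof -
  have "(complexify s *v v) $ i
      = v $ i - of_real (coroot s $ i) * (\<Sum>j\<in>UNIV. cvec (root_form s) $ j * v $ j)" for v i
  proof -
    have "(complexify s *v v) $ i
        = (\<Sum>j\<in>UNIV. (if i = j then v $ j else 0) - of_real (coroot s $ i) * (cvec (root_form s) $ j * v $ j))"
      unfolding matrix_vector_mult_def complexify_def
      by (auto simp: reflection_nth[OF assms] algebra_simps intro!: sum.cong)
    then show ?thesis by (simp add: sum_subtractf sum_distrib_left)
  qed
  moreover have "\<exists>i. coroot s $ i \<noteq> 0"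
    using coroot_nonzero[OF assms] by (auto simp: vec_eq_iff)
  ultimately show ?thesis
    by (auto simp: mirror_def linear_form_kernel_def vec_eq_iff)
qed

lemma linear_form_kernel_eq:
  fixes a b :: "complex^'n"
  assumes "linear_form_kernel b = linear_form_kernel a" "(\<Sum>i\<in>UNIV. a $ i * r $ i) = 2"
  shows "\<exists>c. c \<noteq> 0 \<and> b = c *s a"
proof -
  define c where "c = (\<Sum>i\<in>UNIV. b $ i * r $ i) / 2"
  have "b $ j = c * a $ j" for j
  proof -
    \<comment> \<open>The vectors \<open>axis j 1 - (a $ j / 2) *s r\<close> are the projections of
      the standard basis along \<open>r\<close> to the kernel of \<open>a\<close>; being in the
      kernel of \<open>b\<close> too, they determine \<open>b\<close> from its value at
      \<open>r\<close>.\<close>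
    have pair: "(\<Sum>i\<in>UNIV. d $ i * (axis j 1 - (a $ j / 2) *s r) $ i)
        = d $ j - a $ j / 2 * (\<Sum>i\<in>UNIV. d $ i * r $ i)" for d :: "complex^'n"
    proof -
      have "(\<Sum>i\<in>UNIV. d $ i * (axis j 1 - (a $ j / 2) *s r) $ i)
          = (\<Sum>i\<in>UNIV. (if i = j then d $ i else 0) - a $ j / 2 * (d $ i * r $ i))"
        by (intro sum.cong) (auto simp: axis_def algebra_simps)
      then show ?thesis by (simp add: sum_subtractf sum_distrib_left)
    qed
    have "axis j 1 - (a $ j / 2) *s r \<in> linear_form_kernel a"
      unfolding linear_form_kernel_def mem_Collect_eq pair assms(2) by simp
    then have "axis j 1 - (a $ j / 2) *s r \<in> linear_form_kernel b"
      by (simp only: assms(1))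
    then show ?thesis
      unfolding linear_form_kernel_def mem_Collect_eq pair by (simp add: c_def field_simps)
  qed
  then have b: "b = c *s a" by (simp add: vec_eq_iff)
  moreover have "r \<notin> linear_form_kernel b"
    unfolding assms(1) using assms(2) by (simp add: linear_form_kernel_def)
  then have "c \<noteq> 0" using b by (auto simp: linear_form_kernel_def)
  ultimately show ?thesis by blast
qed

section \<open>The action on polynomials\<close>

lemma act_eq: "act w = subst (\<lambda>i. linear_form (\<chi> j. complex_of_real (matrix_inv w $ i $ j)))"
  by (simp add: act_def linear_form_def)

lemma ringhom_act: "ringhom (act w)"
  by (simp add: act_eq ringhom_subst)

lemmas act_simps = ringhom_simps[OF ringhom_act]

lemma act_Const [simp]: "act w (Const c) = Const c"
  by (simp add: act_eq)

lemma act_Var: "act w (Var i) = (\<Sum>j\<in>UNIV. Const (complex_of_real (matrix_inv w $ i $ j)) * Var j)"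
  by (simp add: act_def)

lemma act_linear_form:
  "act w (linear_form a) = linear_form (\<chi> j. \<Sum>i\<in>UNIV. a $ i * complex_of_real (matrix_inv w $ i $ j))"
proof -
  have "act w (linear_form a)
      = (\<Sum>i\<in>UNIV. \<Sum>j\<in>UNIV. Const (a $ i) * (Const (complex_of_real (matrix_inv w $ i $ j)) * Var j))"
    by (simp add: linear_form_def act_simps act_Var sum_distrib_left)
  also have "\<dots> = (\<Sum>j\<in>UNIV. \<Sum>i\<in>UNIV. Const (a $ i * complex_of_real (matrix_inv w $ i $ j)) * Var j)"
    by (subst sum.swap) (simp add: Const_simps mult.assoc)
  also have "\<dots> = linear_form (\<chi> j. \<Sum>i\<in>UNIV. a $ i * complex_of_real (matrix_inv w $ i $ j))"
    by (simp add: linear_form_def Const_simps sum_distrib_right)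
  finally show ?thesis .
qed

lemma act_lin: "act w (lin a) = lin (a v* matrix_inv w)"
  by (simp add: act_linear_form vector_matrix_mult_def cvec_def mult.commute)

lemma act_mult:
  assumes "invertible g" "invertible h"
  shows "act (g ** h) p = act g (act h p)"
proof -
  have inv: "matrix_inv (g ** h) = matrix_inv h ** matrix_inv g"
  proof (rule matrix_inv_unique)
    have "(matrix_inv h ** matrix_inv g) ** (g ** h) = matrix_inv h ** (matrix_inv g ** g) ** h"
      by (simp add: matrix_mul_assoc)
    then show "(matrix_inv h ** matrix_inv g) ** (g ** h) = mat 1"
      by (simp add: matrix_inv_left assms)
  qed
  show ?thesis
  proof (rule ringhom_eqI[of "act (g ** h)" "\<lambda>p. act g (act h p)"])
    show "act (g ** h) (Var i) = act g (act h (Var i))" for i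
    proof -
      have "act h (Var i) = linear_form (\<chi> j. complex_of_real (matrix_inv h $ i $ j))"
        by (simp add: act_eq)
      then have "act g (act h (Var i)) = linear_form (\<chi> j. \<Sum>k\<in>UNIV.
          complex_of_real (matrix_inv h $ i $ k) * complex_of_real (matrix_inv g $ k $ j))"
        by (simp only: act_linear_form) simp
      also have "\<dots> = linear_form (\<chi> j. complex_of_real ((matrix_inv h ** matrix_inv g) $ i $ j))"
        by (simp add: matrix_matrix_mult_def)
      also have "\<dots> = act (g ** h) (Var i)"
        by (simp only: act_eq inv subst_Var)
      finally show ?thesis by simp
    qed
  qed (auto simp: ringhom_act ringhom_compose[OF ringhom_act ringhom_act])
qed

lemma act_one: "act (mat 1) p = p"
proof (rule ringhom_eqI[of "act (mat 1)" "\<lambda>p. p"])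
  have "matrix_inv (mat 1) = (mat 1 :: real^'a^'a)" by (rule matrix_inv_unique) simp
  then have "act (mat 1) (Var i) = (\<Sum>j\<in>UNIV. if j = i then Var j else 0)" for i :: 'a
    unfolding act_Var by (intro sum.cong) (auto simp: mat_def Const_simps)
  then show "act (mat 1) (Var i) = Var i" for i :: 'a
    by simp
qed (auto simp: ringhom_act, simp add: ringhom_def)

lemma act_inv:
  assumes "invertible w"
  shows "act w (act (matrix_inv w) p) = p" "act (matrix_inv w) (act w p) = p"
proof -
  have "invertible (matrix_inv w)"
    using matrix_inv_left[OF assms] matrix_inv_right[OF assms] by (auto simp: invertible_def)
  then show "act w (act (matrix_inv w) p) = p" "act (matrix_inv w) (act w p) = p"
    using assms by (simp_all add: matrix_inv_left matrix_inv_right act_one flip: act_mult)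
qed

lemma act_reflection_linear_form:
  assumes "is_reflection s"
  shows "act s (linear_form a)
    = linear_form a - Const (\<Sum>i\<in>UNIV. a $ i * complex_of_real (coroot s $ i)) * lin (root_form s)"
proof -
  have "(\<Sum>i\<in>UNIV. a $ i * complex_of_real (matrix_inv s $ i $ j))
      = a $ j - (\<Sum>i\<in>UNIV. a $ i * complex_of_real (coroot s $ i)) * complex_of_real (root_form s $ j)" for j
  proof -
    have "(\<Sum>i\<in>UNIV. a $ i * complex_of_real (matrix_inv s $ i $ j))
        = (\<Sum>i\<in>UNIV. (if i = j then a $ i else 0)
            - a $ i * complex_of_real (coroot s $ i) * complex_of_real (root_form s $ j))"
      by (auto simp: reflection_inv[OF assms] reflection_nth[OF assms] algebra_simps intro!: sum.cong)
    then show ?thesis by (simp add: sum_subtractf sum_distrib_right)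
  qed
  then have "act s (linear_form a) = linear_form
      (a - (\<Sum>i\<in>UNIV. a $ i * complex_of_real (coroot s $ i)) *s cvec (root_form s))"
    unfolding act_linear_form by (intro arg_cong[where f = linear_form]) (simp add: vec_eq_iff)
  then show ?thesis by (simp add: linear_form_diff linear_form_scale)
qed

text \<open>Modulo its root a reflection fixes all variables, hence all polynomials.\<close>

lemma root_dvd_act_diff:
  assumes "is_reflection s"
  shows "lin (root_form s) dvd p - act s p"
  unfolding act_eq
proof (rule dvd_diff_subst)
  fix i
  have "Var i - act s (Var i) = Const (\<Sum>j\<in>UNIV. axis i 1 $ j * complex_of_real (coroot s $ j)) * lin (root_form s)"
    unfolding linear_form_axis[symmetric] act_reflection_linear_form[OF assms] by simp
  then show "lin (root_form s) dvd Var i - linear_form (\<chi> j. complex_of_real (matrix_inv s $ i $ j))"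
    by (simp add: act_eq)
qed

lemma Const_numeral [simp]: "Const (numeral k) = numeral k"
  by (simp add: Const_def)

text \<open>Here p - s p = 2 p, and 2 is a unit.\<close>

lemma root_dvd_antiinvariant:
  assumes "is_reflection s" "act s p = - p"
  shows "lin (root_form s) dvd p"
proof -
  have "Const 2 * p = p - act s p"
    by (simp add: assms(2))
  then have "lin (root_form s) dvd Const 2 * p"
    by (simp only: root_dvd_act_diff[OF assms(1)])
  then have "lin (root_form s) dvd Const (1/2) * (Const 2 * p)" by (rule dvd_mult)
  also have "Const (1/2) * (Const 2 * p) = Const (1/2 * 2) * p"
    by (simp only: Const_simps(4) mult.assoc)
  also have "\<dots> = p"
    by (simp add: Const_simps(2))
  finally show ?thesis .
qed

section \<open>Irreducible reflection groups\<close>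

abbreviation pairing :: "complex^'n \<Rightarrow> real^'n \<Rightarrow> complex" where
  "pairing a r \<equiv> (\<Sum>i\<in>UNIV. a $ i * complex_of_real (r $ i))"

lemma pairing_cvec: "pairing (cvec a) r = complex_of_real (a \<bullet> r)"
  by (simp add: inner_vec_def)

locale reflection_group =
  fixes W :: "(real^'n::{finite,linorder}^'n::{finite,linorder}) set"
  assumes irreducible_W: "irreducible_reflection_group W"
begin

lemma finite_W: "finite W"
  and one_W: "mat 1 \<in> W"
  and mult_W: "g \<in> W \<Longrightarrow> h \<in> W \<Longrightarrow> g ** h \<in> W"
  and invertible_W: "g \<in> W \<Longrightarrow> invertible g"
  and inv_W: "g \<in> W \<Longrightarrow> matrix_inv g \<in> W"
  using irreducible_W by (auto simp: irreducible_reflection_group_def matrix_group_def)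

lemma W_nonempty: "W \<noteq> {}"
  using one_W by auto

lemma reflectionD: "s \<in> reflections W \<Longrightarrow> is_reflection s" "s \<in> reflections W \<Longrightarrow> s \<in> W"
  by (auto simp: reflections_def)

lemma finite_reflections: "finite (reflections W)"
  using finite_W by (simp add: reflections_def)

lemma W_generated:
  assumes "matrix_group G" "reflections W \<subseteq> G"
  shows "W \<subseteq> G"
  using irreducible_W assms by (auto simp: irreducible_reflection_group_def)

lemma reflections_nonempty: "reflections W \<noteq> {}"
proof
  assume "reflections W = {}"
  moreover have "matrix_inv (mat 1) = (mat 1 :: ((real, 'n) vec, 'n) vec)" by (rule matrix_inv_unique) simp
  then have "matrix_group {mat 1 :: ((real, 'n) vec, 'n) vec}"
    by (auto simp: matrix_group_def invertible_def)
  ultimately have "W \<subseteq> {mat 1}" by (intro W_generated) auto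
  then show False using irreducible_W one_W by (auto simp: irreducible_reflection_group_def)
qed

lemma irreducible:
  assumes "subspace U" "\<And>w u. w \<in> W \<Longrightarrow> u \<in> U \<Longrightarrow> w *v u \<in> U" "u \<in> U" "u \<noteq> 0"
  shows "U = UNIV"
  using irreducible_W assms by (auto simp: irreducible_reflection_group_def)

lemma act_group:
  "g \<in> W \<Longrightarrow> h \<in> W \<Longrightarrow> act (g ** h) p = act g (act h p)"
  by (simp add: act_mult invertible_W)

text \<open>The stabiliser of \<open>p\<close> in \<open>W\<close> is a group containing the
  generators.\<close>

lemma invariant_if_reflection_invariant:
  assumes "\<And>s. s \<in> reflections W \<Longrightarrow> act s p = p" "w \<in> W"
  shows "act w p = p"
proof -
  have "matrix_group {g \<in> W. act g p = p}"
  proof -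
    have "act (matrix_inv g) p = p" if "g \<in> W" "act g p = p" for g
      using act_inv(2)[OF invertible_W[OF that(1)], of p] that(2) by simp
    then show ?thesis
      unfolding matrix_group_def by (auto simp: one_W act_one mult_W act_group inv_W invertible_W)
  qed
  then have "W \<subseteq> {g \<in> W. act g p = p}"
    by (rule W_generated) (use assms(1) reflectionD in auto)
  then show ?thesis using assms(2) by auto
qed

text \<open>The matrices refer to an arbitrary basis, so the standard inner product need not be
  invariant; averaging it over \<open>W\<close> gives an invariant positive definite form.\<close>

definition beta :: "(real, 'n) vec \<Rightarrow> (real, 'n) vec \<Rightarrow> real" where
  "beta u v = (\<Sum>w\<in>W. (w *v u) \<bullet> (w *v v))"

lemma beta_commute: "beta u v = beta v u"
  by (simp add: beta_def inner_commute)

lemma beta_add_left: "beta (u + u') v = beta u v + beta u' v"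
  and beta_diff_left: "beta (u - u') v = beta u v - beta u' v"
  and beta_scale_left: "beta (c *\<^sub>R u) v = c * beta u v"
  and beta_zero_left [simp]: "beta 0 v = 0"
  by (simp_all add: beta_def matrix_vector_right_distrib matrix_vector_mult_diff_distrib
      matrix_vector_mult_scaleR inner_add_left inner_diff_left sum.distrib sum_subtractf sum_distrib_left)

lemma beta_add_right: "beta v (u + u') = beta v u + beta v u'"
  and beta_diff_right: "beta v (u - u') = beta v u - beta v u'"
  and beta_scale_right: "beta v (c *\<^sub>R u) = c * beta v u"
  and beta_zero_right [simp]: "beta v 0 = 0"
  using beta_add_left beta_diff_left beta_scale_left beta_zero_left beta_commute by metis+

lemmas beta_simps = beta_add_left beta_diff_left beta_scale_left
  beta_add_right beta_diff_right beta_scale_right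

lemma beta_sum_left: "beta (sum f I) v = (\<Sum>i\<in>I. beta (f i) v)"
  by (induction I rule: infinite_finite_induct) (auto simp: beta_simps)

lemma beta_sum_right: "beta v (sum f I) = (\<Sum>i\<in>I. beta v (f i))"
  by (induction I rule: infinite_finite_induct) (auto simp: beta_simps)

lemma beta_invariant:
  assumes "g \<in> W"
  shows "beta (g *v u) (g *v v) = beta u v"
  unfolding beta_def
proof (rule sum.reindex_bij_witness[of _ "\<lambda>w. w ** matrix_inv g" "\<lambda>w. w ** g"])
  show "w ** g ** matrix_inv g = w" "w ** matrix_inv g ** g = w" for w
    using invertible_W[OF assms]
    by (simp_all add: matrix_inv_left matrix_inv_right flip: matrix_mul_assoc)
qed (use assms in \<open>auto simp: mult_W inv_W matrix_vector_mul_assoc\<close>)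

lemma beta_pos:
  assumes "v \<noteq> 0"
  shows "beta v v > 0"
proof -
  have "0 < (mat 1 *v v) \<bullet> (mat 1 *v v)" using assms by simp
  also have "\<dots> \<le> beta v v"
    unfolding beta_def by (rule member_le_sum) (auto simp: one_W finite_W)
  finally show ?thesis .
qed

lemma beta_self_eq_0_iff [simp]: "beta v v = 0 \<longleftrightarrow> v = 0"
  using beta_pos[of v] by (cases "v = 0") auto

text \<open>The matrix of \<open>beta\<close>. It carries vectors to covectors equivariantly and
  thus identifies V with its dual; its inverse will turn differentials into gradients.\<close>

definition gram :: "((real, 'n) vec, 'n) vec" where
  "gram = (\<Sum>w\<in>W. transpose w ** w)"

lemma inner_gram: "u \<bullet> (gram *v v) = beta u v"
proof -
  have "(\<Sum>w\<in>F. transpose w ** w) *v v = (\<Sum>w\<in>F. transpose w *v (w *v v))"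
    for F :: "((real, 'n) vec, 'n) vec set"
    by (induction F rule: infinite_finite_induct)
      (auto simp: matrix_vector_mult_add_rdistrib matrix_vector_mul_assoc simp del: transpose_matrix_vector)
  then have "u \<bullet> (gram *v v) = (\<Sum>w\<in>W. u \<bullet> (transpose w *v (w *v v)))"
    by (simp only: gram_def inner_sum_right)
  also have "\<dots> = beta u v"
    unfolding beta_def by (intro sum.cong refl) (metis dot_lmul_matrix inner_commute transpose_matrix_vector)
  finally show ?thesis .
qed

lemma gram_equivariant:
  assumes "w \<in> W"
  shows "gram *v (w *v v) = (gram *v v) v* matrix_inv w"
proof -
  have "u \<bullet> (gram *v (w *v v)) = u \<bullet> ((gram *v v) v* matrix_inv w)" for u
  proof -
    have "w *v (matrix_inv w *v u) = u"
      by (simp add: matrix_vector_mul_assoc matrix_inv_right invertible_W assms)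
    then have "u \<bullet> (gram *v (w *v v)) = beta (w *v (matrix_inv w *v u)) (w *v v)"
      by (simp only: inner_gram)
    also have "\<dots> = (matrix_inv w *v u) \<bullet> (gram *v v)"
      by (simp add: beta_invariant assms inner_gram)
    also have "\<dots> = u \<bullet> ((gram *v v) v* matrix_inv w)"
      by (simp add: dot_lmul_matrix inner_commute[of "matrix_inv w *v u"] inner_commute[of u])
    finally show ?thesis .
  qed
  then show ?thesis using vector_eq_ldot by blast
qed

lemma invertible_gram: "invertible gram"
proof -
  have "v = 0" if "gram *v v = 0" for v
    using inner_gram[of v v] that by simp
  then show ?thesis
    by (simp add: invertible_left_inverse matrix_left_invertible_ker)
qed

text \<open>\<open>s\<close> preserves \<open>beta\<close> and negates the coroot; comparing the
  pairing of the coroot with \<open>v\<close> before and after \<open>s\<close> gives the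
  formula.\<close>

lemma root_form_eq:
  assumes "s \<in> reflections W"
  shows "root_form s \<bullet> v = 2 * beta (coroot s) v / beta (coroot s) (coroot s)"
proof -
  note s = reflectionD[OF assms] root_coroot[OF reflectionD(1)[OF assms]]
  have "s *v coroot s = - coroot s" by (simp add: s scaleR_2)
  then have "beta (- coroot s) (v - (root_form s \<bullet> v) *\<^sub>R coroot s) = beta (coroot s) v"
    using beta_invariant[OF s(2), of "coroot s" v] s(4)[of v] by simp
  then have "- beta (coroot s) v + (root_form s \<bullet> v) * beta (coroot s) (coroot s) = beta (coroot s) v"
    using beta_scale_left[of "-1"] by (simp add: beta_simps)
  moreover have "beta (coroot s) (coroot s) \<noteq> 0" using coroot_nonzero[OF s(1)] by simp
  ultimately show ?thesis by (simp add: field_simps)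
qed

text \<open>The common zero space of the roots is fixed pointwise by every reflection, hence by
  \<open>W\<close>; irreducibility leaves no room for it.\<close>

lemma root_forms_span:
  assumes "\<And>s. s \<in> reflections W \<Longrightarrow> root_form s \<bullet> v = 0"
  shows "v = 0"
proof (rule ccontr)
  assume v: "v \<noteq> 0"
  let ?U = "{v. \<forall>s\<in>reflections W. root_form s \<bullet> v = 0}"
  have "?U = UNIV"
  proof (rule irreducible[of _ v])
    show "subspace ?U" by (auto simp: subspace_def inner_add_right)
    show "w *v u \<in> ?U" if "w \<in> W" "u \<in> ?U" for w u
    proof -
      have 1: "matrix_inv g *v u = u" if "g \<in> W" "g *v u = u" for g
        using matrix_inv_left[OF invertible_W[OF that(1)]] that(2)
        by (metis matrix_vector_mul_assoc matrix_vector_mul_lid)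
      then have "matrix_group {g \<in> W. g *v u = u}"
        by (auto simp: matrix_group_def one_W mult_W inv_W invertible_W simp flip: matrix_vector_mul_assoc)
      moreover have "reflections W \<subseteq> {g \<in> W. g *v u = u}"
        using \<open>u \<in> ?U\<close> by (auto simp: reflectionD root_coroot)
      ultimately have "w *v u = u" using W_generated \<open>w \<in> W\<close> by blast
      then show ?thesis using that by simp
    qed
  qed (use assms v in auto)
  moreover obtain s where s: "s \<in> reflections W" using reflections_nonempty by auto
  ultimately have "root_form s \<bullet> root_form s = 0" by blast
  then show False using root_nonzero[OF reflectionD(1)[OF s]] by simp
qed

lemma coroots_span:
  assumes "\<And>s. s \<in> reflections W \<Longrightarrow> l \<bullet> coroot s = 0"
  shows "l = 0"
proof -
  obtain v where v: "l = gram *v v"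
    by (metis invertible_gram matrix_inv_right matrix_vector_mul_assoc matrix_vector_mul_lid)
  have "v = 0"
  proof (rule root_forms_span)
    fix s assume s: "s \<in> reflections W"
    have "beta (coroot s) v = 0" using assms[OF s] by (simp add: v inner_gram inner_commute)
    then show "root_form s \<bullet> v = 0" by (simp add: root_form_eq s)
  qed
  then show ?thesis by (simp add: v)
qed

lemma pairing_coroots:
  assumes "\<And>s. s \<in> reflections W \<Longrightarrow> pairing a (coroot s) = 0"
  shows "a = 0"
proof -
  have "(\<chi> i. Re (a $ i)) = 0" "(\<chi> i. Im (a $ i)) = 0"
    by (rule coroots_span, use assms in \<open>force simp: inner_vec_def complex_eq_iff\<close>)+
  then show ?thesis by (auto simp: vec_eq_iff complex_eq_iff)
qed

lemma irreducible_dual: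
  assumes "subspace U" "\<And>w u. w \<in> W \<Longrightarrow> u \<in> U \<Longrightarrow> u v* matrix_inv w \<in> U" "u \<in> U" "u \<noteq> 0"
  shows "U = UNIV"
proof -
  have surj: "\<exists>v. x = gram *v v" for x
    by (metis invertible_gram matrix_inv_right matrix_vector_mul_assoc matrix_vector_mul_lid)
  obtain v where v: "u = gram *v v" using surj by blast
  have "{v. gram *v v \<in> U} = UNIV"
  proof (rule irreducible[of _ v])
    show "subspace {v. gram *v v \<in> U}"
      using assms(1) by (auto simp: subspace_def matrix_vector_right_distrib matrix_vector_mult_scaleR)
  qed (use assms v in \<open>auto simp: gram_equivariant\<close>)
  then show ?thesis using surj by (metis UNIV_eq_I mem_Collect_eq UNIV_I)
qed

text \<open>An isometry of a positive definite form that differs from the identity by rank one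
  cannot be a transvection: preserving the length of every \<open>v\<close> forces (l . v)
  \<open>beta u u\<close> = 2 \<open>beta u v\<close>, hence
  \<open>l \<bullet> u = 2\<close>.\<close>

lemma reflection_of_rank_one:
  assumes g: "g \<in> W" "g \<noteq> mat 1" and l: "l \<noteq> 0"
    and rank: "\<And>a. \<exists>c. a - a v* matrix_inv g = c *\<^sub>R l"
  shows "g \<in> reflections W \<and> (\<exists>c. l = c *\<^sub>R root_form g)"
proof -
  define h where "h = matrix_inv g"
  have h: "h \<in> W" using g by (simp add: h_def inv_W)
  have "\<forall>i. \<exists>c. axis i 1 - axis i 1 v* h = c *\<^sub>R l" using rank by (simp add: h_def)
  then obtain u0 where u0: "\<And>i. axis i 1 - axis i 1 v* h = u0 i *\<^sub>R l" by metis
  define u where "u = (\<chi> i. u0 i)"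
  have hv: "h *v v = v - (l \<bullet> v) *\<^sub>R u" for v
  proof (rule vec_eq_iff[THEN iffD2], rule)
    fix i
    have "(axis i 1 - axis i 1 v* h) \<bullet> v = v $ i - (h *v v) $ i"
      by (simp add: inner_diff_left dot_lmul_matrix inner_axis')
    then show "(h *v v) $ i = (v - (l \<bullet> v) *\<^sub>R u) $ i"
      by (simp add: u0 u_def mult.commute)
  qed
  have "u \<noteq> 0"
  proof
    assume "u = 0"
    then have "h = mat 1" by (simp add: matrix_eq hv)
    then have "g = mat 1"
      using matrix_inv_right[OF invertible_W[OF g(1)]] by (simp add: h_def)
    with g show False by simp
  qed
  have key: "(l \<bullet> v) * beta u u = 2 * beta u v" for v
  proof -
    have *: "(l \<bullet> v) * beta u u = 2 * beta u v" if "l \<bullet> v \<noteq> 0" for v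
    proof -
      have "beta (v - (l \<bullet> v) *\<^sub>R u) (v - (l \<bullet> v) *\<^sub>R u) = beta v v"
        using beta_invariant[OF h, of v v] by (simp add: hv)
      then have "(l \<bullet> v) * ((l \<bullet> v) * beta u u - 2 * beta u v) = 0"
        by (simp add: beta_simps beta_commute[of v u] algebra_simps)
      then show ?thesis using that by simp
    qed
    show ?thesis
    proof (cases "l \<bullet> v = 0")
      case True
      \<comment> \<open>The identity is linear in \<open>v\<close>, and \<open>l\<close> and
        \<open>v + l\<close> are both off the hyperplane.\<close>
      have "l \<bullet> l \<noteq> 0" "l \<bullet> (v + l) \<noteq> 0" using l True by (auto simp: inner_add_right)
      from this[THEN *] show ?thesis using True by (simp add: inner_add_right beta_simps)
    qed (use * in blast)
  qed
  have lu: "l \<bullet> u = 2" using \<open>u \<noteq> 0\<close> key[of u] by simp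
  have "is_reflection h" using reflectionI[OF lu hv] by simp
  then have "is_reflection g" "h = g"
    using g(1) reflection_inv[of h] matrix_inv_unique[of g h] matrix_inv_right[of g] invertible_W
    by (auto simp: h_def)
  then have gr: "g \<in> reflections W" using g by (simp add: reflections_def)
  have eq: "(l \<bullet> v) *\<^sub>R u = (root_form g \<bullet> v) *\<^sub>R coroot g" for v
    using hv[of v] root_coroot(2)[OF \<open>is_reflection g\<close>, of v] \<open>h = g\<close> by simp
  define k where "k = (l \<bullet> coroot g) / 2"
  have "2 *\<^sub>R coroot g = (l \<bullet> coroot g) *\<^sub>R u"
    using eq[of "coroot g"] root_coroot(1)[OF \<open>is_reflection g\<close>] by simp
  then have "(1 / 2) *\<^sub>R (2 *\<^sub>R coroot g) = k *\<^sub>R u"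
    by (simp add: k_def)
  then have "coroot g = k *\<^sub>R u" by simp
  then have "(l \<bullet> v) *\<^sub>R u = ((k *\<^sub>R root_form g) \<bullet> v) *\<^sub>R u" for v
    using eq[of v] by (simp add: mult.commute)
  then have "l \<bullet> v = (k *\<^sub>R root_form g) \<bullet> v" for v
    using \<open>u \<noteq> 0\<close> scaleR_cancel_right by blast
  then have "l = k *\<^sub>R root_form g" using vector_eq_rdot by blast
  then show ?thesis using gr by blast
qed

text \<open>For \<open>v\<close> on the mirror, h v - v is killed by all covectors that kill the
  coroot, so it is a multiple of the coroot; as \<open>v\<close> and the coroot are orthogonal,
  lengths force this multiple to be zero. So \<open>h\<close> fixes the mirror and maps the coroot
  to plus or minus itself.\<close>

lemma fixes_mirror:
  assumes g: "g \<in> W" and s: "s \<in> reflections W"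
    and rank: "\<And>a. a \<bullet> coroot s = 0 \<Longrightarrow> \<exists>c. a - a v* matrix_inv g = c *\<^sub>R root_form s"
  shows "g = mat 1 \<or> g = s"
proof -
  define h where "h = matrix_inv g"
  have h: "h \<in> W" using g by (simp add: h_def inv_W)
  note rs = root_coroot[OF reflectionD(1)[OF s]]
  let ?r = "coroot s"
  have r0: "?r \<noteq> 0" using coroot_nonzero reflectionD s by blast
  have b0: "beta ?r v = 0 \<longleftrightarrow> root_form s \<bullet> v = 0" for v
    using r0 by (simp add: root_form_eq[OF s])
  have fixed: "h *v v = v" if v: "root_form s \<bullet> v = 0" for v
  proof -
    define x where "x = h *v v - v"
    have ax: "a \<bullet> x = 0" if a: "a \<bullet> ?r = 0" for a
    proof -
      obtain c where c: "a - a v* h = c *\<^sub>R root_form s" using rank[OF a] by (auto simp: h_def)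
      have "a \<bullet> x = - ((a - a v* h) \<bullet> v)"
        by (simp add: x_def inner_diff_left inner_diff_right dot_lmul_matrix)
      then show ?thesis using c v by simp
    qed
    let ?d = "(x \<bullet> ?r) / (?r \<bullet> ?r)"
    have o: "(x - ?d *\<^sub>R ?r) \<bullet> ?r = 0" using r0 by (simp add: inner_diff_left)
    then have "(x - ?d *\<^sub>R ?r) \<bullet> (x - ?d *\<^sub>R ?r) = 0"
      using ax[OF o] by (simp add: inner_diff_right)
    then have xd: "h *v v = v + ?d *\<^sub>R ?r" by (simp add: x_def)
    have "beta (v + ?d *\<^sub>R ?r) (v + ?d *\<^sub>R ?r) = beta v v"
      using beta_invariant[OF h, of v v] xd by simp
    then have "?d * ?d * beta ?r ?r = 0"
      using b0[of v] v by (simp add: beta_simps beta_commute[of v ?r])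
    then have "?d = 0" using r0 by simp
    then show ?thesis using xd by simp
  qed
  \<comment> \<open>The component on the mirror of the image of the coroot; it is orthogonal to the
    fixed mirror, hence zero.\<close>
  define v where "v = h *v ?r - ((root_form s \<bullet> (h *v ?r)) / 2) *\<^sub>R ?r"
  have v: "root_form s \<bullet> v = 0" by (simp add: v_def inner_diff_right rs)
  have "beta (h *v ?r) v = beta (h *v ?r) (h *v v)" using fixed[OF v] by simp
  also have "\<dots> = 0" using b0 v by (simp add: beta_invariant h)
  finally have "beta v v = 0"
    using b0[of v] v by (subst v_def) (simp add: beta_simps)
  then obtain k where k: "h *v ?r = k *\<^sub>R ?r" by (auto simp: v_def)
  have "k * k * beta ?r ?r = beta ?r ?r"
    using beta_invariant[OF h, of ?r ?r] k by (simp add: beta_simps)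
  then have "k * k = 1" using r0 by simp
  then have "k = 1 \<or> k = -1" by (simp add: square_eq_1_iff)
  moreover have form: "h *v y = y + ((k - 1) * (root_form s \<bullet> y) / 2) *\<^sub>R ?r" for y
  proof -
    let ?c = "(root_form s \<bullet> y) / 2"
    have "h *v (y - ?c *\<^sub>R ?r) = y - ?c *\<^sub>R ?r"
      by (rule fixed) (simp add: inner_diff_right rs)
    then have "h *v y = y - ?c *\<^sub>R ?r + ?c *\<^sub>R (k *\<^sub>R ?r)"
      by (simp add: matrix_vector_mult_diff_distrib matrix_vector_mult_scaleR k algebra_simps)
    also have "\<dots> = y + (?c * k - ?c) *\<^sub>R ?r" by (simp add: scaleR_left_diff_distrib)
    also have "?c * k - ?c = (k - 1) * (root_form s \<bullet> y) / 2" by (simp add: field_simps)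
    finally show ?thesis .
  qed
  ultimately have "h = mat 1 \<or> h = s"
    by (auto simp: matrix_eq rs)
  then show ?thesis
  proof
    assume "h = mat 1"
    then show ?thesis using matrix_inv_right[OF invertible_W[OF g]] by (simp add: h_def)
  next
    assume "h = s"
    then have "matrix_inv s = g"
      using matrix_inv_right[OF invertible_W[OF g]] by (intro matrix_inv_unique) (simp add: h_def)
    then show ?thesis using reflection_inv reflectionD s by auto
  qed
qed

lemma reflection_vector_matrix:
  assumes "is_reflection s"
  shows "a v* s = a - (a \<bullet> coroot s) *\<^sub>R root_form s"
proof -
  have "(a v* s) \<bullet> v = (a - (a \<bullet> coroot s) *\<^sub>R root_form s) \<bullet> v" for v
    by (simp add: dot_lmul_matrix root_coroot[OF assms] inner_diff_left inner_diff_right)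
  then show ?thesis using vector_eq_rdot by blast
qed

lemma not_reflection_one: "mat 1 \<notin> reflections W"
proof
  assume "mat 1 \<in> reflections W"
  then have s: "is_reflection (mat 1 :: ((real, 'n) vec, 'n) vec)" by (simp add: reflections_def)
  show False
    using root_coroot(1)[OF s] root_coroot(2)[OF s, of "coroot (mat 1)"] coroot_nonzero[OF s]
    by simp
qed

lemma reflection_determined:
  assumes "s \<in> reflections W" "t \<in> reflections W" "root_form t = c *\<^sub>R root_form s"
  shows "t = s"
proof -
  have "t = mat 1 \<or> t = s"
  proof (rule fixes_mirror)
    show "\<exists>d. a - a v* matrix_inv t = d *\<^sub>R root_form s" for a
      using assms reflectionD by (auto simp: reflection_inv reflection_vector_matrix intro!: exI)
  qed (use assms reflectionD in auto)
  then show ?thesis using assms not_reflection_one by auto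
qed

section \<open>Equivariant maps from the dual space\<close>

text \<open>
  A linear map from \<open>V\<^sup>*\<close> to polynomials is encoded by the images \<open>p i\<close> of the coordinate functions,
  so that the map itself is the restriction of \<open>subst p\<close> to linear forms.
\<close>

definition equivariant :: "('n \<Rightarrow> 'n mpoly) \<Rightarrow> bool" where
  "equivariant p \<longleftrightarrow> (\<forall>w\<in>W. \<forall>k. act w (p k) = subst p (act w (Var k)))"

lemma equivariant_act:
  assumes "equivariant p" "w \<in> W"
  shows "act w (subst p f) = subst p (act w f)"
  by (rule ringhom_eqI[of "\<lambda>f. act w (subst p f)"])
    (use assms in \<open>auto simp: equivariant_def ringhom_compose[OF ringhom_act ringhom_subst]
      ringhom_compose[OF ringhom_subst ringhom_act]\<close>)

lemma equivariant_reflection: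
  assumes "equivariant p" "s \<in> reflections W"
  shows "act s (subst p (linear_form a))
    = subst p (linear_form a) - Const (pairing a (coroot s)) * subst p (lin (root_form s))"
  using equivariant_act[OF assms(1) reflectionD(2)[OF assms(2)]]
    act_reflection_linear_form[OF reflectionD(1)[OF assms(2)]]
  by (simp add: subst_simps)

lemma equivariant_root:
  assumes "equivariant p" "s \<in> reflections W"
  shows "act s (subst p (lin (root_form s))) = - subst p (lin (root_form s))"
  unfolding equivariant_reflection[OF assms] pairing_cvec
    root_coroot(1)[OF reflectionD(1)[OF assms(2)]]
  by simp

text \<open>The kernel is stable under \<open>W\<close>, but irreducibility is given over the reals,
  while \<open>a\<close> is complex. A reflection that moves \<open>a\<close> puts its root, which
  is real, into the kernel.\<close>

lemma equivariant_kernel: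
  assumes "equivariant p" "a \<noteq> 0" "subst p (linear_form a) = 0"
  shows "p k = 0"
proof -
  obtain s where s: "s \<in> reflections W" "pairing a (coroot s) \<noteq> 0"
    using pairing_coroots assms(2) by blast
  have root0: "subst p (lin (root_form s)) = 0"
    using equivariant_reflection[OF assms(1) s(1), of a] s(2) by (simp add: assms(3) act_simps)
  let ?U = "{b. subst p (lin b) = 0}"
  have "?U = UNIV"
  proof (rule irreducible_dual)
    show "subspace ?U"
      by (auto simp: subspace_def cvec_add cvec_scale linear_form_add linear_form_scale subst_simps)
    show "b v* matrix_inv w \<in> ?U" if "w \<in> W" "b \<in> ?U" for w b
      using equivariant_act[OF assms(1) that(1), of "lin b"] that(2) by (simp add: act_lin act_simps)
  qed (use s root0 root_nonzero reflectionD in auto)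
  then have "subst p (lin (axis k 1)) = 0" by blast
  moreover have "cvec (axis k 1) = axis k 1" by (simp add: vec_eq_iff axis_def)
  ultimately show ?thesis by (simp add: linear_form_axis)
qed

end

section \<open>The Jacobian of the basic invariants\<close>

lemma prime_elem_dvd_prod:
  fixes p :: "'a::idom"
  assumes "prime_elem p" "p dvd prod f A"
  shows "\<exists>a\<in>A. p dvd f a"
  using assms(2)
proof (induction A rule: infinite_finite_induct)
  case (insert x F)
  then show ?case using prime_elem_dvd_multD[OF assms(1)] by auto
qed (use assms(1) in \<open>auto simp: prime_elem_def\<close>)

lemma Const_dvd_1: "c \<noteq> 0 \<Longrightarrow> Const c dvd 1"
  by (rule dvdI[of _ _ "Const (1 / c)"]) (simp flip: Const_simps)

lemma prime_elem_not_dvd_Const: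
  assumes "prime_elem p" "c \<noteq> 0"
  shows "\<not> p dvd Const c"
  using assms Const_dvd_1[OF assms(2)] dvd_trans prime_elem_not_unit by blast

text \<open>\<open>p\<close> cannot vanish at the origin, which scaling fixes, so its degree is
  zero.\<close>

lemma hom_factor_of_Const:
  fixes p :: "'v mpoly"
  assumes "hom d p" "p * q = Const c" "c \<noteq> 0"
  shows "\<exists>c'. c' \<noteq> 0 \<and> p = Const c'"
proof -
  let ?z = "subst (\<lambda>_. 0) :: 'v mpoly \<Rightarrow> 'v mpoly"
  have "?z p * ?z q = Const c" using assms(2) by (simp flip: subst_simps)
  then have nz: "?z p \<noteq> 0" using assms(3) by auto
  have sc: "?z (subst (\<lambda>i. Const 2 * Var i) p) = ?z p"
    by (simp add: subst_subst subst_simps)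
  have "d = 0"
  proof (rule ccontr)
    assume d: "d \<noteq> 0"
    have "Const (2 powi d) * ?z p = ?z p"
      using assms(1) sc by (simp add: hom_def subst_simps del: Const_numeral)
    moreover obtain k where k: "Poly_Mapping.lookup (?z p) k \<noteq> 0"
      using nz poly_mapping_eqI[of "?z p" 0] by auto
    ultimately have "2 powi d * Poly_Mapping.lookup (?z p) k = Poly_Mapping.lookup (?z p) k"
      by (metis lookup_Const_mult)
    then have "(2::complex) powi d = 1" using k by simp
    then have "norm ((2::complex) powi d) = 1" by simp
    then have *: "(2::real) powi d = 1" unfolding norm_power_int by simp
    show False
      using power_int_strict_increasing[of d 0 "2::real"] power_int_strict_increasing[of 0 d "2::real"] * d
      by (cases "d < 0") auto
  qed
  then obtain c' where "p = Const c'" using assms(1) hom_degree_0 by blast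
  then show ?thesis using nz by auto
qed

text \<open>Each linear form is prime and goes to one of the two factors; homogeneity makes the unit
  that remains a constant.\<close>

lemma divisor_of_linear_product:
  fixes p :: "'v::{finite,linorder} mpoly"
  assumes "finite F" "hom d p" "p * q = Const c * (\<Prod>x\<in>F. linear_form (b x))" "c \<noteq> 0"
    "\<And>x. x \<in> F \<Longrightarrow> b x \<noteq> 0"
  shows "\<exists>F' c'. F' \<subseteq> F \<and> c' \<noteq> 0 \<and> p = Const c' * (\<Prod>x\<in>F'. linear_form (b x))"
  using assms
proof (induction F arbitrary: p q d rule: finite_induct)
  case empty
  then show ?case using hom_factor_of_Const[of d p q c] by (auto intro!: exI[of _ "{}"])
next
  case (insert x F)
  let ?l = "linear_form (b x)"
  have l: "prime_elem ?l" "?l \<noteq> 0" using insert.prems(4) by (auto intro: prime_elem_linear_form)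
  have pq: "p * q = ?l * (Const c * (\<Prod>x\<in>F. linear_form (b x)))"
    using insert by (simp add: mult_ac)
  then have "?l dvd p \<or> ?l dvd q"
    using prime_elem_dvd_multD[OF l(1), of p q] by simp
  then show ?case
  proof
    assume "?l dvd p"
    then obtain p' where p': "p = ?l * p'" by (auto simp: dvd_def)
    then have "p' * q = Const c * (\<Prod>x\<in>F. linear_form (b x))"
      using pq l(2) by (simp add: mult.assoc)
    moreover have "hom (d - 1) p'"
      using hom_cancel[OF hom_linear_form, of "d - 1" "b x" p'] insert.prems(1) p' l(2) by simp
    ultimately obtain F' c' where F': "F' \<subseteq> F" "c' \<noteq> 0" "p' = Const c' * (\<Prod>x\<in>F'. linear_form (b x))"
      using insert.IH[of "d - 1" p' q] insert.prems by blast
    have "x \<notin> F'" "finite F'" using F'(1) insert.hyps finite_subset by auto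
    then have "p = Const c' * (\<Prod>x\<in>insert x F'. linear_form (b x))"
      using p' F'(3) by (simp add: mult_ac)
    then show ?thesis using F' by (intro exI[of _ "insert x F'"] exI[of _ c']) auto
  next
    assume "?l dvd q"
    then obtain q' where q': "q = ?l * q'" by (auto simp: dvd_def)
    then have "?l * (p * q') = ?l * (Const c * (\<Prod>x\<in>F. linear_form (b x)))"
      using pq by (simp add: mult_ac)
    then have "p * q' = Const c * (\<Prod>x\<in>F. linear_form (b x))"
      using l(2) by simp
    then show ?thesis using insert.IH[of d p q'] insert.prems by blast
  qed
qed

lemma ringhom_map_poly:
  assumes "ringhom \<phi>"
  shows "map_poly \<phi> (p * q) = map_poly \<phi> p * map_poly \<phi> q" "map_poly \<phi> 1 = 1"
proof -
  note s = ringhom_simps[OF assms]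
  show "map_poly \<phi> (p * q) = map_poly \<phi> p * map_poly \<phi> q"
    by (intro poly_eqI) (simp add: coeff_map_poly s coeff_mult)
  show "map_poly \<phi> 1 = 1" by (simp add: s)
qed

lemma ringhom_map_poly_prod:
  assumes "ringhom \<phi>"
  shows "map_poly \<phi> (prod f I) = (\<Prod>i\<in>I. map_poly \<phi> (f i))"
  using ringhom_map_poly[OF assms]
  by (induction I rule: infinite_finite_induct) auto

section \<open>Jacobians and their transformation under linear substitutions\<close>

definition Jac :: "('n::finite \<Rightarrow> 'n mpoly) \<Rightarrow> 'n mpoly" where
  "Jac f = det (\<chi> i k. pd k (f i))"

lemma Jac_lin:
  fixes M :: "real^'n^'n"
  shows "Jac (\<lambda>i. lin (M $ i)) = Const (complex_of_real (det M))"
proof -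
  have "ringhom (\<lambda>x. Const (complex_of_real x) :: 'n mpoly)"
    by (auto simp: ringhom_def Const_simps)
  from ringhom_det[OF this, of M] show ?thesis by (simp add: Jac_def pd_linear_form)
qed

lemma pd_act:
  "pd k (act w p) = (\<Sum>l\<in>UNIV. act w (pd l p) * Const (complex_of_real (matrix_inv w $ l $ k)))"
  unfolding act_eq pd_subst by (simp add: pd_linear_form)

lemma Jac_act:
  fixes f :: "'n::finite \<Rightarrow> 'n mpoly"
  shows "Jac (\<lambda>i. act w (f i)) = Const (complex_of_real (det (matrix_inv w))) * act w (Jac f)"
proof -
  have c: "ringhom (\<lambda>x. Const (complex_of_real x) :: 'n mpoly)"
    by (auto simp: ringhom_def Const_simps)
  have "(\<chi> i k. pd k (act w (f i)))
      = (\<chi> i l. act w (pd l (f i))) ** (\<chi> l k. Const (complex_of_real (matrix_inv w $ l $ k)))"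
    by (simp add: pd_act matrix_matrix_mult_def)
  then have "Jac (\<lambda>i. act w (f i)) = det (\<chi> i l. act w (pd l (f i)))
      * det (\<chi> l k. Const (complex_of_real (matrix_inv w $ l $ k)) :: 'n mpoly ^'n^'n)"
    by (simp add: Jac_def det_mul)
  also have "det (\<chi> l k. Const (complex_of_real (matrix_inv w $ l $ k)) :: 'n mpoly ^'n^'n)
      = Const (complex_of_real (det (matrix_inv w)))"
    using ringhom_det[OF c, of "matrix_inv w"] by simp
  also have "det (\<chi> i l. act w (pd l (f i))) = act w (Jac f)"
    by (simp add: Jac_def ringhom_det[OF ringhom_act])
  finally show ?thesis by (simp add: mult.commute)
qed

lemma hom_Jac:
  fixes f :: "'n::{finite,linorder} \<Rightarrow> 'n mpoly"
  assumes "\<And>i. hom (d i) (f i)"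
  shows "hom (\<Sum>i\<in>UNIV. d i - 1) (Jac f)"
proof -
  have "hom (sum (\<lambda>i. d i - 1) UNIV + sum (\<lambda>_. 0) (UNIV :: 'n set)) (Jac f)"
    unfolding Jac_def by (intro hom_det) (simp add: hom_pd assms)
  then show ?thesis by simp
qed

text \<open>The invariants are indexed by the coordinate type, so that the Jacobian matrix is
  square; \<open>n0\<close> plays the part of N, the index of an invariant of highest
  degree.\<close>

locale invariant_generators = reflection_group W
  for W :: "(real^'n::{finite,linorder}^'n::{finite,linorder}) set" +
  fixes z :: "'n \<Rightarrow> 'n mpoly" and d :: "'n \<Rightarrow> int" and n0 :: 'n
  assumes hom_z: "hom (d i) (z i)"
    and subst_z_inj: "subst z P = 0 \<Longrightarrow> P = 0"
    and range_subst_z: "range (subst z) = invariants W"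
    and d_le: "d i \<le> d n0"
begin

lemma subst_z_inject [simp]: "subst z P = subst z Q \<longleftrightarrow> P = Q"
  using subst_z_inj[of "P - Q"] by (auto simp: subst_simps)

lemma invariantE:
  assumes "\<And>w. w \<in> W \<Longrightarrow> act w p = p"
  obtains P where "p = subst z P"
proof -
  have "p \<in> range (subst z)" using assms range_subst_z by (auto simp: invariants_def)
  then show ?thesis using that by auto
qed

lemma act_subst_z: "w \<in> W \<Longrightarrow> act w (subst z P) = subst z P"
  using range_subst_z by (auto simp: invariants_def)

lemma act_z: "w \<in> W \<Longrightarrow> act w (z i) = z i"
  using act_subst_z[of w "Var i"] by simp

section \<open>Linear factors of the Jacobian\<close>

definition J :: "'n mpoly" where "J = Jac z"

text \<open>A set and not a family over \<open>W\<close>: the conjugates are distinct, so the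
  polynomial with these roots has a nonzero derivative at \<open>f\<close>.\<close>

definition orbit :: "'n mpoly \<Rightarrow> 'n mpoly set" where "orbit f = (\<lambda>w. act w f) ` W"

lemma finite_orbit: "finite (orbit f)"
  by (simp add: orbit_def finite_W)

lemma self_in_orbit: "f \<in> orbit f"
  unfolding orbit_def by (rule image_eqI[OF _ one_W]) (simp add: act_one)

lemma bij_betw_act_orbit:
  assumes "w \<in> W"
  shows "bij_betw (act w) (orbit f) (orbit f)"
proof (rule bij_betw_byWitness[where f' = "act (matrix_inv w)"])
  show "act w ` orbit f \<subseteq> orbit f"
    using assms mult_W by (force simp: orbit_def simp flip: act_group)
  show "act (matrix_inv w) ` orbit f \<subseteq> orbit f"
    using assms mult_W inv_W by (force simp: orbit_def simp flip: act_group)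
qed (auto simp: act_inv invertible_W assms)

text \<open>
  Differentiate the equation \<open>P f = 0\<close>, where \<open>P\<close> is the polynomial whose roots are the conjugates
  of \<open>f\<close>: its coefficients are invariant, so their derivatives are combinations of those of \<open>z\<close>.
\<close>

lemma orbit_derivative:
  "\<exists>K. \<forall>k. (\<Prod>u\<in>orbit f - {f}. f - u) * pd k f = (\<Sum>j\<in>UNIV. K j * pd k (z j))"
proof -
  define P where "P = (\<Prod>u\<in>orbit f. [:- u, 1:])"
  have "map_poly (act w) P = P" if "w \<in> W" for w
  proof -
    have "map_poly (act w) P = (\<Prod>u\<in>orbit f. [:- act w u, 1:])"
      unfolding P_def ringhom_map_poly_prod[OF ringhom_act]
      by (intro prod.cong) (simp_all add: map_poly_pCons act_simps)
    also have "\<dots> = P"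
      unfolding P_def by (rule prod.reindex_bij_betw[OF bij_betw_act_orbit[OF that]])
    finally show ?thesis .
  qed
  then have inv: "act w (coeff P c) = coeff P c" if "w \<in> W" for w c
    using that by (metis act_simps(1) coeff_map_poly)
  \<comment> \<open>For invariant coefficients, d(Q(f)) is Q'(f) df plus the differentials of the
    coefficients, which are combinations of the dz_j.\<close>
  have "\<exists>K. \<forall>k. pd k (poly Q f) = (\<Sum>j\<in>UNIV. K j * pd k (z j)) + poly (pderiv Q) f * pd k f"
    if "\<And>w c. w \<in> W \<Longrightarrow> act w (coeff Q c) = coeff Q c" for Q
    using that
  proof (induction Q)
    case 0
    then show ?case by (intro exI[of _ "\<lambda>_. 0"]) simp
  next
    case (pCons a Q)
    have "act w (coeff Q c) = coeff Q c" if "w \<in> W" for w c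
      using pCons.prems[OF that, of "Suc c"] by simp
    then obtain K where K:
      "\<And>k. pd k (poly Q f) = (\<Sum>j\<in>UNIV. K j * pd k (z j)) + poly (pderiv Q) f * pd k f"
      using pCons.IH by blast
    have "act w a = a" if "w \<in> W" for w
      using pCons.prems[OF that, of 0] by simp
    then obtain A where A: "a = subst z A" using invariantE by blast
    have "pd k (poly (pCons a Q) f)
        = (\<Sum>j\<in>UNIV. (subst z (pd j A) + f * K j) * pd k (z j)) + poly (pderiv (pCons a Q)) f * pd k f" for k
      by (simp add: pd_add pd_mult K A pd_subst pderiv_pCons sum.distrib sum_distrib_left algebra_simps)
    then show ?case by (intro exI[of _ "\<lambda>j. subst z (pd j A) + f * K j"] allI)
  qed
  from this[OF inv] obtain K where
    K: "\<And>k. pd k (poly P f) = (\<Sum>j\<in>UNIV. K j * pd k (z j)) + poly (pderiv P) f * pd k f"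
    by blast
  define P' where "P' = (\<Prod>u\<in>orbit f - {f}. [:- u, 1:])"
  have P: "P = [:- f, 1:] * P'"
    unfolding P_def P'_def by (rule prod.remove[OF finite_orbit self_in_orbit])
  have "poly P f = 0" by (simp add: P)
  moreover have "poly (pderiv P) f = poly P' f"
    unfolding P pderiv_mult by (simp add: pderiv_pCons)
  moreover have "poly P' f = (\<Prod>u\<in>orbit f - {f}. f - u)"
    by (simp add: P'_def poly_prod)
  ultimately have "(\<Prod>u\<in>orbit f - {f}. f - u) * pd k f = (\<Sum>j\<in>UNIV. - K j * pd k (z j))" for k
    using K[of k] by (simp add: eq_neg_iff_add_eq_0 sum_negf add.commute)
  then show ?thesis by (intro exI[of _ "\<lambda>j. - K j"]) blast
qed

text \<open>The determinant of the relations of \<open>orbit_derivative\<close> for a whole family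
  \<open>f\<close>. Different choices of linear forms \<open>f\<close> show that \<open>J\<close> is
  nonzero, which linear factors it can have, and how often.\<close>

lemma J_divides:
  "\<exists>q. q * J = (\<Prod>i\<in>UNIV. \<Prod>u\<in>orbit (f i) - {f i}. f i - u) * Jac f"
proof -
  have "\<forall>i. \<exists>K. \<forall>k. (\<Prod>u\<in>orbit (f i) - {f i}. f i - u) * pd k (f i) = (\<Sum>j\<in>UNIV. K j * pd k (z j))"
    using orbit_derivative by blast
  from choice[OF this] obtain K where K:
    "\<And>i k. (\<Prod>u\<in>orbit (f i) - {f i}. f i - u) * pd k (f i) = (\<Sum>j\<in>UNIV. K i j * pd k (z j))"
    by blast
  have "(\<chi> i j. K i j) ** (\<chi> i k. pd k (z i))
      = (\<chi> i. (\<Prod>u\<in>orbit (f i) - {f i}. f i - u) *s (\<chi> k. pd k (f i)))"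
    by (simp add: vec_eq_iff matrix_matrix_mult_def K)
  then have "det (\<chi> i j. K i j) * J
      = det (\<chi> i. (\<Prod>u\<in>orbit (f i) - {f i}. f i - u) *s (\<chi> k. pd k (f i)))"
    by (simp add: J_def Jac_def flip: det_mul)
  then show ?thesis unfolding det_rows_mul Jac_def by blast
qed

lemma orbit_lin_factor:
  assumes "u \<in> orbit (lin a) - {lin a}"
  obtains w where "w \<in> W" "lin a - u = lin (a - a v* matrix_inv w)" "u = lin (a v* matrix_inv w)"
    "a - a v* matrix_inv w \<noteq> 0" "w \<noteq> mat 1"
proof -
  obtain w where w: "w \<in> W" "u = lin (a v* matrix_inv w)"
    using assms by (auto simp: orbit_def act_lin)
  moreover have ne: "a - a v* matrix_inv w \<noteq> 0" using w assms by auto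
  moreover have "w \<noteq> mat 1"
  proof
    assume "w = mat 1"
    moreover have "matrix_inv (mat 1) = (mat 1 :: ((real, 'n) vec, 'n) vec)"
      by (rule matrix_inv_unique) simp
    ultimately show False using ne by simp
  qed
  ultimately show ?thesis using that by (simp add: cvec_diff linear_form_diff)
qed

text \<open>The coordinate functions have Jacobian 1, and the differences between conjugates of
  linear forms are linear; so \<open>J\<close> divides a nonzero product of linear forms.\<close>

lemma J_linear_factors:
  obtains F :: "('n \<times> 'n mpoly) set" and b c where
    "finite F" "c \<noteq> 0" "\<And>x. x \<in> F \<Longrightarrow> b x \<noteq> 0" "J = Const c * (\<Prod>x\<in>F. lin (b x))"
proof -
  define b where "b x = (SOME b. lin (axis (fst x) 1) - snd x = lin b)" for x :: "'n \<times> 'n mpoly"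
  let ?F = "Sigma UNIV (\<lambda>i. orbit (lin (axis i 1)) - {lin (axis i 1)})"
  have b: "lin (axis i 1) - u = lin (b (i, u))" "b (i, u) \<noteq> 0"
    if "u \<in> orbit (lin (axis i 1)) - {lin (axis i 1)}" for i u
  proof -
    have "\<exists>b. lin (axis i 1) - u = lin b" using orbit_lin_factor[OF that] by metis
    then show *: "lin (axis i 1) - u = lin (b (i, u))"
      unfolding b_def fst_conv snd_conv by (rule someI_ex)
    show "b (i, u) \<noteq> 0" using * that by auto
  qed
  have one: "(mat 1 :: ((real, 'n) vec, 'n) vec) $ i = axis i 1" for i
    by (simp add: vec_eq_iff axis_def mat_def)
  obtain q where "q * J = (\<Prod>i\<in>UNIV. \<Prod>u\<in>orbit (lin (axis i 1)) - {lin (axis i 1)}. lin (axis i 1) - u)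
      * Jac (\<lambda>i. lin (axis i 1))"
    using J_divides[of "\<lambda>i. lin (axis i 1)"] by blast
  also have "Jac (\<lambda>i. lin (axis i 1)) = (1 :: 'n mpoly)"
    using Jac_lin[of "mat 1 :: ((real, 'n) vec, 'n) vec"] by (simp add: one Const_simps)
  also have "(\<Prod>i\<in>UNIV. \<Prod>u\<in>orbit (lin (axis i 1)) - {lin (axis i 1)}. lin (axis i 1) - u)
      = (\<Prod>i\<in>UNIV. \<Prod>u\<in>orbit (lin (axis i 1)) - {lin (axis i 1)}. lin (b (i, u)))"
    by (intro prod.cong refl b)
  also have "\<dots> = (\<Prod>x\<in>?F. lin (b x))"
    by (subst prod.Sigma) (auto simp: finite_orbit case_prod_unfold)
  finally have "J * q = Const 1 * (\<Prod>x\<in>?F. lin (b x))"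
    by (simp add: mult.commute Const_simps)
  moreover have "hom (\<Sum>i\<in>UNIV. d i - 1) J" unfolding J_def by (intro hom_Jac hom_z)
  moreover have "finite ?F" using finite_orbit by auto
  moreover have bF: "b x \<noteq> 0" if "x \<in> ?F" for x
    using that b(2) by auto
  ultimately obtain F' c' where "F' \<subseteq> ?F" "c' \<noteq> 0" "J = Const c' * (\<Prod>x\<in>F'. lin (b x))"
    using divisor_of_linear_product[of ?F "\<Sum>i\<in>UNIV. d i - 1" J q 1 "\<lambda>x. cvec (b x)"] bF by auto
  moreover have "finite F'" using \<open>F' \<subseteq> ?F\<close> \<open>finite ?F\<close> by (rule finite_subset)
  ultimately show ?thesis using that[of F' c' b] bF by blast
qed

lemma J_nonzero: "J \<noteq> 0"
  by (rule J_linear_factors) simp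

lemma vector_matrix_add: "(x + y) v* h = x v* h + y v* h"
  by (simp add: vec_eq_iff vector_matrix_mult_def algebra_simps sum.distrib)

lemma vector_matrix_scale: "(k *\<^sub>R x) v* h = k *\<^sub>R (x v* h)" for x :: "(real, 'n) vec"
  by (simp add: vec_eq_iff vector_matrix_mult_def sum_distrib_left mult_ac)

lemma subspace_rank_one:
  fixes g :: "((real, 'n) vec, 'n) vec"
  shows "subspace {a. \<exists>c. a - a v* matrix_inv g = c *\<^sub>R l}"
proof -
  have "\<exists>e. (x + y) - (x + y) v* h = e *\<^sub>R l"
    if "x - x v* h = c *\<^sub>R l" "y - y v* h = c' *\<^sub>R l" for x y h c c'
    using that by (intro exI[of _ "c + c'"]) (simp add: vector_matrix_add scaleR_left_distrib flip: that)
  moreover have "\<exists>e. k *\<^sub>R x - (k *\<^sub>R x) v* h = e *\<^sub>R l"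
    if "x - x v* h = c *\<^sub>R l" for x h k c
  proof -
    have "k *\<^sub>R x - (k *\<^sub>R x) v* h = k *\<^sub>R (x - x v* h)"
      by (simp only: vector_matrix_scale scaleR_diff_right)
    then show ?thesis using that by auto
  qed
  ultimately show ?thesis
    unfolding subspace_def by (auto intro: exI[of _ 0])
qed

text \<open>If \<open>l\<close> is no root, the covectors that a given element other than 1 moves
  along \<open>l\<close> form a proper subspace. A basis avoiding all these subspaces yields a
  multiple of \<open>J\<close> that \<open>l\<close> does not divide.\<close>

lemma linear_factor_of_J:
  assumes "l \<noteq> 0" "lin l dvd J"
  shows "\<exists>s\<in>reflections W. \<exists>c. l = c *\<^sub>R root_form s"
proof (rule ccontr)
  assume no: "\<not> ?thesis"
  define U where "U g = {a. \<exists>c. a - a v* matrix_inv g = c *\<^sub>R l}" for g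
  let ?F = "U ` (W - {mat 1})"
  have "UNIV \<subseteq> span (UNIV - \<Union>?F)"
  proof (rule subspace_avoiding_span)
    fix V assume "V \<in> ?F"
    then obtain g where g: "g \<in> W" "g \<noteq> mat 1" "V = U g" by auto
    have "\<not> UNIV \<subseteq> V"
    proof
      assume "UNIV \<subseteq> V"
      then have "\<exists>c. a - a v* matrix_inv g = c *\<^sub>R l" for a using g(3) by (auto simp: U_def)
      from reflection_of_rank_one[OF g(1,2) assms(1) this] no show False by blast
    qed
    then show "subspace V \<and> \<not> UNIV \<subseteq> V" using g subspace_rank_one by (simp add: U_def)
  qed (auto simp: finite_W)
  then have "span (UNIV - \<Union>?F) = UNIV" by auto
  then obtain M :: "((real, 'n) vec, 'n) vec" where M: "\<And>i. M $ i \<in> UNIV - \<Union>?F" "det M \<noteq> 0"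
    by (rule spanning_set_basis) blast
  have p: "prime_elem (lin l)" using assms(1) by (intro prime_elem_linear_form) simp
  obtain q where "q * J = (\<Prod>i\<in>UNIV. \<Prod>u\<in>orbit (lin (M $ i)) - {lin (M $ i)}. lin (M $ i) - u)
      * Const (complex_of_real (det M))"
    using J_divides[of "\<lambda>i. lin (M $ i)"] unfolding Jac_lin by blast
  then have "lin l dvd (\<Prod>i\<in>UNIV. \<Prod>u\<in>orbit (lin (M $ i)) - {lin (M $ i)}. lin (M $ i) - u)
      * Const (complex_of_real (det M))"
    using assms(2) by (metis dvd_mult)
  moreover have "\<not> lin l dvd Const (complex_of_real (det M))"
    using M(2) by (intro prime_elem_not_dvd_Const p) simp
  ultimately have "lin l dvd (\<Prod>i\<in>UNIV. \<Prod>u\<in>orbit (lin (M $ i)) - {lin (M $ i)}. lin (M $ i) - u)"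
    unfolding prime_elem_dvd_mult_iff[OF p] by simp
  then obtain i u where u: "u \<in> orbit (lin (M $ i)) - {lin (M $ i)}" "lin l dvd lin (M $ i) - u"
    using prime_elem_dvd_prod[OF p] by meson
  from orbit_lin_factor[OF u(1)] obtain w where w: "w \<in> W" "w \<noteq> mat 1"
    "lin (M $ i) - u = lin (M $ i - M $ i v* matrix_inv w)" by metis
  then have "M $ i \<in> U w" using u(2) lin_dvd_lin[OF assms(1)] by (auto simp: U_def)
  then show False using M(1)[of i] w by auto
qed

text \<open>Take a generic basis with all but one covector killing the coroot. Among all differences
  of conjugates only that between the exceptional covector and its image under \<open>s\<close> is
  divisible by the root, and only once.\<close>

lemma J_order:
  assumes s: "s \<in> reflections W"
  shows "\<not> lin (root_form s) * lin (root_form s) dvd J"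
proof
  assume dvd: "lin (root_form s) * lin (root_form s) dvd J"
  let ?l = "lin (root_form s)" and ?r = "coroot s"
  note rs = root_coroot[OF reflectionD(1)[OF s]]
  have rnz: "root_form s \<noteq> 0" using root_nonzero reflectionD(1)[OF s] by blast
  have p: "prime_elem ?l" using rnz by (intro prime_elem_linear_form) simp
  define U where "U g = {a. \<exists>c. a - a v* matrix_inv g = c *\<^sub>R root_form s}" for g
  \<comment> \<open>\<open>s\<close> has to be left out: it moves every covector along its own
    root.\<close>
  let ?F = "U ` (W - {mat 1, s})"
  let ?X = "{x. x \<bullet> ?r = 0}"
  have X: "subspace ?X" using subspace_hyperplane[of ?r] by (simp add: inner_commute)
  have F: "subspace V \<and> \<not> ?X \<subseteq> V" if V: "V \<in> ?F" for V
  proof -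
    obtain g where g: "g \<in> W" "g \<noteq> mat 1" "g \<noteq> s" "V = U g" using V by blast
    then have "\<not> ?X \<subseteq> V"
      using fixes_mirror[OF g(1) s] unfolding U_def by blast
    then show ?thesis using g subspace_rank_one by (simp add: U_def)
  qed
  have fin: "finite ?F" using finite_W by simp
  have XS: "?X \<subseteq> span (?X - \<Union>?F)" by (rule subspace_avoiding_span[OF fin X F])
  have "\<exists>x\<in>UNIV. \<forall>V\<in>insert ?X ?F. x \<notin> V"
  proof (rule subspace_avoids_subspaces)
    have "root_form s \<notin> ?X" using rs by simp
    then show "subspace V \<and> \<not> UNIV \<subseteq> V" if "V \<in> insert ?X ?F" for V
      using that X F by blast
  qed (use fin in auto)
  then obtain v where v: "v \<bullet> ?r \<noteq> 0" "\<And>V. V \<in> ?F \<Longrightarrow> v \<notin> V" by auto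
  obtain M :: "((real, 'n) vec, 'n) vec" and i0 where M:
    "M $ i0 = v" "\<And>i. i \<noteq> i0 \<Longrightarrow> M $ i \<in> ?X - \<Union>?F" "det M \<noteq> 0"
    by (rule hyperplane_basis[OF v(1) _ XS]) auto
  have avoid: "M $ i \<notin> U w" if "w \<in> W" "w \<noteq> mat 1" "w \<noteq> s" for i w
    using M(1) M(2)[of i] v(2) that by (cases "i = i0") auto
  let ?f = "\<lambda>i. lin (M $ i)"
  have as: "act s (?f i) = lin (M $ i - (M $ i \<bullet> ?r) *\<^sub>R root_form s)" for i
    by (simp add: act_lin reflection_inv reflectionD s reflection_vector_matrix)
  have ndvd: "\<not> ?l dvd ?f i - u" if u: "u \<in> orbit (?f i) - {?f i}" "u \<noteq> act s (?f i)" for i u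
  proof
    assume "?l dvd ?f i - u"
    with orbit_lin_factor[OF u(1)] lin_dvd_lin[OF rnz] obtain w c where
      w: "w \<in> W" "u = lin (M $ i v* matrix_inv w)" "w \<noteq> mat 1"
        "M $ i - M $ i v* matrix_inv w = c *\<^sub>R root_form s" by metis
    then have "w \<noteq> s" using u(2) by (auto simp: act_lin)
    then show False using avoid[OF w(1,3)] w(4) by (auto simp: U_def)
  qed
  define Q where "Q i = (\<Prod>u\<in>orbit (?f i) - {?f i}. ?f i - u)" for i
  have Qi: "\<not> ?l dvd Q i" if "i \<noteq> i0" for i
  proof
    assume "?l dvd Q i"
    then obtain u where u: "u \<in> orbit (?f i) - {?f i}" "?l dvd ?f i - u"
      using prime_elem_dvd_prod[OF p] unfolding Q_def by meson
    have "act s (?f i) = ?f i" using M(2)[OF that] as[of i] by simp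
    then show False using ndvd[of u i] u by auto
  qed
  let ?rest = "\<Prod>u\<in>orbit (?f i0) - {?f i0} - {act s (?f i0)}. ?f i0 - u"
  have fs: "?f i0 - act s (?f i0) = Const (complex_of_real (v \<bullet> ?r)) * ?l"
    unfolding as by (simp add: M(1) cvec_diff cvec_scale linear_form_diff linear_form_scale)
  have "Const (complex_of_real (v \<bullet> ?r)) * ?l \<noteq> 0" using v(1) rnz by simp
  then have "act s (?f i0) \<in> orbit (?f i0) - {?f i0}"
    using fs reflectionD(2)[OF s] by (auto simp: orbit_def)
  then have "Q i0 = (?f i0 - act s (?f i0)) * ?rest"
    unfolding Q_def by (intro prod.remove) (auto simp: finite_orbit)
  then have Q0: "Q i0 = Const (complex_of_real (v \<bullet> ?r)) * ?l * ?rest" by (simp only: fs)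
  have rest: "\<not> ?l dvd ?rest"
  proof
    assume "?l dvd ?rest"
    then obtain u where "u \<in> orbit (?f i0) - {?f i0} - {act s (?f i0)}" "?l dvd ?f i0 - u"
      using prime_elem_dvd_prod[OF p] by meson
    then show False using ndvd[of u i0] by auto
  qed
  have rest': "\<not> ?l dvd (\<Prod>i\<in>UNIV - {i0}. Q i)"
    using prime_elem_dvd_prod[OF p, of Q "UNIV - {i0}"] Qi by auto
  obtain q where q: "q * J = (\<Prod>i\<in>UNIV. Q i) * Const (complex_of_real (det M))"
    using J_divides[of ?f] unfolding Jac_lin Q_def by blast
  obtain J' where J': "J = ?l * ?l * J'" using dvd by (auto simp: dvd_def)
  have "(\<Prod>i\<in>UNIV. Q i) = Q i0 * (\<Prod>i\<in>UNIV - {i0}. Q i)"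
    by (rule prod.remove) auto
  then have "?l * (?l * (q * J')) = ?l * (Const (complex_of_real (v \<bullet> ?r)) *
      Const (complex_of_real (det M)) * (?rest * (\<Prod>i\<in>UNIV - {i0}. Q i)))"
    using q by (simp add: J' Q0 mult_ac)
  then have "?l * (q * J') = Const (complex_of_real (v \<bullet> ?r)) *
      Const (complex_of_real (det M)) * (?rest * (\<Prod>i\<in>UNIV - {i0}. Q i))"
    using rnz by (metis mult_left_cancel cvec_eq_0_iff linear_form_eq_0_iff)
  then have "?l dvd Const (complex_of_real (v \<bullet> ?r)) *
      Const (complex_of_real (det M)) * (?rest * (\<Prod>i\<in>UNIV - {i0}. Q i))"
    by (metis dvd_triv_left)
  moreover have "\<not> ?l dvd Const (complex_of_real (v \<bullet> ?r))" "\<not> ?l dvd Const (complex_of_real (det M))"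
    using v(1) M(3) by (intro prime_elem_not_dvd_Const p; simp)+
  ultimately show False
    using rest rest' by (simp add: prime_elem_dvd_mult_iff[OF p])
qed

lemma prime_root: "s \<in> reflections W \<Longrightarrow> prime_elem (lin (root_form s))"
  using root_nonzero[OF reflectionD(1)] by (intro prime_elem_linear_form) simp

lemma Jac_act_reflection:
  assumes "s \<in> reflections W"
  shows "Jac (\<lambda>i. act s (f i)) = - act s (Jac f)"
  using assms by (simp add: Jac_act reflection_inv reflectionD det_reflection Const_simps)

lemma act_J: "s \<in> reflections W \<Longrightarrow> act s J = - J"
proof -
  assume "s \<in> reflections W"
  then have "J = - act s J"
    using Jac_act_reflection[of s z] by (simp add: J_def act_z reflectionD)
  then show "act s J = - J" by (metis minus_minus)
qed

lemma J_order_one: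
  assumes "s \<in> reflections W"
  obtains J1 where "J = lin (root_form s) * J1" "\<not> lin (root_form s) dvd J1"
proof -
  obtain J1 where J1: "J = lin (root_form s) * J1"
    using root_dvd_antiinvariant[OF reflectionD(1)[OF assms] act_J[OF assms]] by (auto simp: dvd_def)
  moreover have "\<not> lin (root_form s) dvd J1"
    using J_order[OF assms] J1 by (metis dvd_refl mult_dvd_mono)
  ultimately show ?thesis using that by blast
qed

lemma J_reflection_factors:
  obtains F :: "('n \<times> 'n mpoly) set" and b c and \<sigma> :: "'n \<times> 'n mpoly \<Rightarrow> ((real, 'n) vec, 'n) vec"
  where "finite F" "c \<noteq> 0" "J = Const c * (\<Prod>x\<in>F. lin (b x))" "inj_on \<sigma> F" "\<sigma> ` F \<subseteq> reflections W"
    "\<And>x. x \<in> F \<Longrightarrow> b x \<noteq> 0 \<and> (\<exists>k. b x = k *\<^sub>R root_form (\<sigma> x))"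
proof -
  obtain F :: "('n \<times> 'n mpoly) set" and b c where
    F: "finite F" "c \<noteq> 0" "\<And>x. x \<in> F \<Longrightarrow> b x \<noteq> 0" "J = Const c * (\<Prod>x\<in>F. lin (b x))"
    by (rule J_linear_factors) (rule that)
  have "\<exists>s. s \<in> reflections W \<and> (\<exists>k. b x = k *\<^sub>R root_form s)" if "x \<in> F" for x
  proof -
    have "lin (b x) dvd J" unfolding F(4) using F(1) that by (intro dvd_mult dvd_prodI)
    then show ?thesis using linear_factor_of_J F(3)[OF that] by blast
  qed
  then have "\<forall>x. \<exists>s. x \<in> F \<longrightarrow> s \<in> reflections W \<and> (\<exists>k. b x = k *\<^sub>R root_form s)" by blast
  from choice[OF this] obtain \<sigma> where
    \<sigma>: "\<And>x. x \<in> F \<Longrightarrow> \<sigma> x \<in> reflections W" "\<And>x. x \<in> F \<Longrightarrow> \<exists>k. b x = k *\<^sub>R root_form (\<sigma> x)"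
    by blast
  have "inj_on \<sigma> F"
  proof (rule inj_onI, rule ccontr)
    fix x y assume xy: "x \<in> F" "y \<in> F" "\<sigma> x = \<sigma> y" "x \<noteq> y"
    let ?l = "lin (root_form (\<sigma> x))"
    have "?l dvd lin (b v)" if "v = x \<or> v = y" for v
    proof -
      have v: "v \<in> F" "\<sigma> v = \<sigma> x" using that xy by auto
      then obtain k where k: "b v = k *\<^sub>R root_form (\<sigma> x)" using \<sigma>(2)[of v] by auto
      then show ?thesis by (simp add: cvec_scale linear_form_scale)
    qed
    then have "?l * ?l dvd lin (b x) * lin (b y)" by (intro mult_dvd_mono) auto
    also have "lin (b x) * lin (b y) = (\<Prod>v\<in>{x, y}. lin (b v))" using xy by simp
    also have "\<dots> dvd (\<Prod>v\<in>F. lin (b v))" using xy F(1) by (intro prod_dvd_prod_subset) auto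
    finally have "?l * ?l dvd J" unfolding F(4) by (rule dvd_mult)
    then show False using J_order \<sigma>(1) xy by blast
  qed
  moreover have "\<sigma> ` F \<subseteq> reflections W" using \<sigma>(1) by blast
  ultimately show ?thesis using that[of F c b \<sigma>] F \<sigma>(2) by blast
qed

text \<open>Mapping each linear factor to its reflection is injective by \<open>J_order\<close>;
  this is the direction needed to bound the degrees of the determinants.\<close>

lemma degree_J_le: "(\<Sum>i\<in>UNIV. d i - 1) \<le> int (card (reflections W))"
proof -
  obtain F :: "('n \<times> 'n mpoly) set" and b c and \<sigma> :: "'n \<times> 'n mpoly \<Rightarrow> ((real, 'n) vec, 'n) vec"
    where F: "finite F" "c \<noteq> 0" "J = Const c * (\<Prod>x\<in>F. lin (b x))" "inj_on \<sigma> F" "\<sigma> ` F \<subseteq> reflections W"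
    by (rule J_reflection_factors) (rule that)
  have "hom (int (card F)) (\<Prod>x\<in>F. lin (b x))"
    using hom_prod[of F "\<lambda>_. 1" "\<lambda>x. lin (b x)"] hom_linear_form by auto
  then have "hom (int (card F)) J" unfolding F(3) by (rule hom_Const_mult)
  moreover have "hom (\<Sum>i\<in>UNIV. d i - 1) J" unfolding J_def by (intro hom_Jac hom_z)
  ultimately have "(\<Sum>i\<in>UNIV. d i - 1) = int (card F)"
    using hom_unique J_nonzero by blast
  also have "card F = card (\<sigma> ` F)" using F(4) by (simp add: card_image)
  also have "int (card (\<sigma> ` F)) \<le> int (card (reflections W))"
    using F(5) finite_reflections by (simp add: card_mono)
  finally show ?thesis by simp
qed

text \<open>The linear factors of \<open>J\<close> are primes, no two of them proportional, so they
  can be split off \<open>p\<close> one after the other.\<close>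

lemma J_dvd:
  assumes "\<And>s. s \<in> reflections W \<Longrightarrow> lin (root_form s) dvd p"
  shows "J dvd p"
proof -
  obtain F :: "('n \<times> 'n mpoly) set" and b c and \<sigma> :: "'n \<times> 'n mpoly \<Rightarrow> ((real, 'n) vec, 'n) vec"
    where F: "finite F" "c \<noteq> 0" "J = Const c * (\<Prod>x\<in>F. lin (b x))" "inj_on \<sigma> F" "\<sigma> ` F \<subseteq> reflections W"
    and b: "\<And>x. x \<in> F \<Longrightarrow> b x \<noteq> 0 \<and> (\<exists>k. b x = k *\<^sub>R root_form (\<sigma> x))"
    by (rule J_reflection_factors) (rule that)
  have "(\<Prod>x\<in>G. lin (b x)) dvd p" if "G \<subseteq> F" for G
    using finite_subset[OF that F(1)] that
  proof (induction G rule: finite_induct)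
    case (insert x G)
    let ?l = "lin (b x)"
    obtain k where k: "b x = k *\<^sub>R root_form (\<sigma> x)" and bx: "b x \<noteq> 0" using b insert by blast
    have l: "prime_elem ?l" using bx by (intro prime_elem_linear_form) simp
    obtain q where q: "p = (\<Prod>x\<in>G. lin (b x)) * q" using insert by (auto simp: dvd_def)
    have "lin (root_form (\<sigma> x)) dvd p" using assms F(5) insert.prems by auto
    moreover have "?l dvd lin (root_form (\<sigma> x))"
      unfolding lin_dvd_lin[OF bx] using k bx by (intro exI[of _ "1 / k"]) auto
    ultimately have "?l dvd (\<Prod>x\<in>G. lin (b x)) * q" using q dvd_trans by metis
    then consider "?l dvd (\<Prod>x\<in>G. lin (b x))" | "?l dvd q"
      using prime_elem_dvd_multD[OF l] by blast
    then show ?case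
    proof cases
      \<comment> \<open>A factor split off earlier would be proportional to the new one; their
        reflections and then their indices would coincide.\<close>
      case 1
      then obtain y where y: "y \<in> G" "?l dvd lin (b y)" using prime_elem_dvd_prod[OF l] by blast
      then obtain e where e: "b y = e *\<^sub>R b x" using lin_dvd_lin[OF bx] by blast
      obtain k' where k': "b y = k' *\<^sub>R root_form (\<sigma> y)" "b y \<noteq> 0" using b y insert.prems by blast
      then have "root_form (\<sigma> y) = (1 / k') *\<^sub>R b y" by auto
      also have "\<dots> = (1 / k' * e * k) *\<^sub>R root_form (\<sigma> x)" by (simp add: e k)
      finally have "\<sigma> y = \<sigma> x"
        using reflection_determined[of "\<sigma> x" "\<sigma> y"] F(5) y insert.prems by blast
      then have "y = x" using F(4) y insert.prems by (auto dest: inj_onD)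
      then show ?thesis using y insert by simp
    next
      case 2
      then obtain q' where "q = ?l * q'" by (auto simp: dvd_def)
      then have "p = (\<Prod>x\<in>insert x G. lin (b x)) * q'"
        using q insert.hyps by (simp add: mult_ac)
      then show ?thesis by (metis dvd_triv_left)
    qed
  qed simp
  from this[of F] obtain q where q: "p = (\<Prod>x\<in>F. lin (b x)) * q" by (auto simp: dvd_def)
  have "Const c * Const (1 / c) = (1 :: 'n mpoly)"
    using F(2) by (simp flip: Const_simps)
  moreover have "J * (Const (1 / c) * q) = (Const c * Const (1 / c)) * ((\<Prod>x\<in>F. lin (b x)) * q)"
    by (simp only: F(3) mult_ac)
  ultimately have "p = J * (Const (1 / c) * q)"
    using q by (simp only: mult_1_left)
  then show ?thesis by (rule dvdI)
qed

lemma hom_J: "hom (\<Sum>i\<in>UNIV. d i - 1) J"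
  unfolding J_def by (intro hom_Jac hom_z)

lemma degree_J_pos: "(\<Sum>i\<in>UNIV. d i - 1) \<ge> 1"
proof (rule ccontr)
  assume neg: "\<not> ?thesis"
  obtain s where s: "s \<in> reflections W" using reflections_nonempty by auto
  then obtain J1 where J1: "J = lin (root_form s) * J1" using J_order_one by blast
  have "lin (root_form s) \<noteq> 0" using prime_root[OF s] by auto
  then have "hom ((\<Sum>i\<in>UNIV. d i - 1) - 1) J1"
    using hom_cancel[of 1 "lin (root_form s)" "(\<Sum>i\<in>UNIV. d i - 1) - 1" J1, OF hom_linear_form] hom_J J1
    by simp
  then have "J1 = 0" using neg hom_negative by fastforce
  then show False using J1 J_nonzero by simp
qed

text \<open>A reflection gives \<open>J\<close> a linear factor, so not all degrees can be 1. This
  makes \<open>1 - d n0\<close>, the degree of the derivative of a coordinate, negative.\<close>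

lemma top_degree: "d n0 \<ge> 2"
proof (rule ccontr)
  assume "\<not> ?thesis"
  then have "d i - 1 \<le> 0" for i using d_le[of i] by simp
  then have "(\<Sum>i\<in>UNIV. d i - 1) \<le> 0" by (intro sum_nonpos) simp
  then show False using degree_J_pos by simp
qed

section \<open>The primitive derivation cleared of denominators\<close>

text \<open>By Cramer's rule, \<open>prim p\<close> is \<open>J\<close> times the primitive derivative of \<open>p\<close>.\<close>

definition prim :: "'n mpoly \<Rightarrow> 'n mpoly" where
  "prim p = Jac (z(n0 := p))"

lemma prim_eq: "prim p = (\<Sum>k\<in>UNIV. pd k p * prim (Var k))"
proof -
  let ?c = "\<lambda>i. \<chi> k. pd k (z i)"
  have row: "prim q = det (\<chi> i. if i = n0 then (\<chi> k. pd k q) else ?c i)" for q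
    unfolding prim_def Jac_def by (intro arg_cong[where f = det]) (simp add: vec_eq_iff)
  have rowp: "(\<chi> k. pd k p) = (\<Sum>j\<in>UNIV. pd j p *s (\<chi> k. pd k (Var j)))"
    by (simp add: vec_eq_iff pd_Var if_distrib cong: if_cong)
  have "prim p = (\<Sum>j\<in>UNIV. det (\<chi> i. if i = n0 then pd j p *s (\<chi> k. pd k (Var j)) else ?c i))"
    unfolding row rowp by (rule det_linear_row_sum) simp
  also have "\<dots> = (\<Sum>j\<in>UNIV. pd j p * prim (Var j))"
    unfolding row by (simp add: det_row_mul)
  finally show ?thesis .
qed

lemma prim_add: "prim (p + q) = prim p + prim q"
  by (subst (1 2 3) prim_eq) (simp add: pd_add distrib_right sum.distrib)

lemma prim_mult: "prim (p * q) = prim p * q + p * prim q"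
  by (subst (1 2 3) prim_eq)
    (simp add: pd_mult ring_distribs sum.distrib sum_distrib_left sum_distrib_right mult_ac)

lemma prim_Const [simp]: "prim (Const c) = 0"
  by (subst prim_eq) simp

lemma prim_0 [simp]: "prim 0 = 0"
  by (subst prim_eq) simp

lemma prim_uminus: "prim (- p) = - prim p"
  using prim_add[of p "- p"] by (simp add: eq_neg_iff_add_eq_0 add.commute)

lemma prim_diff: "prim (p - q) = prim p - prim q"
  using prim_add[of p "- q"] prim_uminus by simp

lemma prim_sum: "prim (sum g I) = (\<Sum>j\<in>I. prim (g j))"
  by (induction I rule: infinite_finite_induct) (auto simp: prim_add)

lemma prim_Const_mult: "prim (Const c * p) = Const c * prim p"
  by (simp add: prim_mult)

lemma prim_power: "prim (p ^ n) = of_nat n * p ^ (n - 1) * prim p"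
  by (rule derivation_power) (rule prim_mult)

lemma prim_z: "prim (z j) = (if j = n0 then J else 0)"
proof (cases "j = n0")
  case True
  then show ?thesis by (simp add: prim_def J_def)
next
  case False
  have "row j (\<chi> i k. pd k ((z(n0 := z j)) i)) = row n0 (\<chi> i k. pd k ((z(n0 := z j)) i))"
    using False by (simp add: row_def)
  then show ?thesis using False det_identical_rows[OF False] by (simp add: prim_def Jac_def)
qed

lemma prim_subst_z: "prim (subst z P) = J * subst z (pd n0 P)"
proof -
  have "prim (subst z P) = (\<Sum>i\<in>UNIV. subst z (pd i P) * prim (subst z (Var i)))"
    by (rule derivation_chain) (simp_all add: subst_simps prim_add prim_mult ringhom_subst)
  also have "\<dots> = (\<Sum>i\<in>UNIV. if i = n0 then J * subst z (pd n0 P) else 0)"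
    by (intro sum.cong) (auto simp: prim_z)
  finally show ?thesis by simp
qed

lemma prim_act:
  assumes "w \<in> W"
  shows "prim (act w p) = Const (complex_of_real (det (matrix_inv w))) * act w (prim p)"
proof -
  have "(\<lambda>i. act w ((z(n0 := p)) i)) = z(n0 := act w p)"
    by (auto simp: fun_eq_iff act_z assms)
  then show ?thesis using Jac_act[of w "z(n0 := p)"] by (simp add: prim_def)
qed

lemma prim_act_reflection:
  assumes "s \<in> reflections W"
  shows "prim (act s p) = - act s (prim p)"
  using prim_act[OF reflectionD(2)[OF assms], of p] assms
  by (simp add: reflection_inv reflectionD det_reflection Const_simps)

lemma hom_prim:
  assumes "hom e p"
  shows "hom ((\<Sum>i\<in>UNIV. d i - 1) + (e - d n0)) (prim p)"
proof -
  have "hom (\<Sum>i\<in>UNIV. (d(n0 := e)) i - 1) (prim p)"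
    unfolding prim_def by (intro hom_Jac) (simp add: hom_z assms)
  moreover have "(\<Sum>i\<in>UNIV. (d(n0 := e)) i - 1) = (\<Sum>i\<in>UNIV. (d i - 1) + (if i = n0 then e - d n0 else 0))"
    by (intro sum.cong) auto
  ultimately show ?thesis by (simp add: sum.distrib)
qed

lemma prim_invariant_dvd:
  assumes "s \<in> reflections W" "act s p = p"
  shows "lin (root_form s) dvd prim p"
  using prim_act_reflection[OF assms(1), of p] assms(2) root_dvd_antiinvariant[OF reflectionD(1)[OF assms(1)]]
  by (metis minus_minus)

text \<open>Reflections have determinant -1, so such a polynomial is anti-invariant and divisible by
  every root; the quotient by \<open>J\<close>, itself anti-invariant, is invariant.\<close>

lemma invariant_of_det_semiinvariant:
  assumes "\<And>w. w \<in> W \<Longrightarrow> p = Const (complex_of_real (det (matrix_inv w))) * act w p"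
  obtains q where "p = J * subst z q"
proof -
  have s: "act s p = - p" if "s \<in> reflections W" for s
  proof -
    have "p = - act s p"
      using assms[OF reflectionD(2)[OF that]] that
      by (simp add: reflection_inv reflectionD det_reflection Const_simps)
    then show ?thesis by (metis minus_minus)
  qed
  then have "J dvd p" by (intro J_dvd root_dvd_antiinvariant reflectionD)
  then obtain q where q: "p = J * q" by (auto simp: dvd_def)
  have "act s q = q" if "s \<in> reflections W" for s
  proof -
    have "J * act s q = J * q" using s[OF that] q act_J[OF that] by (simp add: act_simps)
    then show ?thesis using J_nonzero by simp
  qed
  then have "act w q = q" if "w \<in> W" for w
    using invariant_if_reflection_invariant that by blast
  then show ?thesis using invariantE q that by metis
qed

lemma cramer_J_fract:
  assumes "\<And>j. (\<Sum>k\<in>UNIV. v k * to_frac (pd k (z j))) = 0"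
  shows "v k = 0"
proof -
  define A :: "(('n mpoly fract, 'n) vec, 'n) vec" where "A = (\<chi> j k. to_frac (pd k (z j)))"
  define x where "x = (\<chi> k. v k)"
  have "A *v x = 0"
    using assms by (simp add: vec_eq_iff A_def x_def matrix_vector_mult_def mult.commute)
  moreover have "det A = to_frac J"
    by (simp add: J_def Jac_def A_def ringhom_det[OF ringhom_to_frac])
  then have "invertible A" using J_nonzero by (simp add: invertible_det_nz)
  ultimately have "x = 0"
    by (metis invertible_def matrix_vector_mul_assoc matrix_vector_mul_lid matrix_vector_mult_0_right)
  then show ?thesis by (simp add: x_def vec_eq_iff)
qed

lemma cramer_J:
  assumes "\<And>j. (\<Sum>k\<in>UNIV. v k * pd k (z j)) = 0"
  shows "v k = 0"
  using cramer_J_fract[of "\<lambda>k. to_frac (v k)" k] assms by (simp flip: to_frac_simps)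

end

section \<open>Sign changes of periodic sequences\<close>

lemma sgn_prod_card:
  fixes g :: "'a \<Rightarrow> real"
  assumes "finite A" "\<And>x. x \<in> A \<Longrightarrow> g x \<noteq> 0"
  shows "0 < (-1) ^ card {x \<in> A. g x < 0} * prod g A"
  using assms
proof (induction A rule: finite_induct)
  case (insert a A)
  have IH: "0 < (-1) ^ card {x \<in> A. g x < 0} * prod g A" using insert by simp
  show ?case
  proof (cases "g a < 0")
    case True
    have "{x \<in> insert a A. g x < 0} = insert a {x \<in> A. g x < 0}" using True by auto
    then have "(-1) ^ card {x \<in> insert a A. g x < 0} * prod g (insert a A)
        = (- g a) * ((-1) ^ card {x \<in> A. g x < 0} * prod g A)"
      using insert.hyps by simp
    then show ?thesis using IH True by (simp only: mult_pos_pos neg_0_less_iff_less)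
  next
    case False
    then have "{x \<in> insert a A. g x < 0} = {x \<in> A. g x < 0}" "g a > 0"
      using insert.prems[of a] by auto
    then have "(-1) ^ card {x \<in> insert a A. g x < 0} * prod g (insert a A)
        = g a * ((-1) ^ card {x \<in> A. g x < 0} * prod g A)"
      using insert.hyps by simp
    then show ?thesis using IH \<open>g a > 0\<close> by (simp only: mult_pos_pos)
  qed
qed simp

text \<open>
  A trigonometric polynomial with the same sign changes as \<open>f\<close> is not orthogonal to \<open>f\<close>, and its
  frequencies are bounded by half the number of sign changes.
\<close>

lemma low_frequency_of_sign_changes:
  fixes f :: "nat \<Rightarrow> real"
  assumes p: "0 < p" and per: "\<And>k. f (k + p) = f k" and nz: "\<And>k. f k \<noteq> 0"
  shows "\<exists>l::int. 2 * \<bar>l\<bar> \<le> int (card {k. k < p \<and> f k * f (Suc k) < 0}) \<and>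
    (\<Sum>k<p. complex_of_real (f k) * cis (2 * pi * of_int l * real k / real p)) \<noteq> 0"
proof (rule ccontr)
  define X where "X = {k. k < p \<and> f k * f (Suc k) < 0}"
  have X: "finite X" "\<And>j. j \<in> X \<Longrightarrow> j < p" by (auto simp: X_def)
  have shift: "(\<Prod>k<p. f (Suc k)) = (\<Prod>k<p. f k)"
    using prod.lessThan_Suc_shift[of f p] prod.lessThan_Suc[of f p] per[of 0] nz[of 0]
    by (simp add: mult.commute)
  \<comment> \<open>The product of all \<open>f k * f (Suc k)\<close> over one period is a square,
    so the number of sign changes is even.\<close>
  have "{k \<in> {..<p}. f k * f (Suc k) < 0} = X" by (auto simp: X_def)
  then have "0 < (-1) ^ card X * (\<Prod>k<p. f k * f (Suc k))"
    using sgn_prod_card[of "{..<p}" "\<lambda>k. f k * f (Suc k)"] nz by simp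
  also have "(\<Prod>k<p. f k * f (Suc k)) = (\<Prod>k<p. f k)\<^sup>2"
    by (simp add: prod.distrib shift power2_eq_square)
  finally have "even (card X)"
    by (cases "even (card X)") (auto simp: zero_less_mult_iff)
  then obtain n where n: "card X = 2 * n" by (auto elim: evenE)
  \<comment> \<open>The half shift puts one zero of \<open>g\<close> at j + 1/2, strictly between
    the sample points at which \<open>f\<close> changes its sign.\<close>
  define \<theta> where "\<theta> k j = pi * (real k - real j - 1 / 2) / real p" for k j :: nat
  define g where "g k = (\<Prod>j\<in>X. sin (\<theta> k j))" for k
  assume "\<not> ?thesis"
  then have orth: "(\<Sum>k<p. complex_of_real (f k) * cis (2 * pi * of_int l * real k / real p)) = 0"
    if "\<bar>l\<bar> \<le> int n" for l :: int
    using that n by (auto simp: X_def)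
  define \<tau> where "\<tau> j = cis (- (2 * pi * (real j + 1 / 2) / real p))" for j :: nat
  define Q where "Q = (\<Prod>j\<in>X. [:- 1, \<tau> j:])"
  have "degree Q \<le> (\<Sum>j\<in>X. degree [:- 1, \<tau> j:])"
    unfolding Q_def using degree_prod_sum_le[OF X(1), of "\<lambda>j. [:- 1, \<tau> j:]"] by (simp add: comp_def)
  also have "\<dots> \<le> (\<Sum>j\<in>X. 1)" by (intro sum_mono) simp
  finally have degQ: "degree Q \<le> 2 * n" using n by simp
  define C where "C = (\<Prod>j\<in>X. cis (pi * (real j + 1 / 2) / real p))"
  \<comment> \<open>Each sine is a phase times a linear polynomial in exp(2 pi i k / p). With 2n
    factors the total phase is exp(-2 pi i n k / p), so the frequencies run from -n to n.\<close>
  have G: "(\<Prod>j\<in>X. 2 * \<i> * complex_of_real (sin (\<theta> k j)))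
      = C * (\<Sum>l\<le>2 * n. coeff Q l * cis (2 * pi * of_int (int l - int n) * real k / real p))" for k
  proof -
    let ?x = "cis (2 * pi * real k / real p)"
    have f1: "2 * \<i> * complex_of_real (sin t) = cis (- t) * (cis (2 * t) - 1)" for t
    proof -
      have "cis (- t) * (cis (2 * t) - 1) = cis t - cis (- t)"
        by (simp add: right_diff_distrib cis_mult)
      then show ?thesis by (simp add: complex_eq_iff)
    qed
    have f2: "cis (- \<theta> k j) = cis (- (pi * real k / real p)) * cis (pi * (real j + 1 / 2) / real p)" for j
      unfolding cis_mult \<theta>_def using p by (intro arg_cong[where f = cis]) (simp add: field_simps)
    have f3: "cis (2 * \<theta> k j) = ?x * \<tau> j" for j
      unfolding \<tau>_def cis_mult \<theta>_def using p by (intro arg_cong[where f = cis]) (simp add: field_simps)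
    have "(\<Prod>j\<in>X. 2 * \<i> * complex_of_real (sin (\<theta> k j)))
        = cis (- (pi * real k / real p)) ^ card X * C * (\<Prod>j\<in>X. ?x * \<tau> j - 1)"
      by (simp only: f1 f2 f3 prod.distrib prod_constant C_def)
    also have "cis (- (pi * real k / real p)) ^ card X = cis (real (2 * n) * - (pi * real k / real p))"
      by (simp only: Complex.DeMoivre n)
    also have "real (2 * n) * - (pi * real k / real p) = - (2 * pi * real n * real k / real p)"
      by simp
    also have "(\<Prod>j\<in>X. ?x * \<tau> j - 1) = poly Q ?x"
      by (simp add: Q_def poly_prod algebra_simps)
    also have "poly Q ?x = (\<Sum>l\<le>2 * n. coeff Q l * ?x ^ l)"
      unfolding poly_altdef using degQ by (intro sum.mono_neutral_left) (auto simp: coeff_eq_0)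
    finally have "(\<Prod>j\<in>X. 2 * \<i> * complex_of_real (sin (\<theta> k j)))
        = C * (\<Sum>l\<le>2 * n. coeff Q l * (cis (- (2 * pi * real n * real k / real p)) * ?x ^ l))"
      by (simp add: sum_distrib_left mult_ac)
    moreover have "cis (- (2 * pi * real n * real k / real p)) * ?x ^ l
        = cis (2 * pi * of_int (int l - int n) * real k / real p)" for l
      unfolding Complex.DeMoivre cis_mult using p by (intro arg_cong[where f = cis]) (simp add: field_simps)
    ultimately show ?thesis by simp
  qed
  have "(\<Sum>k<p. complex_of_real (f k) * (\<Prod>j\<in>X. 2 * \<i> * complex_of_real (sin (\<theta> k j))))
      = C * (\<Sum>l\<le>2 * n. coeff Q l *
          (\<Sum>k<p. complex_of_real (f k) * cis (2 * pi * of_int (int l - int n) * real k / real p)))"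
    unfolding G sum_distrib_left by (subst sum.swap) (simp add: mult_ac)
  also have "\<dots> = 0"
  proof -
    have "(\<Sum>k<p. complex_of_real (f k) * cis (2 * pi * of_int (int l - int n) * real k / real p)) = 0"
      if "l \<le> 2 * n" for l
      using that by (intro orth) auto
    then show ?thesis by simp
  qed
  finally have "(2 * \<i>) ^ (2 * n) * complex_of_real (\<Sum>k<p. f k * g k) = 0"
    by (simp add: g_def prod.distrib n sum_distrib_left mult_ac)
  then have zero: "(\<Sum>k<p. f k * g k) = 0" by (simp del: of_real_sum)
  have sin_pos: "0 < sin (pi * u / real p)" if "0 < u" "u < real p" for u
  proof (rule sin_gt_zero)
    show "0 < pi * u / real p" using that p by simp
    have "pi * u < pi * real p" using that by simp
    then show "pi * u / real p < pi" using p by (simp add: divide_less_eq)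
  qed
  \<comment> \<open>\<open>f\<close> and \<open>g\<close> change sign at the same steps, so their
    product keeps its sign throughout the period and cannot sum to zero.\<close>
  have step: "f k * g k * (f (Suc k) * g (Suc k)) > 0" if k: "Suc k < p" for k
  proof -
    have arg: "sin (\<theta> k j) * sin (\<theta> (Suc k) j) > 0" if j: "j \<in> X" "j \<noteq> k" for j
    proof (cases "j < k")
      case True
      have "0 < sin (\<theta> i j)" if "i = k \<or> i = Suc k" for i
        unfolding \<theta>_def using that True k by (intro sin_pos) auto
      then show ?thesis by simp
    next
      case False
      have "sin (\<theta> i j) < 0" if "i = k \<or> i = Suc k" for i
      proof -
        have "0 < sin (pi * (- (real i - real j - 1 / 2)) / real p)"
          using that False j X(2)[of j] by (intro sin_pos) auto
        also have "pi * (- (real i - real j - 1 / 2)) / real p = - \<theta> i j"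
          by (simp only: \<theta>_def mult_minus_right minus_divide_left)
        finally show ?thesis by simp
      qed
      then show ?thesis by (simp add: mult_neg_neg)
    qed
    have gg: "g k * g (Suc k) = (\<Prod>j\<in>X. sin (\<theta> k j) * sin (\<theta> (Suc k) j))"
      by (simp add: g_def prod.distrib)
    show ?thesis
    proof (cases "k \<in> X")
      case True
      have "0 < sin (pi / (2 * real p))"
        using sin_pos[of "1 / 2"] p by simp
      moreover have "\<theta> k k = - (pi / (2 * real p))" "\<theta> (Suc k) k = pi / (2 * real p)"
        by (simp_all add: \<theta>_def)
      ultimately have "sin (\<theta> k k) * sin (\<theta> (Suc k) k) < 0"
        by (simp add: mult_neg_pos)
      moreover have "0 < (\<Prod>j\<in>X - {k}. sin (\<theta> k j) * sin (\<theta> (Suc k) j))"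
        using arg by (intro prod_pos) auto
      ultimately have "g k * g (Suc k) < 0"
        unfolding gg prod.remove[OF X(1) True] by (rule mult_neg_pos)
      moreover have "f k * f (Suc k) < 0" using True by (simp add: X_def)
      ultimately have "0 < (f k * f (Suc k)) * (g k * g (Suc k))" by (intro mult_neg_neg)
      then show ?thesis by (simp add: mult_ac)
    next
      case False
      then have "0 < g k * g (Suc k)" unfolding gg using arg by (intro prod_pos) auto
      moreover have "0 < f k * f (Suc k)"
        using False k nz[of k] nz[of "Suc k"] by (auto simp: X_def not_less less_le)
      ultimately have "0 < (f k * f (Suc k)) * (g k * g (Suc k))" by simp
      then show ?thesis by (simp add: mult_ac)
    qed
  qed
  have "f 0 * g 0 \<noteq> 0"
  proof -
    have "sin (\<theta> 0 j) \<noteq> 0" if "j \<in> X" for j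
    proof -
      have "0 < sin (pi * (real j + 1 / 2) / real p)"
        using X(2)[OF that] by (intro sin_pos) auto
      also have "pi * (real j + 1 / 2) / real p = - \<theta> 0 j"
        using p by (simp add: \<theta>_def field_simps)
      finally show ?thesis by simp
    qed
    then show ?thesis using nz[of 0] X(1) by (simp add: g_def)
  qed
  have pos: "0 < f 0 * g 0 * (f k * g k)" if "k < p" for k
    using that
  proof (induction k)
    case 0
    then show ?case using \<open>f 0 * g 0 \<noteq> 0\<close> by (metis not_real_square_gt_zero)
  next
    case (Suc k)
    have "0 < (f 0 * g 0 * (f k * g k)) * (f k * g k * (f (Suc k) * g (Suc k)))"
      by (rule mult_pos_pos[OF _ step[OF Suc.prems]]) (use Suc in simp)
    also have "\<dots> = (f k * g k)\<^sup>2 * (f 0 * g 0 * (f (Suc k) * g (Suc k)))"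
      by (simp add: power2_eq_square mult_ac)
    finally show ?case by (simp add: zero_less_mult_iff)
  qed
  have "0 < (\<Sum>k<p. f 0 * g 0 * (f k * g k))"
    using pos p by (intro sum_pos) auto
  also have "\<dots> = f 0 * g 0 * (\<Sum>k<p. f k * g k)" by (simp add: sum_distrib_left)
  finally show False using zero by simp
qed

section \<open>A lower bound for the highest degree\<close>

context reflection_group
begin

text \<open>Both signs occur and the length is fixed by \<open>beta\<close>, so \<open>W\<close>
  permutes this set; the vectors \<open>coroot s\<close>, with their arbitrary factors, are not
  permuted in general.\<close>

definition unit_roots :: "(real, 'n) vec set" where
  "unit_roots = {b. beta b b = 1 \<and> (\<exists>s\<in>W. \<forall>v. s *v v = v - (2 * beta b v) *\<^sub>R b)}"

lemma unit_root_beta: "b \<in> unit_roots \<Longrightarrow> beta b b = 1"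
  by (simp add: unit_roots_def)

definition root_refl :: "(real, 'n) vec \<Rightarrow> ((real, 'n) vec, 'n) vec" where
  "root_refl b = (SOME s. s \<in> W \<and> (\<forall>v. s *v v = v - (2 * beta b v) *\<^sub>R b))"

lemma root_refl:
  assumes "b \<in> unit_roots"
  shows "root_refl b \<in> W" "root_refl b *v v = v - (2 * beta b v) *\<^sub>R b"
proof -
  have "\<exists>s. s \<in> W \<and> (\<forall>v. s *v v = v - (2 * beta b v) *\<^sub>R b)"
    using assms by (auto simp: unit_roots_def)
  from someI_ex[OF this] show "root_refl b \<in> W" "root_refl b *v v = v - (2 * beta b v) *\<^sub>R b"
    by (auto simp: root_refl_def)
qed

lemma unit_roots_invariant:
  assumes "w \<in> W" "b \<in> unit_roots"
  shows "w *v b \<in> unit_roots"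
proof -
  let ?t = "w ** (root_refl b ** matrix_inv w)"
  have inv: "w *v (matrix_inv w *v v) = v" for v
    by (simp add: matrix_vector_mul_assoc matrix_inv_right invertible_W assms)
  have "?t *v v = v - (2 * beta (w *v b) v) *\<^sub>R (w *v b)" for v
  proof -
    have "?t *v v = w *v (matrix_inv w *v v - (2 * beta b (matrix_inv w *v v)) *\<^sub>R b)"
      by (simp add: root_refl[OF assms(2)] flip: matrix_vector_mul_assoc)
    also have "\<dots> = v - (2 * beta b (matrix_inv w *v v)) *\<^sub>R (w *v b)"
      by (simp only: matrix_vector_mult_diff_distrib matrix_vector_mult_scaleR inv)
    also have "beta b (matrix_inv w *v v) = beta (w *v b) v"
      using beta_invariant[OF assms(1), of b "matrix_inv w *v v"] inv by simp
    finally show ?thesis .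
  qed
  moreover have "?t \<in> W" using assms root_refl by (simp add: mult_W inv_W)
  ultimately show ?thesis
    using beta_invariant[OF assms(1), of b b] unit_root_beta[OF assms(2)]
    unfolding unit_roots_def by auto
qed

lemma unit_roots_uminus: "b \<in> unit_roots \<Longrightarrow> - b \<in> unit_roots"
  using beta_scale_left[of "-1" b] beta_scale_right[of _ "-1" b]
  by (auto simp: unit_roots_def)

lemma unit_root_eq:
  assumes "b \<in> unit_roots" "b' \<in> unit_roots" "\<And>v. root_refl b *v v = root_refl b' *v v"
  shows "b' = b \<or> b' = - b"
proof -
  have "(2 * beta b b') *\<^sub>R b = 2 *\<^sub>R b'"
    using assms(3)[of b'] root_refl(2)[OF assms(1)] root_refl(2)[OF assms(2)] unit_root_beta[OF assms(2)] by simp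
  then have "(1 / 2) *\<^sub>R ((2 * beta b b') *\<^sub>R b) = (1 / 2) *\<^sub>R (2 *\<^sub>R b')" by simp
  then have eq: "b' = beta b b' *\<^sub>R b" by simp
  have "beta b' b' = beta b b' * beta b b' * beta b b"
    by (subst (1 2) eq) (simp add: beta_simps)
  then have "beta b b' * beta b b' = 1" using assms unit_root_beta by simp
  then have "beta b b' = 1 \<or> beta b b' = -1" by (simp add: square_eq_1_iff)
  then show ?thesis using eq by auto
qed

definition unit_root_of :: "((real, 'n) vec, 'n) vec \<Rightarrow> (real, 'n) vec" where
  "unit_root_of s = (1 / sqrt (beta (coroot s) (coroot s))) *\<^sub>R coroot s"

lemma unit_root_of:
  assumes "s \<in> reflections W"
  shows "unit_root_of s \<in> unit_roots" "s *v v = v - (2 * beta (unit_root_of s) v) *\<^sub>R unit_root_of s"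
proof -
  define q where "q = sqrt (beta (coroot s) (coroot s))"
  have q: "beta (coroot s) (coroot s) = q * q" "q \<noteq> 0"
    using beta_pos[OF coroot_nonzero[OF reflectionD(1)[OF assms]]] by (auto simp: q_def)
  have u: "unit_root_of s = (1 / q) *\<^sub>R coroot s" by (simp add: unit_root_of_def q_def)
  have form: "s *v v = v - (2 * beta (unit_root_of s) v) *\<^sub>R unit_root_of s" for v
    unfolding root_coroot(2)[OF reflectionD(1)[OF assms]] root_form_eq[OF assms]
    by (simp add: u q beta_simps)
  moreover have "beta (unit_root_of s) (unit_root_of s) = 1"
    using q by (simp add: u beta_simps)
  ultimately show "unit_root_of s \<in> unit_roots"
    "s *v v = v - (2 * beta (unit_root_of s) v) *\<^sub>R unit_root_of s"
    using reflectionD(2)[OF assms] by (auto simp: unit_roots_def)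
qed

lemma finite_unit_roots: "finite unit_roots"
proof -
  have "unit_roots \<subseteq> (\<Union>w\<in>W. {b \<in> unit_roots. root_refl b = w})" using root_refl by auto
  moreover have "finite {b \<in> unit_roots. root_refl b = w}" for w
  proof (cases "{b \<in> unit_roots. root_refl b = w} = {}")
    case False
    then obtain b0 where "b0 \<in> unit_roots" "root_refl b0 = w" by auto
    then have "b = b0 \<or> b = - b0" if "b \<in> unit_roots" "root_refl b = w" for b
      using unit_root_eq[of b0 b] that by simp
    then have "{b \<in> unit_roots. root_refl b = w} \<subseteq> {b0, - b0}" by auto
    then show ?thesis by (rule finite_subset) simp
  next
    case True
    then show ?thesis by (simp only: finite.emptyI)
  qed
  ultimately show ?thesis using finite_W by (meson finite_UN finite_subset)
qed

lemma card_unit_roots: "2 * card (reflections W) \<le> card unit_roots"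
proof -
  let ?f = "\<lambda>(s, e). (if e then unit_root_of s else - unit_root_of s)"
  have "inj_on ?f (reflections W \<times> UNIV)"
  proof (rule inj_onI, clarify)
    fix s t e e' assume st: "s \<in> reflections W" "t \<in> reflections W"
      and eq: "(if e then unit_root_of s else - unit_root_of s) = (if e' then unit_root_of t else - unit_root_of t)"
    have b: "beta (- u) v = - beta u v" for u v using beta_scale_left[of "-1" u v] by simp
    have "unit_root_of t = unit_root_of s \<or> unit_root_of t = - unit_root_of s"
      using eq by (auto split: if_splits)
    then have "s *v v = t *v v" for v
      using unit_root_of(2)[OF st(1), of v] unit_root_of(2)[OF st(2), of v] by (auto simp: b)
    then have "s = t" by (simp add: matrix_eq)
    moreover have "unit_root_of s \<noteq> 0"
      using unit_root_beta[OF unit_root_of(1)[OF st(1)]] by auto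
    ultimately show "s = t \<and> e = e'"
      using eq by (auto split: if_splits simp: eq_neg_iff_add_eq_0 neg_eq_iff_add_eq_0 simp flip: scaleR_2)
  qed
  moreover have "?f ` (reflections W \<times> UNIV) \<subseteq> unit_roots"
    using unit_root_of(1) unit_roots_uminus by auto
  ultimately have "card (reflections W \<times> (UNIV :: bool set)) \<le> card unit_roots"
    using card_inj_on_le finite_unit_roots by blast
  then show ?thesis by (simp add: card_cartesian_product)
qed

lemma unit_roots_span: "span unit_roots = UNIV"
proof (rule ccontr)
  assume "span unit_roots \<noteq> UNIV"
  then obtain l where l: "l \<noteq> 0" "span unit_roots \<subseteq> {x. l \<bullet> x = 0}"
    using span_not_univ_subset_hyperplane by blast
  have "l \<bullet> coroot s = 0" if s: "s \<in> reflections W" for s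
  proof -
    have "l \<bullet> unit_root_of s = 0" using l(2) span_base[OF unit_root_of(1)[OF s]] by auto
    moreover have "beta (coroot s) (coroot s) \<noteq> 0"
      using coroot_nonzero[OF reflectionD(1)[OF s]] by simp
    ultimately show ?thesis by (simp add: unit_root_of_def)
  qed
  then show False using coroots_span l(1) by blast
qed

lemma exists_regular_vector: "\<exists>\<rho>. \<forall>b\<in>unit_roots. beta \<rho> b \<noteq> 0"
proof -
  have "\<exists>\<rho>\<in>UNIV. \<forall>V\<in>(\<lambda>b. {v. beta v b = 0}) ` unit_roots. \<rho> \<notin> V"
  proof (rule subspace_avoids_subspaces)
    fix V assume "V \<in> (\<lambda>b. {v. beta v b = 0}) ` unit_roots"
    then obtain b where b: "b \<in> unit_roots" "V = {v. beta v b = 0}" by auto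
    then have "b \<notin> V" using unit_root_beta by simp
    moreover have "subspace V" unfolding b by (auto simp: subspace_def beta_simps)
    ultimately show "subspace V \<and> \<not> UNIV \<subseteq> V" by auto
  qed (auto simp: finite_unit_roots)
  then show ?thesis by auto
qed

text \<open>\<open>D\<close> is a smallest set of positive roots from which all positive roots are
  nonnegative combinations. Minimality gives obtuse angles, these give independence, and a simple
  reflection changes the sign of its own root only.\<close>

lemma simple_system:
  obtains \<rho> D where "\<And>b. b \<in> unit_roots \<Longrightarrow> beta \<rho> b \<noteq> 0" "finite D" "D \<subseteq> unit_roots"
    "independent D" "span D = UNIV"
    "\<And>a b. a \<in> D \<Longrightarrow> b \<in> unit_roots \<Longrightarrow>
      (beta \<rho> b > 0) \<noteq> (beta \<rho> (root_refl a *v b) > 0) \<Longrightarrow> b = a \<or> b = - a"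
proof -
  obtain \<rho> where \<rho>: "\<And>b. b \<in> unit_roots \<Longrightarrow> beta \<rho> b \<noteq> 0" using exists_regular_vector by blast
  define P where "P = {b \<in> unit_roots. beta \<rho> b > 0}"
  have finP: "finite P" using finite_unit_roots by (simp add: P_def)
  have neg: "- b \<in> P" if "b \<in> unit_roots" "b \<notin> P" for b
    using that \<rho>[of b] unit_roots_uminus[of b] beta_scale_right[of \<rho> "-1" b] by (auto simp: P_def)
  define gen where "gen D \<longleftrightarrow> D \<subseteq> P \<and> (\<forall>b\<in>P. \<exists>c. (\<forall>x. 0 \<le> c x) \<and> b = (\<Sum>x\<in>D. c x *\<^sub>R x))"
    for D
  have "gen P"
    unfolding gen_def
  proof (intro conjI ballI)
    fix b assume b: "b \<in> P"
    have "b = (\<Sum>x\<in>P. (if x = b then 1 else 0) *\<^sub>R x)"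
      using b finP by (simp add: if_distrib[of "\<lambda>t. t *\<^sub>R _"] cong: if_cong)
    then show "\<exists>c. (\<forall>x. 0 \<le> c x) \<and> b = (\<Sum>x\<in>P. c x *\<^sub>R x)"
      by (intro exI[of _ "\<lambda>x. if x = b then 1 else 0"]) auto
  qed simp
  then obtain D where D: "gen D" and min: "\<And>D'. gen D' \<Longrightarrow> card D \<le> card D'"
    using ex_has_least_nat[of gen P card] by blast
  have DP: "D \<subseteq> P" using D by (simp add: gen_def)
  then have finD: "finite D" using finP finite_subset by blast
  have Dpos: "beta \<rho> x > 0" if "x \<in> D" for x using that DP by (auto simp: P_def)
  have Dgen: "\<exists>c. (\<forall>x. 0 \<le> c x) \<and> b = (\<Sum>x\<in>D. c x *\<^sub>R x)" if "b \<in> P" for b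
    using D that by (simp add: gen_def)
  \<comment> \<open>Pairing with \<open>\<rho>\<close> shows k > 0 if some coefficient is positive;
    then \<open>x0\<close> is generated by the others, against minimality.\<close>
  have irredundant: "c y = 0"
    if x0: "x0 \<in> D" and c: "\<And>x. x \<in> D - {x0} \<Longrightarrow> 0 \<le> c x"
      and eq: "(\<Sum>x\<in>D - {x0}. c x *\<^sub>R x) = k *\<^sub>R x0" and y: "y \<in> D - {x0}" for x0 c k y
  proof (rule ccontr)
    assume "c y \<noteq> 0"
    then have cy: "c y > 0" using c[OF y] by simp
    have "0 < (\<Sum>x\<in>D - {x0}. c x * beta \<rho> x)"
    proof (rule sum_pos2[of _ y])
      show "0 < c y * beta \<rho> y" using cy Dpos y by simp
      show "0 \<le> c x * beta \<rho> x" if "x \<in> D - {x0}" for x using c[OF that] Dpos[of x] that by simp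
    qed (use finD y in auto)
    also have "\<dots> = beta \<rho> (k *\<^sub>R x0)" by (simp add: beta_sum_right beta_simps flip: eq)
    finally have "k > 0" using Dpos[OF x0] by (simp add: beta_simps zero_less_mult_iff)
    have x0eq: "x0 = (\<Sum>x\<in>D - {x0}. (c x / k) *\<^sub>R x)"
    proof -
      have "x0 = (1 / k) *\<^sub>R (k *\<^sub>R x0)" using \<open>k > 0\<close> by simp
      then show ?thesis by (simp add: scaleR_sum_right flip: eq)
    qed
    have "gen (D - {x0})"
      unfolding gen_def
    proof (intro conjI ballI)
      show "D - {x0} \<subseteq> P" using DP by auto
      fix b assume "b \<in> P"
      then obtain e where e: "\<And>x. 0 \<le> e x" "b = (\<Sum>x\<in>D. e x *\<^sub>R x)" using Dgen by blast
      have "b = e x0 *\<^sub>R x0 + (\<Sum>x\<in>D - {x0}. e x *\<^sub>R x)"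
        unfolding e(2) by (rule sum.remove[OF finD x0])
      also have "e x0 *\<^sub>R x0 = (\<Sum>x\<in>D - {x0}. (e x0 * (c x / k)) *\<^sub>R x)"
        by (subst x0eq) (simp add: scaleR_sum_right)
      finally have "b = (\<Sum>x\<in>D - {x0}. (e x0 * (c x / k) + e x) *\<^sub>R x)"
        by (simp add: scaleR_left_distrib sum.distrib)
      also have "\<dots> = (\<Sum>x\<in>D - {x0}. (if x \<in> D - {x0} then e x0 * (c x / k) + e x else 0) *\<^sub>R x)"
        by (intro sum.cong) auto
      finally show "\<exists>c. (\<forall>x. 0 \<le> c x) \<and> b = (\<Sum>x\<in>D - {x0}. c x *\<^sub>R x)"
        using e(1) c \<open>k > 0\<close>
        by (intro exI[of _ "\<lambda>x. if x \<in> D - {x0} then e x0 * (c x / k) + e x else 0"]) auto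
    qed
    from min[OF this] show False using x0 finD by (simp add: card_Diff_singleton) (metis card_gt_0_iff empty_iff finD not_less One_nat_def Suc_pred diff_less zero_less_one less_irrefl not_le)
  qed
  \<comment> \<open>Otherwise the reflected root \<open>b - t *\<^sub>R a\<close>, or its negative,
    is a nonnegative combination of \<open>D\<close>; with t > 0 either case is a relation excluded
    by \<open>irredundant\<close>.\<close>
  have obtuse: "beta a b \<le> 0" if ab: "a \<in> D" "b \<in> D" "a \<noteq> b" for a b
  proof (rule ccontr)
    assume "\<not> ?thesis"
    then have t: "2 * beta a b > 0" by simp
    define t where "t = 2 * beta a b"
    have au: "a \<in> unit_roots" "b \<in> unit_roots" using ab DP by (auto simp: P_def)
    have e: "b - t *\<^sub>R a \<in> unit_roots"
      using unit_roots_invariant[OF root_refl(1)[OF au(1)] au(2)] by (simp add: root_refl(2)[OF au(1)] t_def)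
    show False
    proof (cases "b - t *\<^sub>R a \<in> P")
      case True
      then obtain c where c: "\<And>x. 0 \<le> c x" "b - t *\<^sub>R a = (\<Sum>x\<in>D. c x *\<^sub>R x)" using Dgen by blast
      have "(\<Sum>x\<in>D - {b}. (c x + (if x = a then t else 0)) *\<^sub>R x) = (\<Sum>x\<in>D - {b}. c x *\<^sub>R x) + t *\<^sub>R a"
        using ab finD by (simp add: scaleR_left_distrib sum.distrib if_distrib[of "\<lambda>t. t *\<^sub>R _"] cong: if_cong)
      also have "\<dots> = (1 - c b) *\<^sub>R b"
        using c(2) sum.remove[OF finD ab(2), of "\<lambda>x. c x *\<^sub>R x"] by (simp add: algebra_simps)
      finally have "c a + (if a = a then t else 0) = 0"
        by (rule irredundant[OF ab(2), rotated]) (use c(1) t ab in \<open>auto simp: t_def\<close>)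
      then show False using c(1)[of a] t by (simp add: t_def)
    next
      case False
      then have "- (b - t *\<^sub>R a) \<in> P" using neg e by blast
      then obtain c where c: "\<And>x. 0 \<le> c x" "- (b - t *\<^sub>R a) = (\<Sum>x\<in>D. c x *\<^sub>R x)" using Dgen by blast
      have "(\<Sum>x\<in>D - {a}. (c x + (if x = b then 1 else 0)) *\<^sub>R x) = (\<Sum>x\<in>D - {a}. c x *\<^sub>R x) + b"
        using ab finD by (simp add: scaleR_left_distrib sum.distrib if_distrib[of "\<lambda>t. t *\<^sub>R _"] cong: if_cong)
      also have "\<dots> = (t - c a) *\<^sub>R a"
        using c(2) sum.remove[OF finD ab(1), of "\<lambda>x. c x *\<^sub>R x"] by (simp add: algebra_simps)
      finally have "c b + (if b = b then 1 else 0) = 0"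
        by (rule irredundant[OF ab(1), rotated]) (use c(1) ab in auto)
      then show False using c(1)[of b] by simp
    qed
  qed
  have positive: "c x = 0"
    if "D' \<subseteq> D" "\<And>x. x \<in> D' \<Longrightarrow> 0 \<le> c x" "(\<Sum>x\<in>D'. c x *\<^sub>R x) = 0" "x \<in> D'" for D' c x
  proof -
    have "(\<Sum>x\<in>D'. c x * beta \<rho> x) = beta \<rho> (\<Sum>x\<in>D'. c x *\<^sub>R x)"
      by (simp add: beta_sum_right beta_simps)
    then have "(\<Sum>x\<in>D'. c x * beta \<rho> x) = 0" using that(3) by simp
    moreover have "0 \<le> c x * beta \<rho> x" if "x \<in> D'" for x
      using \<open>\<And>x. x \<in> D' \<Longrightarrow> 0 \<le> c x\<close>[OF that] Dpos[of x] \<open>D' \<subseteq> D\<close> that by auto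
    ultimately have "c x * beta \<rho> x = 0"
      using sum_nonneg_eq_0_iff[of D' "\<lambda>x. c x * beta \<rho> x"] finite_subset[OF that(1) finD] that(4) by blast
    then show ?thesis using Dpos[of x] that by auto
  qed
  have "independent D"
  proof (rule independent_if_scalars_zero[OF finD])
    fix c x assume eq: "(\<Sum>x\<in>D. c x *\<^sub>R x) = 0" and x: "x \<in> D"
    \<comment> \<open>Separate the positive coefficients: both sides of the relation equal
      \<open>u\<close>, and the obtuse angles give \<open>beta u u \<le> 0\<close>, so
      \<open>u\<close> is zero.\<close>
    define Q where "Q = {x \<in> D. c x > 0}"
    have Q: "Q \<subseteq> D" "finite Q" using finD by (auto simp: Q_def)
    define u where "u = (\<Sum>x\<in>Q. c x *\<^sub>R x)"
    have split: "(\<Sum>x\<in>D. c x *\<^sub>R x) = u + (\<Sum>x\<in>D - Q. c x *\<^sub>R x)"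
      unfolding u_def using sum.subset_diff[OF Q(1) finD, of "\<lambda>x. c x *\<^sub>R x"] by (simp add: add.commute)
    then have u: "u = (\<Sum>y\<in>D - Q. (- c y) *\<^sub>R y)"
      using eq by (simp add: sum_negf eq_neg_iff_add_eq_0)
    have "beta u u = (\<Sum>x\<in>Q. c x * beta x u)"
      by (subst (1) u_def) (simp only: beta_sum_left beta_scale_left)
    also have "\<dots> = (\<Sum>x\<in>Q. \<Sum>y\<in>D - Q. c x * (- c y) * beta x y)"
      by (subst u) (simp only: beta_sum_right beta_scale_right sum_distrib_left mult.assoc)
    also have "\<dots> \<le> 0"
    proof (intro sum_nonpos)
      fix x y assume "x \<in> Q" "y \<in> D - Q"
      then have "c x > 0" "c y \<le> 0" "beta x y \<le> 0" using obtuse by (auto simp: Q_def)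
      then show "c x * (- c y) * beta x y \<le> 0" by (intro mult_nonneg_nonpos mult_nonneg_nonneg) auto
    qed
    finally have "u = 0" using beta_pos[of u] by (cases "u = 0") auto
    have "c y = 0" if "y \<in> Q" for y
      by (rule positive[OF Q(1) _ _ that]) (use \<open>u = 0\<close> in \<open>auto simp: u_def Q_def\<close>)
    then have "Q = {}" by (auto simp: Q_def)
    then have "(- c x) = 0"
      by (intro positive[of D "\<lambda>x. - c x" x]) (use eq x in \<open>auto simp: Q_def sum_negf not_less\<close>)
    then show "c x = 0" by simp
  qed
  moreover have "span D = UNIV"
  proof -
    have "unit_roots \<subseteq> span D"
    proof
      fix b assume b: "b \<in> unit_roots"
      have *: "v \<in> span D" if "v \<in> P" for v
      proof -
        obtain c where "v = (\<Sum>x\<in>D. c x *\<^sub>R x)" using Dgen[OF \<open>v \<in> P\<close>] by blast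
        then show ?thesis by (simp add: span_sum span_scale span_base)
      qed
      show "b \<in> span D"
      proof (cases "b \<in> P")
        case False
        then have "- b \<in> span D" using * neg b by blast
        then show ?thesis using span_neg by fastforce
      qed (rule *)
    qed
    from span_minimal[OF this subspace_span] show ?thesis using unit_roots_span by auto
  qed
  moreover have flip: "b = a \<or> b = - a"
    if a: "a \<in> D" and b: "b \<in> unit_roots"
      and flip: "(beta \<rho> b > 0) \<noteq> (beta \<rho> (root_refl a *v b) > 0)" for a b
  proof -
    have au: "a \<in> unit_roots" using a DP by (auto simp: P_def)
    have pos: "b = a" if bP: "b \<in> P" and nP: "root_refl a *v b \<notin> P" for b
    proof -
      have bu: "b \<in> unit_roots" using bP by (simp add: P_def)
      define t where "t = 2 * beta a b"
      have rb: "root_refl a *v b = b - t *\<^sub>R a" by (simp add: root_refl(2)[OF au] t_def)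
      obtain c where c: "\<And>x. 0 \<le> c x" "b = (\<Sum>x\<in>D. c x *\<^sub>R x)" using Dgen bP by blast
      have "- (b - t *\<^sub>R a) \<in> P"
        using neg[OF unit_roots_invariant[OF root_refl(1)[OF au] bu] nP] unfolding rb .
      then obtain e where e: "\<And>x. 0 \<le> e x" "- (b - t *\<^sub>R a) = (\<Sum>x\<in>D. e x *\<^sub>R x)" using Dgen by blast
      have c': "b = c a *\<^sub>R a + (\<Sum>x\<in>D - {a}. c x *\<^sub>R x)"
        using c(2) sum.remove[OF finD a, of "\<lambda>x. c x *\<^sub>R x"] by simp
      have e': "- (b - t *\<^sub>R a) = e a *\<^sub>R a + (\<Sum>x\<in>D - {a}. e x *\<^sub>R x)"
        using e(2) sum.remove[OF finD a, of "\<lambda>x. e x *\<^sub>R x"] by simp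
      have sumeq: "(\<Sum>x\<in>D - {a}. (c x + e x) *\<^sub>R x) = (t - c a - e a) *\<^sub>R a"
      proof -
        have "(\<Sum>x\<in>D - {a}. (c x + e x) *\<^sub>R x) = (\<Sum>x\<in>D - {a}. c x *\<^sub>R x) + (\<Sum>x\<in>D - {a}. e x *\<^sub>R x)"
          by (simp add: scaleR_left_distrib sum.distrib)
        also have "(\<Sum>x\<in>D - {a}. c x *\<^sub>R x) = b - c a *\<^sub>R a"
          by (subst c') simp
        also have "(\<Sum>x\<in>D - {a}. e x *\<^sub>R x) = - (b - t *\<^sub>R a) - e a *\<^sub>R a"
          unfolding e' by simp
        finally show ?thesis by (simp add: algebra_simps)
      qed
      \<comment> \<open>The reflection changes only the coefficient at \<open>a\<close>, so the
        coefficients of \<open>b\<close> and of the negative of its image cancel elsewhere; both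
        being nonnegative, they vanish.\<close>
      have "c x + e x = 0" if "x \<in> D - {a}" for x
        by (rule irredundant[OF a _ sumeq that]) (simp add: c(1) e(1))
      then have "c x = 0" if "x \<in> D - {a}" for x
        using c(1)[of x] e(1)[of x] that by (metis add_nonneg_eq_0_iff)
      then have ba: "b = c a *\<^sub>R a" using c' by simp
      then have "c a * c a = 1"
        using unit_root_beta[OF bu] unit_root_beta[OF au] by (simp add: beta_simps)
      then have "c a = 1" using c(1)[of a] by (simp add: square_eq_1_iff)
      then show "b = a" using ba by simp
    qed
    have rbu: "root_refl a *v b \<in> unit_roots" using unit_roots_invariant[OF root_refl(1)[OF au] b] .
    show ?thesis
    proof (cases "b \<in> P")
      case True
      then show ?thesis using pos flip rbu by (auto simp: P_def)
    next
      case False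
      have "root_refl a *v (- b) = - (root_refl a *v b)"
        using matrix_vector_mult_scaleR[of "root_refl a" "-1" b] by simp
      moreover have "root_refl a *v b \<in> P" using False flip rbu b by (auto simp: P_def)
      then have "- (root_refl a *v b) \<notin> P"
        using beta_scale_right[of \<rho> "-1"] by (simp add: P_def)
      ultimately have "- b = a" using pos[of "- b"] neg[OF b False] by simp
      then show ?thesis by auto
    qed
  qed
  moreover have "D \<subseteq> unit_roots" using DP by (auto simp: P_def)
  ultimately show ?thesis using that \<rho> finD by blast
qed

end

lemma Const_eq_1_iff [simp]: "Const a = 1 \<longleftrightarrow> a = 1"
  using Const_inject[of a 1] unfolding Const_simps(2) .

context reflection_group
begin

text \<open>The product of the simple reflections in any order. Each factor changes the sign of two
  roots at most, which gives the bound 2N, and independence of the simple roots excludes fixed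
  vectors.\<close>

lemma coxeter_element:
  obtains \<rho> c where "c \<in> W" "\<And>v. c *v v = v \<Longrightarrow> v = 0" "\<And>b. b \<in> unit_roots \<Longrightarrow> beta \<rho> b \<noteq> 0"
    "card {b \<in> unit_roots. (beta \<rho> b > 0) \<noteq> (beta \<rho> (c *v b) > 0)} \<le> 2 * CARD('n)"
proof -
  obtain \<rho> D where \<rho>: "\<And>b. b \<in> unit_roots \<Longrightarrow> beta \<rho> b \<noteq> 0" and D: "finite D" "D \<subseteq> unit_roots"
    "independent D" "span D = UNIV" and flip: "\<And>a b. a \<in> D \<Longrightarrow> b \<in> unit_roots \<Longrightarrow>
      (beta \<rho> b > 0) \<noteq> (beta \<rho> (root_refl a *v b) > 0) \<Longrightarrow> b = a \<or> b = - a"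
    by (rule simple_system) (rule that)
  obtain xs where xs: "set xs = D" "distinct xs" using finite_distinct_list[OF D(1)] by blast
  define cox where "cox ys = foldr (\<lambda>a M. root_refl a ** M) ys (mat 1)" for ys
  have cox_simps: "cox [] *v v = v" "cox (a # ys) *v v = root_refl a *v (cox ys *v v)" for a ys v
    by (simp_all add: cox_def matrix_vector_mul_assoc)
  have coxW: "cox ys \<in> W" if "set ys \<subseteq> D" for ys
    using that D(2) root_refl(1) by (induction ys) (auto simp: cox_def one_W mult_W)
  have diff: "cox ys *v v - v \<in> span (set ys)" if "set ys \<subseteq> D" for ys v
    using that
  proof (induction ys)
    case (Cons a ys)
    have a: "a \<in> unit_roots" using Cons.prems D(2) by auto
    have "cox (a # ys) *v v - v = (cox ys *v v - v) - (2 * beta a (cox ys *v v)) *\<^sub>R a"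
      by (simp add: cox_simps root_refl(2)[OF a])
    moreover have "cox ys *v v - v \<in> span (set (a # ys))"
      using Cons span_mono[of "set ys" "set (a # ys)"] by auto
    moreover have "(2 * beta a (cox ys *v v)) *\<^sub>R a \<in> span (set (a # ys))"
      by (intro span_scale span_base) simp
    ultimately show ?case by (simp only: span_diff)
  qed (simp add: cox_simps)
  \<comment> \<open>If the whole product fixes \<open>v\<close>, the tail moves \<open>v\<close> by
    a multiple of \<open>a\<close> that lies in the span of the remaining simple roots, hence by
    zero; then induct.\<close>
  have fixed: "\<forall>a\<in>set ys. beta a v = 0"
    if "set ys \<subseteq> D" "distinct ys" "cox ys *v v = v" for ys v
    using that
  proof (induction ys)
    case (Cons a ys)
    have a: "a \<in> unit_roots" using Cons.prems D(2) by auto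
    have "root_refl a *v (root_refl a *v (cox ys *v v)) = cox ys *v v"
      using unit_root_beta[OF a]
      by (simp add: root_refl(2)[OF a] beta_simps)
    then have "cox ys *v v = root_refl a *v v" using Cons.prems(3) by (simp add: cox_simps)
    then have eq: "cox ys *v v - v = - ((2 * beta a v) *\<^sub>R a)" by (simp add: root_refl(2)[OF a])
    have ind: "a \<notin> span (set ys)"
    proof -
      have "independent (insert a (set ys))"
        using independent_mono[OF D(3)] Cons.prems(1) by simp
      then show ?thesis using Cons.prems(2) by (simp add: independent_insert)
    qed
    have av: "beta a v = 0"
    proof (rule ccontr)
      assume "beta a v \<noteq> 0"
      have "- ((2 * beta a v) *\<^sub>R a) \<in> span (set ys)" using diff[of ys v] Cons.prems(1) eq by simp
      then have "(- 1 / (2 * beta a v)) *\<^sub>R (- ((2 * beta a v) *\<^sub>R a)) \<in> span (set ys)"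
        by (rule span_scale)
      then show False using ind \<open>beta a v \<noteq> 0\<close> by simp
    qed
    then have "cox ys *v v = v" using eq by simp
    then show ?case using Cons av by simp
  qed simp
  have "v = 0" if "cox xs *v v = v" for v
  proof -
    have "\<forall>a\<in>D. beta a v = 0" using fixed[of xs v] xs that by simp
    then have "D \<subseteq> {u. beta u v = 0}" by blast
    moreover have "subspace {u. beta u v = 0}" by (auto simp: subspace_def beta_simps)
    ultimately have "span D \<subseteq> {u. beta u v = 0}" by (rule span_minimal)
    then have "beta v v = 0" using D(4) by blast
    then show ?thesis by simp
  qed
  moreover have flips: "card {b \<in> unit_roots. (beta \<rho> b > 0) \<noteq> (beta \<rho> (cox ys *v b) > 0)} \<le> 2 * length ys"
    if "set ys \<subseteq> D" for ys
    using that
  proof (induction ys)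
    case (Cons a ys)
    let ?A = "{b \<in> unit_roots. (beta \<rho> b > 0) \<noteq> (beta \<rho> (cox ys *v b) > 0)}"
    \<comment> \<open>Prepending the reflection in \<open>a\<close> affects only the two roots that
      the tail carries to \<open>a\<close> or \<open>- a\<close>.\<close>
    let ?B = "{b. cox ys *v b = a \<or> cox ys *v b = - a}"
    have "ys_inv": "invertible (cox ys)" using coxW Cons.prems invertible_W by auto
    then have inj: "inj ((*v) (cox ys))" by (rule inj_matrix_vector_mult)
    have "?B = (*v) (cox ys) -` {a, - a}" by auto
    also have "card \<dots> \<le> card {a, - a}"
      using card_vimage_inj_on_le[OF inj, of "{a, - a}"] by simp
    also have "\<dots> \<le> 2" by (simp add: card_insert_if)
    finally have B: "card ?B \<le> 2" .
    have finB: "finite ?B"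
    proof -
      have "finite ((*v) (cox ys) -` {a, - a})" by (rule finite_vimageI) (use inj in auto)
      also have "(*v) (cox ys) -` {a, - a} = ?B" by auto
      finally show ?thesis .
    qed
    have "{b \<in> unit_roots. (beta \<rho> b > 0) \<noteq> (beta \<rho> (cox (a # ys) *v b) > 0)} \<subseteq> ?A \<union> ?B"
    proof
      fix b assume b: "b \<in> {b \<in> unit_roots. (beta \<rho> b > 0) \<noteq> (beta \<rho> (cox (a # ys) *v b) > 0)}"
      show "b \<in> ?A \<union> ?B"
      proof (cases "b \<in> ?A")
        case False
        have "cox ys *v b \<in> unit_roots" using coxW Cons.prems b by (intro unit_roots_invariant) auto
        moreover have "(beta \<rho> (cox ys *v b) > 0) \<noteq> (beta \<rho> (root_refl a *v (cox ys *v b)) > 0)"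
          using b False by (auto simp: cox_simps)
        ultimately have "cox ys *v b = a \<or> cox ys *v b = - a"
          using flip[of a "cox ys *v b"] Cons.prems by auto
        then show ?thesis by simp
      qed simp
    qed
    then have "card {b \<in> unit_roots. (beta \<rho> b > 0) \<noteq> (beta \<rho> (cox (a # ys) *v b) > 0)} \<le> card (?A \<union> ?B)"
      using finB finite_unit_roots by (intro card_mono) auto
    also have "\<dots> \<le> card ?A + card ?B" by (rule card_Un_le)
    finally show ?case using Cons B by simp
  qed (simp add: cox_simps)
  moreover have "length xs = CARD('n)"
  proof -
    have "card D = dim (UNIV :: (real, 'n) vec set)"
      using dim_eq_card[of D UNIV] D by simp
    then show ?thesis using xs distinct_card[of xs] by simp
  qed
  ultimately show ?thesis
    using that[of "cox xs" \<rho>] coxW[of xs] \<rho> flips[of xs] xs by auto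
qed

section \<open>Powers and eigenvectors of the Coxeter element\<close>

definition mpow :: "((real, 'n) vec, 'n) vec \<Rightarrow> nat \<Rightarrow> ((real, 'n) vec, 'n) vec" where
  "mpow c k = ((\<lambda>M. c ** M) ^^ k) (mat 1)"

lemma mpow_simps: "mpow c 0 = mat 1" "mpow c (Suc k) = c ** mpow c k"
  by (simp_all add: mpow_def)

lemma mpow_add: "mpow c (i + k) = mpow c i ** mpow c k"
  by (induction i) (simp_all add: mpow_simps matrix_mul_assoc)

lemma mpow_W: "c \<in> W \<Longrightarrow> mpow c k \<in> W"
  by (induction k) (simp_all add: mpow_simps one_W mult_W)

lemma finite_order:
  assumes "c \<in> W"
  obtains p where "0 < p" "mpow c p = mat 1"
proof -
  have "\<not> inj (mpow c)"
    using finite_W mpow_W[OF assms] finite_imageD[of "mpow c" UNIV] finite_subset[of "range (mpow c)" W]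
    by auto
  then obtain i j where ij: "i < j" "mpow c i = mpow c j"
    by (metis injI linorder_neqE_nat)
  then have "mpow c i = mpow c i ** mpow c (j - i)" using mpow_add[of c i "j - i"] by simp
  then have "matrix_inv (mpow c i) ** mpow c i = matrix_inv (mpow c i) ** (mpow c i ** mpow c (j - i))"
    by simp
  then have "mat 1 = mpow c (j - i)"
    using matrix_inv_left[OF invertible_W[OF mpow_W[OF assms]]] by (simp add: matrix_mul_assoc)
  then show ?thesis using that[of "j - i"] ij by simp
qed

text \<open>The values of \<open>\<rho>\<close> along the orbit of \<open>b\<close> have a nonzero
  Fourier coefficient of low frequency. The same Fourier sum, taken over the vectors of the orbit,
  is then nonzero and an eigenvector.\<close>

lemma low_frequency_eigenvector:
  assumes c: "c \<in> W" "\<And>v. c *v v = v \<Longrightarrow> v = 0" and p: "0 < p" "mpow c p = mat 1"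
    and \<rho>: "\<And>b. b \<in> unit_roots \<Longrightarrow> beta \<rho> b \<noteq> 0" and b: "b \<in> unit_roots"
  obtains l :: int and v where "v \<noteq> 0" "l \<noteq> 0"
    "complexify c *v v = cis (- (2 * pi * of_int l / real p)) *s v"
    "2 * \<bar>l\<bar> \<le> int (card {k. k < p \<and> beta \<rho> (mpow c k *v b) * beta \<rho> (mpow c (Suc k) *v b) < 0})"
proof -
  define x where "x k = mpow c k *v b" for k
  have xu: "x k \<in> unit_roots" for k
    unfolding x_def by (intro unit_roots_invariant mpow_W c b)
  have xS: "x (Suc k) = c *v x k" for k by (simp add: x_def mpow_simps matrix_vector_mul_assoc)
  have xp: "x (k + p) = x k" for k by (simp add: x_def mpow_add p)
  obtain l :: int where l:
    "2 * \<bar>l\<bar> \<le> int (card {k. k < p \<and> beta \<rho> (x k) * beta \<rho> (x (Suc k)) < 0})"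
    "(\<Sum>k<p. complex_of_real (beta \<rho> (x k)) * cis (2 * pi * of_int l * real k / real p)) \<noteq> 0"
    using low_frequency_of_sign_changes[OF p(1), of "\<lambda>k. beta \<rho> (x k)"] \<rho>[OF xu] xp by auto
  define e where "e k = cis (2 * pi * of_int l * real k / real p)" for k
  define v where "v = (\<chi> i. \<Sum>k<p. e k * complex_of_real (x k $ i))"
  have e_Suc: "e k = cis (- (2 * pi * of_int l / real p)) * e (Suc k)" for k
    unfolding e_def cis_mult using p(1) by (intro arg_cong[where f = cis]) (simp add: field_simps)
  have e_p: "e p = 1" "e 0 = 1"
    using p(1) cis_multiple_2pi[of "of_int l"] by (simp_all add: e_def mult.assoc)
  have "v \<noteq> 0"
  proof
    assume "v = 0"
    have "beta \<rho> (x k) = (\<Sum>i\<in>UNIV. x k $ i * (gram *v \<rho>) $ i)" for k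
      using inner_gram[of "x k" \<rho>] beta_commute[of \<rho> "x k"] by (simp add: inner_vec_def)
    then have "(\<Sum>k<p. complex_of_real (beta \<rho> (x k)) * e k)
        = (\<Sum>k<p. \<Sum>i\<in>UNIV. complex_of_real ((gram *v \<rho>) $ i) * (e k * complex_of_real (x k $ i)))"
      by (simp add: sum_distrib_left mult_ac)
    also have "\<dots> = (\<Sum>i\<in>UNIV. complex_of_real ((gram *v \<rho>) $ i) * v $ i)"
      by (subst sum.swap) (simp add: v_def sum_distrib_left)
    finally show False using l(2) \<open>v = 0\<close> by (simp add: e_def)
  qed
  moreover have "l \<noteq> 0"
  proof
    assume "l = 0"
    \<comment> \<open>For frequency 0 the eigenvector is the sum over a period, which is fixed by
      \<open>c\<close> and hence zero.\<close>
    define y where "y = (\<Sum>k<p. x k)"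
    have "c *v y = (\<Sum>k<p. x (Suc k))"
      unfolding y_def xS by (rule linear_sum[OF matrix_vector_mul_linear])
    also have "\<dots> = y"
      using sum.lessThan_Suc_shift[of x p] sum.lessThan_Suc[of x p] xp[of 0] by (simp add: y_def)
    finally have "y = 0" by (rule c(2))
    then have "(\<Sum>k<p. x k $ i) = 0" for i by (simp add: y_def vec_eq_iff)
    then have "v = 0"
      using \<open>l = 0\<close> by (simp add: v_def e_def vec_eq_iff flip: of_real_sum)
    then show False using \<open>v \<noteq> 0\<close> by simp
  qed
  moreover have "complexify c *v v = cis (- (2 * pi * of_int l / real p)) *s v"
  proof (rule vec_eq_iff[THEN iffD2], rule)
    fix i
    have "(complexify c *v v) $ i = (\<Sum>j\<in>UNIV. \<Sum>k<p. complex_of_real (c $ i $ j) * (e k * complex_of_real (x k $ j)))"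
      by (simp add: matrix_vector_mult_def complexify_def v_def sum_distrib_left)
    also have "\<dots> = (\<Sum>k<p. e k * complex_of_real (x (Suc k) $ i))"
      by (subst sum.swap) (simp add: xS matrix_vector_mult_def sum_distrib_left mult_ac)
    also have "\<dots> = cis (- (2 * pi * of_int l / real p)) * (\<Sum>k<p. e (Suc k) * complex_of_real (x (Suc k) $ i))"
      by (subst e_Suc) (simp add: sum_distrib_left mult.assoc)
    also have "(\<Sum>k<p. e (Suc k) * complex_of_real (x (Suc k) $ i)) = (\<Sum>k<p. e k * complex_of_real (x k $ i))"
      using sum.lessThan_Suc_shift[of "\<lambda>k. e k * complex_of_real (x k $ i)" p]
        sum.lessThan_Suc[of "\<lambda>k. e k * complex_of_real (x k $ i)" p] xp[of 0] e_p by simp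
    finally show "(complexify c *v v) $ i = (cis (- (2 * pi * of_int l / real p)) *s v) $ i"
      by (simp add: v_def)
  qed
  ultimately show ?thesis using that l(1) unfolding x_def by blast
qed

end

context invariant_generators
begin

section \<open>Degrees of invariants and eigenvalues of group elements\<close>

lemma degree_pos: "d i \<ge> 1"
proof -
  have "z i \<noteq> 0" using subst_z_inj[of "Var i"] pd_Var[of i i] by auto
  then have "\<not> d i < 0" using hom_negative hom_z by blast
  moreover have "d i \<noteq> 0"
  proof
    assume "d i = 0"
    then obtain c where "z i = Const c" using hom_degree_0 hom_z by metis
    then have "Var i = Const c" using subst_z_inject[of "Var i" "Const c"] by simp
    then have "pd i (Var i) = 0" by simp
    then show False by (simp add: pd_Var)
  qed
  ultimately show ?thesis by simp
qed

text \<open>If all \<open>z i\<close> vanish at \<open>v\<close>, every invariant takes the same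
  value at \<open>v\<close> and at 0. The product of 1 - u over the conjugates u of a linear form
  with value 1 at \<open>v\<close> vanishes at \<open>v\<close> but is 1 at 0.\<close>

lemma invariants_separate_zero:
  assumes "v \<noteq> 0"
  shows "\<exists>i. subst (\<lambda>i. Const (v $ i)) (z i) \<noteq> (0 :: 'n mpoly)"
proof (rule ccontr)
  let ?ev = "\<lambda>u. subst (\<lambda>i. Const (u $ i)) :: 'n mpoly \<Rightarrow> 'n mpoly"
  assume "\<not> ?thesis"
  then have v: "?ev v (z i) = 0" for i by simp
  have zero: "?ev 0 (z i) = 0" for i
  proof -
    have "?ev 0 (subst (\<lambda>i. Const 2 * Var i) (z i)) = ?ev 0 (z i)"
      by (simp add: subst_subst subst_simps Const_simps)
    then have "Const (2 powi d i) * ?ev 0 (z i) = 1 * ?ev 0 (z i)"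
      using hom_z[of i] unfolding hom_def by (simp add: subst_simps del: Const_numeral)
    moreover have "(2::complex) powi d i \<noteq> 1"
    proof
      assume "(2::complex) powi d i = 1"
      then have "norm ((2::complex) powi d i) = 1" by simp
      then have "(2::real) powi d i = 1" unfolding norm_power_int by simp
      then show False using power_int_strict_increasing[of 0 "d i" "2::real"] degree_pos[of i] by simp
    qed
    then have "Const (2 powi d i) \<noteq> (1 :: 'n mpoly)"
      by simp
    ultimately show ?thesis
      using mult_right_cancel[of "?ev 0 (z i)" "Const (2 powi d i)" 1] by (cases "?ev 0 (z i) = 0") simp_all
  qed
  obtain i0 where i0: "v $ i0 \<noteq> 0" using assms by (auto simp: vec_eq_iff)
  define a where "a = (1 / v $ i0) *s axis i0 (1::complex)"
  define f where "f = linear_form a"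
  have f: "f = Const (1 / v $ i0) * Var i0" by (simp add: f_def a_def linear_form_scale linear_form_axis)
  define P where "P = (\<Prod>u\<in>orbit f. 1 - u)"
  have "act w P = P" if "w \<in> W" for w
    unfolding P_def act_simps by (rule prod.reindex_bij_betw[OF bij_betw_act_orbit[OF that]])
  then obtain Q where Q: "P = subst z Q" using invariantE by blast
  have "?ev v P = ?ev 0 P" unfolding Q subst_subst v zero ..
  moreover have "?ev v P = 0"
  proof -
    have "?ev v (1 - f) = 0" using i0 by (simp add: f subst_simps flip: Const_simps)
    then show ?thesis
      unfolding P_def subst_simps using finite_orbit self_in_orbit
      by (intro prod_zero bexI[of _ f]) (auto simp: subst_simps)
  qed
  moreover have "?ev 0 P = 1"
  proof -
    have "?ev 0 u = 0" if "u \<in> orbit f" for u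
      using that by (auto simp: orbit_def f_def act_linear_form subst_linear_form Const_simps)
    then show ?thesis unfolding P_def subst_simps by simp
  qed
  ultimately show False by simp
qed

text \<open>Evaluate at the eigenvector an invariant that does not vanish there: invariance and
  homogeneity give two expressions for its value at \<open>c v\<close>.\<close>

lemma eigenvalue_degree:
  assumes "c \<in> W" "v \<noteq> 0" "complexify c *v v = \<omega> *s v" "\<omega> \<noteq> 0"
  shows "\<exists>i. \<omega> powi d i = 1"
proof -
  let ?ev = "\<lambda>u. subst (\<lambda>i. Const (u $ i)) :: 'n mpoly \<Rightarrow> 'n mpoly"
  obtain i where i: "?ev v (z i) \<noteq> 0" using invariants_separate_zero[OF assms(2)] by blast
  have cc: "matrix_inv (matrix_inv c) = c"
    by (rule matrix_inv_unique) (simp add: matrix_inv_right invertible_W assms(1))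
  have "?ev v (z i) = ?ev v (act (matrix_inv c) (z i))"
    by (simp add: act_z inv_W assms(1))
  also have "\<dots> = ?ev (complexify c *v v) (z i)"
    unfolding act_eq subst_subst cc subst_linear_form
    by (simp add: matrix_vector_mult_def complexify_def Const_simps)
  also have "\<dots> = ?ev v (subst (\<lambda>i. Const \<omega> * Var i) (z i))"
    by (simp add: assms(3) subst_subst subst_simps Const_simps)
  also have "\<dots> = Const (\<omega> powi d i) * ?ev v (z i)"
    using hom_z[of i] assms(4) unfolding hom_def by (simp add: subst_simps)
  finally have "Const (\<omega> powi d i) * ?ev v (z i) = 1 * ?ev v (z i)" by simp
  then have "Const (\<omega> powi d i) = (1 :: 'n mpoly)" by (rule mult_right_cancel[OF i, THEN iffD1])
  then have "\<omega> powi d i = 1" by simp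
  then show ?thesis by blast
qed

text \<open>The sign changes along the orbits of all roots are counted in two ways: at least 2p / h
  for each starting root, by the eigenvalue of low frequency, and at most 2N for each of the p
  steps. Roots come in pairs, at least one pair for each reflection.\<close>

lemma reflections_le_top_degree: "2 * int (card (reflections W)) \<le> int CARD('n) * d n0"
proof -
  obtain \<rho> c where c: "c \<in> W" "\<And>v. c *v v = v \<Longrightarrow> v = 0" "\<And>b. b \<in> unit_roots \<Longrightarrow> beta \<rho> b \<noteq> 0"
    "card {b \<in> unit_roots. (beta \<rho> b > 0) \<noteq> (beta \<rho> (c *v b) > 0)} \<le> 2 * CARD('n)"
    by (rule coxeter_element) (rule that)
  obtain p where p: "0 < p" "mpow c p = mat 1" using finite_order[OF c(1)] by blast
  define X where "X b = {k. k < p \<and> beta \<rho> (mpow c k *v b) * beta \<rho> (mpow c (Suc k) *v b) < 0}" for b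
  have bound: "2 * int p \<le> int (card (X b)) * d n0" if b: "b \<in> unit_roots" for b
  proof -
    obtain l :: int and v where lv: "v \<noteq> 0" "l \<noteq> 0"
      "complexify c *v v = cis (- (2 * pi * of_int l / real p)) *s v" "2 * \<bar>l\<bar> \<le> int (card (X b))"
      unfolding X_def by (rule low_frequency_eigenvector[OF c(1,2) p c(3) b]) (assumption | rule that)+
    then obtain i where "cis (- (2 * pi * of_int l / real p)) powi d i = 1"
      using eigenvalue_degree[OF c(1) lv(1,3)] by auto
    then have "cos (of_int (d i) * - (2 * pi * of_int l / real p)) = 1"
      by (simp add: cis_power_int complex_eq_iff)
    then obtain m :: int where "of_int (d i) * - (2 * pi * of_int l / real p) = of_int m * 2 * pi"
      unfolding cos_one_2pi_int by blast
    then have "pi * (of_int (d i) * of_int l) = pi * (- (of_int m * real p))"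
      using p(1) by (simp add: field_simps)
    then have "of_int (d i) * of_int l = - (of_int m * real p)"
      using mult_left_cancel[of pi] pi_neq_zero by blast
    then have "real_of_int (d i * l) = real_of_int (- m * int p)" by simp
    then have dl: "d i * l = - m * int p" by linarith
    \<comment> \<open>This is where nonzero frequency matters: p divides the nonzero integer
      \<open>d i * l\<close>, so p is at most its absolute value.\<close>
    then have "m \<noteq> 0" using lv(2) degree_pos[of i] by auto
    have "int p \<le> \<bar>m\<bar> * int p" using \<open>m \<noteq> 0\<close> p(1) by simp
    also have "\<dots> = \<bar>d i * l\<bar>" by (simp add: dl abs_mult)
    also have "\<dots> = \<bar>l\<bar> * d i" using degree_pos[of i] by (simp add: abs_mult)
    also have "\<dots> \<le> \<bar>l\<bar> * d n0" using d_le[of i] by (intro mult_left_mono) auto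
    finally have "2 * int p \<le> (2 * \<bar>l\<bar>) * d n0" by simp
    also have "\<dots> \<le> int (card (X b)) * d n0"
      using lv(4) degree_pos[of n0] by (intro mult_right_mono) auto
    finally show ?thesis .
  qed
  let ?Fl = "{b \<in> unit_roots. (beta \<rho> b > 0) \<noteq> (beta \<rho> (c *v b) > 0)}"
  have cX: "(\<Sum>b\<in>unit_roots. card (X b)) \<le> p * (2 * CARD('n))"
  proof -
    have flip: "beta \<rho> (mpow c k *v b) * beta \<rho> (mpow c (Suc k) *v b) < 0 \<longleftrightarrow> mpow c k *v b \<in> ?Fl"
      if b: "b \<in> unit_roots" for b k
    proof -
      have u: "mpow c j *v b \<in> unit_roots" for j by (intro unit_roots_invariant mpow_W c(1) b)
      then show ?thesis
        using c(3)[OF u[of k]] c(3)[OF u[of "Suc k"]]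
        by (auto simp: mult_less_0_iff mpow_simps simp flip: matrix_vector_mul_assoc)
    qed
    have "(\<Sum>b\<in>unit_roots. card (X b)) = (\<Sum>b\<in>unit_roots. \<Sum>k<p. if mpow c k *v b \<in> ?Fl then 1 else 0)"
    proof (rule sum.cong[OF refl])
      fix b assume b: "b \<in> unit_roots"
      have "X b = {k \<in> {..<p}. mpow c k *v b \<in> ?Fl}" unfolding X_def flip[OF b] by auto
      then show "card (X b) = (\<Sum>k<p. if mpow c k *v b \<in> ?Fl then 1 else 0)"
        by (simp add: sum.If_cases Int_def)
    qed
    also have "\<dots> = (\<Sum>k<p. card {b \<in> unit_roots. mpow c k *v b \<in> ?Fl})"
      by (subst sum.swap) (simp add: sum.If_cases finite_unit_roots Int_def)
    \<comment> \<open>For fixed \<open>k\<close> the power of \<open>c\<close> is injective on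
      roots, so the k-th step changes signs no more often than the first.\<close>
    also have "\<dots> \<le> (\<Sum>k<p. 2 * CARD('n))"
    proof (rule sum_mono)
      fix k
      have inj: "inj ((*v) (mpow c k))" by (intro inj_matrix_vector_mult invertible_W mpow_W c(1))
      have "card {b \<in> unit_roots. mpow c k *v b \<in> ?Fl} = card ((*v) (mpow c k) ` {b \<in> unit_roots. mpow c k *v b \<in> ?Fl})"
        using inj by (intro card_image[symmetric]) (auto intro: inj_on_subset)
      also have "\<dots> \<le> card ?Fl" using finite_unit_roots by (intro card_mono) auto
      finally show "card {b \<in> unit_roots. mpow c k *v b \<in> ?Fl} \<le> 2 * CARD('n)" using c(4) by simp
    qed
    finally show ?thesis by simp
  qed
  have "int (card unit_roots) * (2 * int p) = (\<Sum>b\<in>unit_roots. 2 * int p)" by simp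
  also have "\<dots> \<le> (\<Sum>b\<in>unit_roots. int (card (X b)) * d n0)" by (intro sum_mono bound)
  also have "\<dots> = int (\<Sum>b\<in>unit_roots. card (X b)) * d n0" by (simp add: sum_distrib_right)
  also have "\<dots> \<le> int (p * (2 * CARD('n))) * d n0"
    using cX[THEN of_nat_mono, where 'a = int] degree_pos[of n0] by (intro mult_right_mono) linarith+
  finally have "(2 * int p) * int (card unit_roots) \<le> (2 * int p) * (int CARD('n) * d n0)"
    by (simp add: mult_ac)
  then have "int (card unit_roots) \<le> int CARD('n) * d n0" using p(1) by simp
  then show ?thesis using card_unit_roots by linarith
qed

end

section \<open>A linear differential system with polynomial coefficients\<close>

lemma pd_of_nat [simp]: "pd i (of_nat n) = 0"
  by (induction n) (simp_all add: pd_add)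

lemma pd_of_int [simp]: "pd i (of_int n) = 0"
  by (cases n rule: int_diff_cases) (simp add: pd_diff)

lemma pd_power_Var: "pd i (Var i ^ n) = of_nat n * Var i ^ (n - 1)"
  using derivation_power[of "pd i" "Var i" n] by (simp add: pd_mult pd_Var)

lemma pd_prod_eq_0:
  assumes "\<And>x. x \<in> A \<Longrightarrow> pd i (f x) = 0"
  shows "pd i (prod f A) = 0"
  using assms by (induction A rule: infinite_finite_induct) (auto simp: pd_mult)

lemma pd_det_eq_0:
  assumes "\<And>k l. pd i (M $ k $ l) = 0"
  shows "pd i (det M) = 0"
  unfolding det_def pd_sum by (intro sum.neutral ballI) (simp add: pd_mult pd_prod_eq_0 assms)

lemma pd_iter_add: "(pd i ^^ n) (p + q) = (pd i ^^ n) p + (pd i ^^ n) q"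
  by (induction n) (simp_all add: pd_add)

lemma pd_iter_0 [simp]: "(pd i ^^ n) 0 = 0"
  by (induction n) simp_all

lemma pd_iter_diff: "(pd i ^^ n) (p - q) = (pd i ^^ n) p - (pd i ^^ n) q"
  by (induction n) (simp_all add: pd_diff)

lemma pd_iter_sum: "(pd i ^^ n) (sum f A) = (\<Sum>x\<in>A. (pd i ^^ n) (f x))"
  by (induction A rule: infinite_finite_induct) (simp_all add: pd_iter_add)

lemma pd_iter_mult: "pd i k = 0 \<Longrightarrow> (pd i ^^ n) (p * k) = (pd i ^^ n) p * k"
  by (induction n) (simp_all add: pd_mult)

lemma pd_iter_mono: "(pd i ^^ n) p = 0 \<Longrightarrow> n \<le> m \<Longrightarrow> (pd i ^^ m) p = 0"
  by (metis funpow_add comp_apply le_add_diff_inverse2 pd_iter_0)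

lemma pd_iter_power_Var_less: "m < n \<Longrightarrow> (pd i ^^ n) (Var i ^ m) = 0"
proof (induction n arbitrary: m)
  case (Suc n)
  show ?case
  proof (cases m)
    case 0
    then show ?thesis by (simp add: funpow_swap1)
  next
    case (Suc m')
    then have "(pd i ^^ Suc n) (Var i ^ m) = (pd i ^^ n) (Var i ^ m' * of_nat m)"
      unfolding funpow_Suc_right comp_apply pd_power_Var by (simp add: mult.commute)
    then show ?thesis using Suc.IH[of m'] Suc.prems Suc by (simp only: pd_iter_mult pd_of_nat) simp
  qed
qed simp

lemma pd_iter_power_Var: "(pd i ^^ n) (Var i ^ n) = of_nat (fact n)"
proof (induction n)
  case (Suc n)
  have "(pd i ^^ Suc n) (Var i ^ Suc n) = (pd i ^^ n) (Var i ^ n * of_nat (Suc n))"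
    unfolding funpow_Suc_right comp_apply pd_power_Var by (simp only: mult.commute diff_Suc_1)
  also have "\<dots> = of_nat (fact n) * of_nat (Suc n)" by (simp only: pd_iter_mult pd_of_nat Suc)
  finally show ?case by (simp only: fact_Suc of_nat_mult of_nat_id mult.commute)
qed simp

lemma pd_nilpotent: "\<exists>n. (pd i ^^ n) p = 0"
proof (induction p rule: poly_mapping_add_induct)
  case zero
  show ?case by (rule exI[of _ 0]) simp
next
  case (single k c)
  have "(pd i ^^ Suc m) (Poly_Mapping.single k c) = 0" if "Poly_Mapping.lookup k i = m" for m k c
    using that
  proof (induction m arbitrary: k c)
    case 0
    then show ?case by (simp add: pd_single)
  next
    case (Suc m)
    have "Poly_Mapping.lookup (k - Poly_Mapping.single i 1) i = m"
      using Suc.prems by (simp add: minus_poly_mapping.rep_eq)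
    from Suc.IH[OF this] show ?case
      unfolding funpow_Suc_right[of "Suc m"] comp_apply pd_single .
  qed
  then show ?case by blast
next
  case (add p q)
  then obtain n m where "(pd i ^^ n) p = 0" "(pd i ^^ m) q = 0" by blast
  then have "(pd i ^^ max n m) (p + q) = 0"
    using pd_iter_mono[of n i p "max n m"] pd_iter_mono[of m i q "max n m"] by (simp add: pd_iter_add)
  then show ?case by blast
qed

section \<open>Linear algebra over a domain\<close>

lemma clear_denominators:
  fixes x :: "'n::finite \<Rightarrow> 'a::idom fract"
  shows "\<exists>q a. q \<noteq> 0 \<and> (\<forall>i. to_frac q * x i = to_frac (a i))"
proof -
  have "\<exists>pq. snd pq \<noteq> 0 \<and> x i = Fract (fst pq) (snd pq)" for i
  proof (cases "x i")
    case (Fract a b)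
    then show ?thesis by (intro exI[of _ "(a, b)"]) simp
  qed
  then have "\<forall>i. \<exists>pq. snd pq \<noteq> 0 \<and> x i = Fract (fst pq) (snd pq)" by blast
  from choice[OF this] obtain r where r: "\<forall>i. snd (r i) \<noteq> 0 \<and> x i = Fract (fst (r i)) (snd (r i))"
    by (rule exE)
  define p q where "p = fst \<circ> r" and "q = snd \<circ> r"
  then have pq: "\<And>i. q i \<noteq> 0" "\<And>i. x i = Fract (p i) (q i)" using r by auto
  have "to_frac (prod q UNIV) * x i = to_frac ((prod q (UNIV - {i})) * p i)" for i
  proof -
    have "prod q UNIV = q i * prod q (UNIV - {i})" by (rule prod.remove) auto
    then show ?thesis using pq by (simp add: to_frac_def eq_fract mult_ac)
  qed
  then show ?thesis
    using pq(1) by (intro exI[of _ "prod q UNIV"] exI[of _ "\<lambda>i. prod q (UNIV - {i}) * p i"] conjI allI) simp_all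
qed

lemma det_0_kernel:
  fixes C :: "'a::idom ^ 'n::finite ^ 'n"
  assumes "det C = 0"
  obtains a where "\<exists>i. a i \<noteq> 0" "\<And>j. (\<Sum>i\<in>UNIV. a i * C $ i $ j) = 0"
proof -
  define A where "A = (\<chi> i j. to_frac (C $ i $ j))"
  have "det (transpose A) = 0"
    using assms by (simp add: A_def to_frac_simps flip: ringhom_det[OF ringhom_to_frac])
  then have "\<not> (\<exists>B. B ** transpose A = mat 1)"
    using invertible_det_nz[of "transpose A"] invertible_left_inverse[of "transpose A"] by blast
  then obtain x where x: "transpose A *v x = 0" "x \<noteq> 0"
    unfolding matrix_left_invertible_ker by blast
  obtain q a where q: "q \<noteq> 0" "\<And>i. to_frac q * x $ i = to_frac (a i)"
    using clear_denominators[of "\<lambda>i. x $ i"] by blast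
  obtain i where "x $ i \<noteq> 0" using x(2) by (auto simp: vec_eq_iff)
  then have "to_frac (a i) \<noteq> 0" using q by (simp flip: q(2))
  moreover have "(\<Sum>i\<in>UNIV. a i * C $ i $ j) = 0" for j
  proof -
    have "(\<Sum>i\<in>UNIV. A $ i $ j * x $ i) = 0"
      using x(1) by (simp add: vec_eq_iff matrix_vector_mult_def transpose_def)
    then have "to_frac q * (\<Sum>i\<in>UNIV. A $ i $ j * x $ i) = 0" by simp
    then have "(\<Sum>i\<in>UNIV. A $ i $ j * to_frac (a i)) = 0"
      by (simp add: sum_distrib_left mult_ac flip: q(2))
    then have "to_frac (\<Sum>i\<in>UNIV. a i * C $ i $ j) = 0"
      by (simp add: A_def to_frac_simps mult.commute)
    then show ?thesis by simp
  qed
  ultimately show ?thesis using that by auto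
qed

text \<open>Cramer's rule without denominators: where the determinant is a nonzero constant it
  solves the linear system within polynomials.\<close>

lemma cramer_rows:
  fixes C :: "'a::idom ^ 'n::finite ^ 'n"
  assumes "det C \<noteq> 0"
  shows "(\<Sum>k\<in>UNIV. det (\<chi> i. if i = k then e else C $ i) * C $ k $ j) = det C * e $ j"
proof -
  define A where "A = (\<chi> i j. to_frac (C $ i $ j))"
  have detA: "det A = to_frac (det C)" by (simp add: A_def ringhom_det[OF ringhom_to_frac])
  then have "invertible (transpose A)" using assms by (simp add: invertible_det_nz)
  then obtain B where "transpose A ** B = mat 1" by (auto simp: invertible_def)
  then have B: "transpose A *v (B *v v) = v" for v by (simp add: matrix_vector_mul_assoc)
  define x where "x = B *v (\<chi> j. to_frac (e $ j))"
  have x: "(\<Sum>i\<in>UNIV. x $ i *s row i A) = (\<chi> j. to_frac (e $ j))"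
  proof -
    have "(\<Sum>i\<in>UNIV. x $ i *s row i A) = transpose A *v x"
      by (simp add: vec_eq_iff matrix_vector_mult_def transpose_def row_def mult.commute)
    then show ?thesis by (simp only: x_def B)
  qed
  have "to_frac (det (\<chi> i. if i = k then e else C $ i)) = x $ k * to_frac (det C)" for k
  proof -
    have "to_frac (det (\<chi> i. if i = k then e else C $ i))
        = det (\<chi> i. if i = k then (\<Sum>i\<in>UNIV. x $ i *s row i A) else row i A)"
      unfolding ringhom_det[OF ringhom_to_frac] x
      by (intro arg_cong[where f = det]) (simp add: vec_eq_iff A_def row_def)
    then show ?thesis unfolding cramer_lemma_transpose detA .
  qed
  then have "to_frac (\<Sum>k\<in>UNIV. det (\<chi> i. if i = k then e else C $ i) * C $ k $ j)
      = to_frac (det C) * (\<Sum>k\<in>UNIV. x $ k *s row k A) $ j"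
    by (simp add: to_frac_simps A_def row_def sum_distrib_left mult_ac)
  also have "\<dots> = to_frac (det C * e $ j)" by (simp add: x to_frac_simps)
  finally show ?thesis by (simp only: to_frac_inject)
qed

text \<open>The variables here stand for the invariants, with \<open>Var n0\<close> for y_N:
  \<open>B\<close> does not involve it, and \<open>G\<close> is at most linear in it.\<close>

locale pd_system =
  fixes G B :: "'n::{finite,linorder} \<Rightarrow> 'n \<Rightarrow> 'n mpoly" and n0 :: 'n
  assumes pd_B: "pd n0 (B i j) = 0"
    and pd_pd_G: "pd n0 (pd n0 (G i j)) = 0"
begin

definition L :: "('n \<Rightarrow> 'n mpoly) \<Rightarrow> 'n \<Rightarrow> 'n mpoly" where
  "L a j = (\<Sum>i\<in>UNIV. pd n0 (a i) * G i j + a i * B i j)"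

text \<open>The matrix by which \<open>L\<close> acts on the coefficient of the n-th power of
  \<open>Var n0\<close>, up to lower powers.\<close>

definition C :: "nat \<Rightarrow> (('n mpoly, 'n) vec, 'n) vec" where
  "C n = (\<chi> i j. of_nat n * pd n0 (G i j) + B i j)"

definition G0 :: "'n \<Rightarrow> 'n \<Rightarrow> 'n mpoly" where
  "G0 i j = G i j - Var n0 * pd n0 (G i j)"

text \<open>Vanishing of the n-th derivative says that the degree in \<open>Var n0\<close> is below
  n. Bounding the solution as well as the right-hand side is what later contradicts a kernel of
  \<open>C n\<close>.\<close>

definition solvable :: "nat \<Rightarrow> bool" where
  "solvable n \<longleftrightarrow> (\<forall>c :: 'n \<Rightarrow> 'n mpoly. (\<forall>j. (pd n0 ^^ n) (c j) = 0) \<longrightarrow>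
     (\<exists>a. (\<forall>i. (pd n0 ^^ n) (a i) = 0) \<and> L a = c))"

lemma pd_C: "pd n0 (C n $ i $ j) = 0"
  by (simp add: C_def pd_add pd_mult pd_B pd_pd_G)

lemma pd_G0: "pd n0 (G0 i j) = 0"
  by (simp add: G0_def pd_diff pd_mult pd_Var pd_pd_G)

lemma L_add: "L (\<lambda>i. a i + b i) j = L a j + L b j"
  by (simp add: L_def pd_add ring_distribs sum.distrib add_ac)

lemma L_diff: "L (\<lambda>i. a i - b i) j = L a j - L b j"
  by (simp add: L_def pd_diff ring_distribs sum.distrib sum_subtractf)

lemma L_leading:
  assumes "\<And>i. pd n0 (a i) = 0"
  shows "L (\<lambda>i. Var n0 ^ n * a i) j
    = Var n0 ^ n * (\<Sum>i\<in>UNIV. a i * C n $ i $ j)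
      + of_nat n * Var n0 ^ (n - 1) * (\<Sum>i\<in>UNIV. a i * G0 i j)"
proof -
  \<comment> \<open>For n = 0 both sides vanish, so the truncated exponent does no harm.\<close>
  have Y: "of_nat n * Var n0 ^ (n - 1) * Var n0 = of_nat n * (Var n0 ^ n :: 'n mpoly)"
    by (cases n) simp_all
  have "pd n0 (Var n0 ^ n * a i) * G i j + Var n0 ^ n * a i * B i j
      = Var n0 ^ n * (a i * C n $ i $ j) + of_nat n * Var n0 ^ (n - 1) * (a i * G0 i j)" for i
  proof -
    have "pd n0 (Var n0 ^ n * a i) * G i j = of_nat n * Var n0 ^ (n - 1) * a i * (G0 i j + Var n0 * pd n0 (G i j))"
      by (simp add: pd_mult pd_power_Var assms G0_def)
    also have "\<dots> = of_nat n * Var n0 ^ (n - 1) * (a i * G0 i j)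
        + (of_nat n * Var n0 ^ (n - 1) * Var n0) * (a i * pd n0 (G i j))"
      by (simp only: distrib_left mult_ac)
    finally show ?thesis unfolding Y by (simp add: C_def algebra_simps)
  qed
  then show ?thesis by (simp add: L_def sum.distrib sum_distrib_left)
qed

lemma pd_iter_leading_rest:
  assumes "pd n0 k = 0"
  shows "(pd n0 ^^ n) (of_nat n * Var n0 ^ (n - 1) * k) = 0"
proof (cases n)
  case (Suc m)
  have "(pd n0 ^^ n) (of_nat n * Var n0 ^ (n - 1) * k) = (pd n0 ^^ n) (Var n0 ^ (n - 1) * (of_nat n * k))"
    by (simp only: mult_ac)
  also have "\<dots> = (pd n0 ^^ n) (Var n0 ^ (n - 1)) * (of_nat n * k)"
    by (rule pd_iter_mult) (simp add: pd_mult assms)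
  finally show ?thesis using Suc by (simp add: pd_iter_power_Var_less del: funpow.simps)
qed simp

lemma pd_sum_mult: "(\<And>i. pd n0 (a i) = 0) \<Longrightarrow> (\<And>i. pd n0 (b i) = 0) \<Longrightarrow> pd n0 (\<Sum>i\<in>UNIV. a i * b i) = 0"
  by (simp add: pd_sum pd_mult)

text \<open>A kernel vector b free of \<open>Var n0\<close> makes \<open>L\<close> of y^n b drop
  below degree n, where it is also attained by some e of degree below n; then y^n b - e is a nonzero
  solution of the homogeneous system.\<close>

lemma det_C_nonzero:
  assumes inj: "\<And>a. (\<And>j. L a j = 0) \<Longrightarrow> a = (\<lambda>_. 0)" and S: "solvable n"
  shows "det (C n) \<noteq> 0"
proof
  assume "det (C n) = 0"
  then obtain a where a: "\<exists>i. a i \<noteq> 0" "\<And>j. (\<Sum>i\<in>UNIV. a i * C n $ i $ j) = 0"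
    by (rule det_0_kernel) (rule that)
  have "\<forall>i. \<exists>N. (pd n0 ^^ N) (a i) = 0" by (intro allI pd_nilpotent)
  then obtain N where N: "\<And>i. (pd n0 ^^ N i) (a i) = 0" by metis
  have "(pd n0 ^^ (\<Sum>i\<in>UNIV. N i)) (a i) = 0" for i
    using N[of i] by (rule pd_iter_mono) (simp add: member_le_sum)
  then have ex: "\<exists>M. \<forall>i. (pd n0 ^^ M) (a i) = 0" by blast
  \<comment> \<open>\<open>C n\<close> is free of \<open>Var n0\<close>, so derivatives of a kernel
    vector stay in the kernel; the last nonzero one is free of \<open>Var n0\<close>.\<close>
  define M where "M = (LEAST M. \<forall>i. (pd n0 ^^ M) (a i) = 0)"
  have M: "\<forall>i. (pd n0 ^^ M) (a i) = 0" unfolding M_def using ex by (rule LeastI_ex)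
  then obtain M' where M': "M = Suc M'" using a(1) by (cases M) auto
  have "\<not> (\<forall>i. (pd n0 ^^ M') (a i) = 0)"
    using not_less_Least[of M' "\<lambda>M. \<forall>i. (pd n0 ^^ M) (a i) = 0"] M' by (simp add: M_def)
  then obtain i0 where i0: "(pd n0 ^^ M') (a i0) \<noteq> 0" by blast
  define b where "b i = (pd n0 ^^ M') (a i)" for i
  have pb: "pd n0 (b i) = 0" for i using M M' by (simp add: b_def)
  have bC: "(\<Sum>i\<in>UNIV. b i * C n $ i $ j) = 0" for j
  proof -
    have "(\<Sum>i\<in>UNIV. b i * C n $ i $ j) = (pd n0 ^^ M') (\<Sum>i\<in>UNIV. a i * C n $ i $ j)"
      by (simp add: b_def pd_iter_sum pd_iter_mult pd_C)
    then show ?thesis by (simp add: a(2))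
  qed
  have Lb: "L (\<lambda>i. Var n0 ^ n * b i) j = of_nat n * Var n0 ^ (n - 1) * (\<Sum>i\<in>UNIV. b i * G0 i j)" for j
    by (simp add: L_leading pb bC)
  then have "\<forall>j. (pd n0 ^^ n) (L (\<lambda>i. Var n0 ^ n * b i) j) = 0"
    by (simp only: pd_iter_leading_rest[OF pd_sum_mult[OF pb pd_G0]]) simp
  then obtain e where e: "\<And>i. (pd n0 ^^ n) (e i) = 0" "L e = L (\<lambda>i. Var n0 ^ n * b i)"
    using S unfolding solvable_def by blast
  have "(\<lambda>i. Var n0 ^ n * b i - e i) = (\<lambda>_. 0)"
    by (rule inj) (simp add: L_diff e(2))
  then have "Var n0 ^ n * b i0 = e i0" by (metis eq_iff_diff_eq_0)
  then have "(pd n0 ^^ n) (Var n0 ^ n) * b i0 = 0" using e(1)[of i0] by (simp add: pb flip: pd_iter_mult)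
  then show False using i0 by (simp add: pd_iter_power_Var b_def)
qed

text \<open>Cramer's rule matches the leading coefficient, as the determinant is a unit, and what
  remains has lower degree.\<close>

lemma solvable_Suc:
  assumes S: "solvable n" and det: "det (C n) = Const c" "c \<noteq> 0"
  shows "solvable (Suc n)"
  unfolding solvable_def
proof (intro allI impI)
  fix g :: "'n \<Rightarrow> 'n mpoly"
  assume g: "\<forall>j. (pd n0 ^^ Suc n) (g j) = 0"
  define x where "x k = det (\<chi> i. if i = k then (\<chi> j. (pd n0 ^^ n) (g j)) else C n $ i)" for k
  have px: "pd n0 (x k) = 0" for k
    unfolding x_def by (rule pd_det_eq_0) (use g pd_C in auto)
  \<comment> \<open>The n-th derivative of the n-th power contributes n!, and Cramer's rule
    contributes \<open>c\<close>.\<close>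
  define r where "r = 1 / (c * of_nat (fact n))"
  define a where "a i = Const r * x i" for i
  have pa: "pd n0 (a i) = 0" for i by (simp add: a_def pd_mult px)
  have "Const r * Const c * of_nat (fact n) = Const (r * c * of_nat (fact n))"
    by (simp only: Const_simps)
  also have "r * c * of_nat (fact n) = 1"
    using det(2) by (simp add: r_def)
  finally have rc: "Const r * Const c * of_nat (fact n) = 1"
    by (simp only: Const_simps)
  have aC: "of_nat (fact n) * (\<Sum>i\<in>UNIV. a i * C n $ i $ j) = (pd n0 ^^ n) (g j)" for j
  proof -
    have nz: "det (C n) \<noteq> 0" using det by simp
    have "(\<Sum>i\<in>UNIV. x i * C n $ i $ j) = Const c * (pd n0 ^^ n) (g j)"
      using cramer_rows[OF nz, of "\<chi> j. (pd n0 ^^ n) (g j)" j] by (simp add: x_def det(1))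
    then have "of_nat (fact n) * (\<Sum>i\<in>UNIV. a i * C n $ i $ j)
        = (Const r * Const c * of_nat (fact n)) * (pd n0 ^^ n) (g j)"
      by (simp add: a_def mult_ac flip: sum_distrib_left)
    then show ?thesis by (simp only: rc mult_1_left)
  qed
  define g' where "g' j = g j - L (\<lambda>i. Var n0 ^ n * a i) j" for j
  have "(pd n0 ^^ n) (g' j) = 0" for j
  proof -
    have "(pd n0 ^^ n) (Var n0 ^ n * (\<Sum>i\<in>UNIV. a i * C n $ i $ j)) = (pd n0 ^^ n) (g j)"
      by (subst pd_iter_mult[OF pd_sum_mult[OF pa pd_C]]) (simp add: pd_iter_power_Var aC del: of_nat_fact)
    then show ?thesis
      by (simp add: g'_def L_leading[OF pa] pd_iter_diff pd_iter_add
          pd_iter_leading_rest[OF pd_sum_mult[OF pa pd_G0]] del: One_nat_def)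
  qed
  then obtain b where b: "\<And>i. (pd n0 ^^ n) (b i) = 0" "L b = g'"
    using S unfolding solvable_def by blast
  have "L (\<lambda>i. Var n0 ^ n * a i + b i) = g"
    by (rule ext) (simp add: L_add b(2) g'_def)
  moreover have "(pd n0 ^^ Suc n) (Var n0 ^ n * a i + b i) = 0" for i
  proof -
    have "(pd n0 ^^ Suc n) (Var n0 ^ n * a i) = (pd n0 ^^ Suc n) (Var n0 ^ n) * a i"
      by (rule pd_iter_mult[OF pa])
    moreover have "(pd n0 ^^ Suc n) (b i) = 0" using b(1)[of i] by (rule pd_iter_mono) simp
    ultimately show ?thesis by (simp add: pd_iter_add pd_iter_power_Var_less del: funpow.simps)
  qed
  ultimately show "\<exists>a. (\<forall>i. (pd n0 ^^ Suc n) (a i) = 0) \<and> L a = g"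
    by (intro exI[of _ "\<lambda>i. Var n0 ^ n * a i + b i"] conjI allI)
qed

text \<open>The two preceding lemmas alternate: solvability below degree n makes
  \<open>det (C n)\<close> nonzero, hence a unit, hence gives solvability one degree higher.\<close>

lemma L_surjective:
  assumes inj: "\<And>a. (\<And>j. L a j = 0) \<Longrightarrow> a = (\<lambda>_. 0)"
    and det: "\<And>n. det (C n) \<noteq> 0 \<Longrightarrow> \<exists>c. det (C n) = Const c"
  shows "\<exists>a. L a = g" and "det (C 0) \<noteq> 0"
proof -
  have S0: "solvable 0" 
    unfolding solvable_def by (auto simp: L_def fun_eq_iff intro!: exI[of _ "\<lambda>_. 0"])
  show "det (C 0) \<noteq> 0" using inj S0 by (rule det_C_nonzero)
  have S: "solvable n" for n
  proof (induction n)
    case (Suc n)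
    have nz: "det (C n) \<noteq> 0" using inj Suc by (rule det_C_nonzero)
    then obtain c where "det (C n) = Const c" using det by blast
    then show ?case using solvable_Suc[OF Suc] nz by auto
  qed (rule S0)
  have "\<forall>j. \<exists>N. (pd n0 ^^ N) (g j) = 0" by (intro allI pd_nilpotent)
  then obtain N where N: "\<And>j. (pd n0 ^^ N j) (g j) = 0" by metis
  have "(pd n0 ^^ (\<Sum>j\<in>UNIV. N j)) (g j) = 0" for j
    using N[of j] by (rule pd_iter_mono) (simp add: member_le_sum)
  then show "\<exists>a. L a = g" using S unfolding solvable_def by blast
qed

end

section \<open>Injectivity of the primitive derivation on equivariant maps\<close>

context invariant_generators
begin

lemma equivariant_Var: "equivariant Var"
  by (simp add: equivariant_def)

text \<open>Every covector is an \<open>s\<close>-invariant one plus a multiple of the root, and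
  \<open>prim\<close> makes invariant polynomials anti-invariant; so only the root has to be
  checked.\<close>

lemma equivariant_prim_dvd:
  assumes p: "equivariant p" and s: "s \<in> reflections W"
    and dvd: "lin (root_form s) dvd prim (subst p (lin (root_form s)))"
  shows "lin (root_form s) dvd prim (subst p (linear_form a))"
proof -
  define c where "c = pairing a (coroot s) / 2"
  define a' where "a' = a - c *s cvec (root_form s)"
  have "pairing a' (coroot s) = pairing a (coroot s) - c * pairing (cvec (root_form s)) (coroot s)"
    by (simp add: a'_def left_diff_distrib sum_subtractf sum_distrib_left mult.assoc)
  also have "\<dots> = 0"
    unfolding pairing_cvec root_coroot(1)[OF reflectionD(1)[OF s]] by (simp add: c_def)
  finally have "act s (subst p (linear_form a')) = subst p (linear_form a')"
    by (simp add: equivariant_reflection[OF p s] Const_simps)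
  then have "lin (root_form s) dvd prim (subst p (linear_form a'))"
    by (rule prim_invariant_dvd[OF s])
  moreover have "linear_form a = linear_form a' + Const c * lin (root_form s)"
    by (simp add: a'_def linear_form_diff linear_form_scale)
  then have "prim (subst p (linear_form a))
      = prim (subst p (linear_form a')) + Const c * prim (subst p (lin (root_form s)))"
    by (simp add: subst_simps prim_add prim_Const_mult)
  ultimately show ?thesis using dvd by (simp add: dvd_add dvd_mult)
qed

lemma equivariant_root_dvd:
  "equivariant p \<Longrightarrow> s \<in> reflections W \<Longrightarrow> lin (root_form s) dvd subst p (lin (root_form s))"
  by (intro root_dvd_antiinvariant equivariant_root reflectionD)

text \<open>If \<open>prim\<close> had no poles at all it would be a derivation of negative degree.\<close>

lemma exists_pole: "\<exists>s\<in>reflections W. \<not> lin (root_form s) dvd prim (lin (root_form s))"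
proof (rule ccontr)
  assume "\<not> ?thesis"
  then have no: "lin (root_form s) dvd prim (lin (root_form s))" if "s \<in> reflections W" for s
    using that by blast
  have "prim (Var k) = 0" for k
  proof -
    have "J dvd prim (Var k)"
    proof (rule J_dvd)
      fix s assume "s \<in> reflections W"
      then show "lin (root_form s) dvd prim (Var k)"
        using equivariant_prim_dvd[OF equivariant_Var, of s "axis k 1"] no by (simp add: linear_form_axis)
    qed
    then obtain q where q: "prim (Var k) = J * q" by (auto simp: dvd_def)
    have "hom ((\<Sum>i\<in>UNIV. d i - 1) + (1 - d n0)) (J * q)"
      using hom_prim[OF hom_Var] q by metis
    then have "hom (1 - d n0) q" using hom_cancel[OF hom_J] J_nonzero by blast
    then have "q = 0" using hom_negative top_degree by fastforce
    then show ?thesis using q by simp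
  qed
  then have "prim (z n0) = 0" by (subst prim_eq) simp
  then show False using J_nonzero prim_z[of n0] by simp
qed

text \<open>In the Leibniz rule the term with \<open>prim\<close> of the root decides, its integer
  factor being a nonzero constant. The order drops by exactly one here, and once more on division by
  \<open>J\<close>.\<close>

lemma prim_exact_order:
  assumes s: "s \<in> reflections W" and pole: "\<not> lin (root_form s) dvd prim (lin (root_form s))"
    and f: "f = lin (root_form s) ^ Suc m * g" "\<not> lin (root_form s) dvd g"
  obtains h where "prim f = lin (root_form s) ^ m * h" "\<not> lin (root_form s) dvd h"
proof
  let ?l = "lin (root_form s)"
  let ?h = "of_nat (Suc m) * (prim ?l * g) + ?l * prim g"
  show "prim f = ?l ^ m * ?h"
    unfolding f(1) prim_mult prim_power by (simp add: algebra_simps)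
  show "\<not> ?l dvd ?h"
  proof
    assume "?l dvd ?h"
    then have "?l dvd of_nat (Suc m) * (prim ?l * g)"
      by (simp only: dvd_add_left_iff[OF dvd_triv_left])
    also have "of_nat (Suc m) = Const (of_nat (Suc m))" by (simp only: Const_simps)
    finally show False
      using prime_elem_not_dvd_Const[OF prime_root[OF s], of "of_nat (Suc m)"] pole f(2)
      by (simp add: prime_elem_dvd_mult_iff[OF prime_root[OF s]] del: of_nat_Suc)
  qed
qed

text \<open>The value at a root with a pole has positive order by anti-invariance; were it nonzero,
  its derivative would have an exact finite order.\<close>

lemma equivariant_prim_inj:
  assumes p: "equivariant p" and zero: "\<And>k. prim (p k) = 0"
  shows "p k = 0"
proof -
  obtain s where s: "s \<in> reflections W" "\<not> lin (root_form s) dvd prim (lin (root_form s))"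
    using exists_pole by blast
  let ?l = "lin (root_form s)" and ?f = "subst p (lin (root_form s))"
  have l0: "cvec (root_form s) \<noteq> 0" using root_nonzero[OF reflectionD(1)[OF s(1)]] by simp
  have "?f = 0"
  proof (rule ccontr)
    assume "?f \<noteq> 0"
    then obtain m g where f: "?f = ?l ^ m * g" "\<not> ?l dvd g"
      using linear_form_multiplicity[OF l0] by blast
    have "m \<noteq> 0" using equivariant_root_dvd[OF p s(1)] f by (intro notI) simp
    then obtain m' where "m = Suc m'" by (cases m) auto
    then obtain h where h: "prim ?f = ?l ^ m' * h" "\<not> ?l dvd h"
      using prim_exact_order[OF s _ f(2), of ?f m'] f(1) by blast
    have "prim ?f = 0" by (simp add: subst_linear_form prim_sum prim_Const_mult zero)
    then have "h = 0" using h(1) l0 by simp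
    then show False using h(2) by simp
  qed
  then show ?thesis by (rule equivariant_kernel[OF p l0])
qed

section \<open>The system of the invariant vector fields\<close>

text \<open>An equivariant map is an invariant vector field, with components \<open>p k\<close>;
  this is the derivative of \<open>z j\<close> along it.\<close>

definition contract :: "('n \<Rightarrow> 'n mpoly) \<Rightarrow> 'n \<Rightarrow> 'n mpoly" where
  "contract p j = (\<Sum>k\<in>UNIV. p k * pd k (z j))"

lemma pd_z: "w \<in> W \<Longrightarrow> pd l (z j) = (\<Sum>k\<in>UNIV. act w (pd k (z j)) * Const (complex_of_real (matrix_inv w $ k $ l)))"
  using pd_act[of l w "z j"] by (simp add: act_z)

lemma equivariant_components:
  assumes "equivariant p" "w \<in> W"
  shows "act w (p k) = (\<Sum>l\<in>UNIV. Const (complex_of_real (matrix_inv w $ k $ l)) * p l)"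
  using equivariant_act[OF assms, of "Var k"] by (simp add: act_Var subst_simps)

lemma contract_linear:
  assumes T: "\<And>k. (\<Sum>l\<in>UNIV. Const (complex_of_real (matrix_inv w $ k $ l)) * q l) = r k" and w: "w \<in> W"
  shows "contract q j = (\<Sum>k\<in>UNIV. r k * act w (pd k (z j)))"
proof -
  have "contract q j = (\<Sum>l\<in>UNIV. \<Sum>k\<in>UNIV. q l * (act w (pd k (z j)) * Const (complex_of_real (matrix_inv w $ k $ l))))"
    unfolding contract_def by (subst pd_z[OF w]) (simp add: sum_distrib_left)
  also have "\<dots> = (\<Sum>k\<in>UNIV. (\<Sum>l\<in>UNIV. Const (complex_of_real (matrix_inv w $ k $ l)) * q l) * act w (pd k (z j)))"
    by (subst sum.swap) (simp add: sum_distrib_left sum_distrib_right mult_ac)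
  finally show ?thesis by (simp only: T)
qed

lemma contract_invariant:
  assumes "equivariant p" "w \<in> W"
  shows "act w (contract p j) = contract p j"
proof -
  have "contract p j = (\<Sum>k\<in>UNIV. act w (p k) * act w (pd k (z j)))"
    by (rule contract_linear[OF equivariant_components[OF assms, symmetric] assms(2)])
  also have "\<dots> = act w (contract p j)" by (simp add: contract_def act_simps)
  finally show ?thesis by (rule sym)
qed

lemma contract_prim_semiinvariant:
  assumes "equivariant p" "w \<in> W"
  shows "contract (\<lambda>k. prim (p k)) j
    = Const (complex_of_real (det (matrix_inv w))) * act w (contract (\<lambda>k. prim (p k)) j)"
proof -
  have "(\<Sum>l\<in>UNIV. Const (complex_of_real (matrix_inv w $ k $ l)) * prim (p l)) = prim (act w (p k))" for k
    by (simp add: equivariant_components[OF assms] prim_sum prim_Const_mult)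
  then have "contract (\<lambda>k. prim (p k)) j = (\<Sum>k\<in>UNIV. prim (act w (p k)) * act w (pd k (z j)))"
    by (rule contract_linear[OF _ assms(2)])
  also have "\<dots> = Const (complex_of_real (det (matrix_inv w))) * act w (contract (\<lambda>k. prim (p k)) j)"
    by (simp add: prim_act[OF assms(2)] contract_def act_simps sum_distrib_left mult.assoc)
  finally show ?thesis .
qed

lemma cramer_J_transpose:
  assumes "\<And>k. (\<Sum>j\<in>UNIV. v j * pd k (z j)) = 0"
  shows "v j = 0"
proof -
  define A :: "(('n mpoly fract, 'n) vec, 'n) vec" where "A = (\<chi> k j. to_frac (pd k (z j)))"
  define x where "x = (\<chi> k. to_frac (v k))"
  have "A *v x = 0"
    using assms by (simp add: vec_eq_iff A_def x_def matrix_vector_mult_def mult.commute flip: to_frac_simps)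
  moreover have "A = transpose (\<chi> j k. to_frac (pd k (z j)))"
    by (simp add: A_def transpose_def)
  then have "det A = to_frac J"
    by (simp add: J_def Jac_def ringhom_det[OF ringhom_to_frac])
  then have "invertible A" using J_nonzero by (simp add: invertible_det_nz)
  ultimately have "x = 0"
    by (metis invertible_def matrix_vector_mul_assoc matrix_vector_mul_lid matrix_vector_mult_0_right)
  then show ?thesis by (simp add: x_def vec_eq_iff)
qed

text \<open>The gradient of \<open>z i\<close> with respect to the invariant form
  \<open>beta\<close>. The gradients are invariant fields, and independent because \<open>J\<close>
  is nonzero.\<close>

definition gr :: "'n \<Rightarrow> 'n \<Rightarrow> 'n mpoly" where
  "gr i k = (\<Sum>l\<in>UNIV. Const (complex_of_real (matrix_inv gram $ k $ l)) * pd l (z i))"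

lemma gram_inv_equivariant:
  assumes "w \<in> W"
  shows "matrix_inv w ** matrix_inv gram ** transpose (matrix_inv w) = matrix_inv gram"
proof -
  let ?g = "matrix_inv gram" and ?w = "matrix_inv w"
  have "gram *v (w *v v) = transpose ?w *v (gram *v v)" for v
    by (simp add: gram_equivariant assms)
  then have "gram ** w = transpose ?w ** gram"
    by (simp add: matrix_eq matrix_vector_mul_assoc)
  then have "?g ** (gram ** w) ** ?g = ?g ** (transpose ?w ** gram) ** ?g" by simp
  then have "(?g ** gram) ** w ** ?g = ?g ** transpose ?w ** (gram ** ?g)"
    by (simp add: matrix_mul_assoc)
  then have "w ** ?g = ?g ** transpose ?w"
    by (simp add: matrix_inv_left matrix_inv_right invertible_gram)
  then have "?w ** ?g ** transpose ?w = ?w ** (w ** ?g)" by (simp add: matrix_mul_assoc)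
  also have "\<dots> = (?w ** w) ** ?g" by (simp add: matrix_mul_assoc)
  finally show ?thesis by (simp add: matrix_inv_left invertible_W assms)
qed

lemma equivariant_gr: "equivariant (gr i)"
  unfolding equivariant_def
proof (intro ballI allI)
  fix w k assume w: "w \<in> W"
  let ?g = "matrix_inv gram" and ?w = "matrix_inv w"
  let ?c = "\<lambda>x. Const (complex_of_real x) :: 'n mpoly"
  have c: "ringhom ?c" by (auto simp: ringhom_def Const_simps)
  have "subst (gr i) (act w (Var k)) = (\<Sum>l\<in>UNIV. ?c (?w $ k $ l) * gr i l)"
    by (simp add: act_Var subst_simps)
  also have "\<dots> = (\<Sum>l\<in>UNIV. \<Sum>m\<in>UNIV. \<Sum>j\<in>UNIV.
      ?c (?w $ k $ l) * ?c (?g $ l $ m) * ?c (?w $ j $ m) * act w (pd j (z i)))"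
    unfolding gr_def by (subst pd_z[OF w]) (simp add: sum_distrib_left mult_ac)
  also have "\<dots> = (\<Sum>j\<in>UNIV. ?c ((?w ** ?g ** transpose ?w) $ k $ j) * act w (pd j (z i)))"
  proof -
    have "(?w ** ?g ** transpose ?w) $ k $ j = (\<Sum>l\<in>UNIV. \<Sum>m\<in>UNIV. ?w $ k $ l * ?g $ l $ m * ?w $ j $ m)" for j
      by (subst sum.swap) (simp add: matrix_matrix_mult_def transpose_def sum_distrib_right)
    then have "(\<Sum>j\<in>UNIV. ?c ((?w ** ?g ** transpose ?w) $ k $ j) * act w (pd j (z i)))
        = (\<Sum>j\<in>UNIV. \<Sum>l\<in>UNIV. \<Sum>m\<in>UNIV. ?c (?w $ k $ l) * ?c (?g $ l $ m) * ?c (?w $ j $ m) * act w (pd j (z i)))"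
      by (simp only: ringhom_simps[OF c] sum_distrib_right)
    also have "\<dots> = (\<Sum>l\<in>UNIV. \<Sum>j\<in>UNIV. \<Sum>m\<in>UNIV. ?c (?w $ k $ l) * ?c (?g $ l $ m) * ?c (?w $ j $ m) * act w (pd j (z i)))"
      by (rule sum.swap)
    also have "\<dots> = (\<Sum>l\<in>UNIV. \<Sum>m\<in>UNIV. \<Sum>j\<in>UNIV. ?c (?w $ k $ l) * ?c (?g $ l $ m) * ?c (?w $ j $ m) * act w (pd j (z i)))"
      by (intro sum.cong refl sum.swap)
    finally show ?thesis by simp
  qed
  also have "\<dots> = act w (gr i k)"
    unfolding gram_inv_equivariant[OF w] gr_def by (simp add: act_simps)
  finally show "act w (gr i k) = subst (gr i) (act w (Var k))" by simp
qed

lemma gram_gr: "(\<Sum>k\<in>UNIV. Const (complex_of_real (gram $ l $ k)) * gr i k) = pd l (z i)"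
proof -
  let ?c = "\<lambda>x. Const (complex_of_real x) :: 'n mpoly"
  have c: "ringhom ?c" by (auto simp: ringhom_def Const_simps)
  have "(\<Sum>k\<in>UNIV. ?c (gram $ l $ k) * gr i k)
      = (\<Sum>m\<in>UNIV. ?c (\<Sum>k\<in>UNIV. gram $ l $ k * matrix_inv gram $ k $ m) * pd m (z i))"
    unfolding gr_def sum_distrib_left
    by (subst sum.swap) (simp only: ringhom_sum[OF c] ringhom_mult[OF c] sum_distrib_right mult.assoc)
  also have "\<dots> = (\<Sum>m\<in>UNIV. if m = l then pd l (z i) else 0)"
    using matrix_inv_right[OF invertible_gram]
    by (intro sum.cong) (auto simp: vec_eq_iff matrix_matrix_mult_def mat_def ringhom_simps[OF c])
  finally show ?thesis by simp
qed

lemma gr_independent: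
  assumes "\<And>k. (\<Sum>i\<in>UNIV. v i * gr i k) = 0"
  shows "v i = 0"
proof (rule cramer_J_transpose)
  fix l
  have "(\<Sum>i\<in>UNIV. v i * pd l (z i)) = (\<Sum>i\<in>UNIV. \<Sum>k\<in>UNIV. Const (complex_of_real (gram $ l $ k)) * (v i * gr i k))"
    by (simp add: sum_distrib_left mult_ac flip: gram_gr[of l])
  also have "\<dots> = (\<Sum>k\<in>UNIV. Const (complex_of_real (gram $ l $ k)) * (\<Sum>i\<in>UNIV. v i * gr i k))"
    by (subst sum.swap) (simp add: sum_distrib_left)
  finally show "(\<Sum>i\<in>UNIV. v i * pd l (z i)) = 0" by (simp add: assms)
qed

lemma hom_gr: "hom (d i - 1) (gr i k)"
  unfolding gr_def by (intro hom_sum hom_Const_mult hom_pd hom_z)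

definition Gm :: "'n \<Rightarrow> 'n \<Rightarrow> 'n mpoly" where
  "Gm i j = (SOME P. contract (gr i) j = subst z P)"

text \<open>One of the two Leibniz terms in the derivative of \<open>Gm i j\<close> along y_N, the
  one in which the gradient is differentiated. The factor \<open>J\<close> is the denominator that
  \<open>prim\<close> has cleared.\<close>

definition Bm :: "'n \<Rightarrow> 'n \<Rightarrow> 'n mpoly" where
  "Bm i j = (SOME P. contract (\<lambda>k. prim (gr i k)) j = J * subst z P)"

lemma Gm: "contract (gr i) j = subst z (Gm i j)"
proof -
  have "\<exists>P. contract (gr i) j = subst z P"
    using invariantE contract_invariant[OF equivariant_gr] by metis
  then show ?thesis unfolding Gm_def by (rule someI_ex)
qed

lemma Bm: "contract (\<lambda>k. prim (gr i k)) j = J * subst z (Bm i j)"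
proof -
  have "\<exists>P. contract (\<lambda>k. prim (gr i k)) j = J * subst z P"
    using invariant_of_det_semiinvariant[OF contract_prim_semiinvariant[OF equivariant_gr]] by metis
  then show ?thesis unfolding Bm_def by (rule someI_ex)
qed

lemma hom_pd_coordinate:
  assumes "hom e (subst z P)"
  shows "hom (e - d n0) (subst z (pd n0 P))"
proof (rule hom_cancel[OF hom_J _ J_nonzero])
  show "hom ((\<Sum>i\<in>UNIV. d i - 1) + (e - d n0)) (J * subst z (pd n0 P))"
    using hom_prim[OF assms] by (simp add: prim_subst_z)
qed

lemma hom_Gm: "hom ((d i - 1) + (d j - 1)) (subst z (Gm i j))"
  unfolding Gm[symmetric] contract_def by (intro hom_sum hom_mult hom_gr hom_pd hom_z)

lemma hom_Bm: "hom ((d i - 1 - d n0) + (d j - 1)) (subst z (Bm i j))"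
proof (rule hom_cancel[OF hom_J _ J_nonzero])
  have "hom (((\<Sum>i\<in>UNIV. d i - 1) + (d i - 1 - d n0)) + (d j - 1)) (contract (\<lambda>k. prim (gr i k)) j)"
    unfolding contract_def by (intro hom_sum hom_mult hom_prim hom_gr hom_pd hom_z)
  then show "hom ((\<Sum>i\<in>UNIV. d i - 1) + ((d i - 1 - d n0) + (d j - 1))) (J * subst z (Bm i j))"
    by (simp only: Bm add.assoc)
qed

sublocale pd_system Gm Bm n0
proof
  \<comment> \<open>Each derivative along y_N costs h. The second one, of which \<open>Bm\<close>
    already contains the first, leads to a negative degree because both \<open>d i\<close> and
    \<open>d j\<close> are at most h.\<close>
  have neg: "d i + d j - 2 - 2 * d n0 < 0" for i j using d_le[of i] d_le[of j] by simp
  show "pd n0 (Bm i j) = 0" for i j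
    using hom_negative[OF hom_pd_coordinate[OF hom_Bm[of i j]]] neg[of i j] subst_z_inj by simp
  show "pd n0 (pd n0 (Gm i j)) = 0" for i j
    using hom_negative[OF hom_pd_coordinate[OF hom_pd_coordinate[OF hom_Gm[of i j]]]] neg[of i j] subst_z_inj
    by simp
qed

definition field_of :: "('n \<Rightarrow> 'n mpoly) \<Rightarrow> 'n \<Rightarrow> 'n mpoly" where
  "field_of a k = (\<Sum>i\<in>UNIV. subst z (a i) * gr i k)"

lemma equivariant_field_of: "equivariant (field_of a)"
  unfolding equivariant_def
proof (intro ballI allI)
  fix w k assume w: "w \<in> W"
  have "act w (field_of a k) = (\<Sum>i\<in>UNIV. subst z (a i) * (\<Sum>l\<in>UNIV. Const (complex_of_real (matrix_inv w $ k $ l)) * gr i l))"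
    by (simp add: field_of_def act_simps act_subst_z w equivariant_components[OF equivariant_gr w])
  also have "\<dots> = (\<Sum>l\<in>UNIV. Const (complex_of_real (matrix_inv w $ k $ l)) * field_of a l)"
    unfolding field_of_def sum_distrib_left by (subst sum.swap) (simp add: mult_ac)
  also have "\<dots> = subst (field_of a) (act w (Var k))" by (simp add: act_Var subst_simps)
  finally show "act w (field_of a k) = subst (field_of a) (act w (Var k))" .
qed

text \<open>This translates differentiation of invariant vector fields into the operator
  \<open>L\<close> on their coefficients.\<close>

lemma contract_field_of: "contract (\<lambda>k. prim (field_of a k)) j = J * subst z (L a j)"
proof -
  have "contract (\<lambda>k. prim (field_of a k)) j
      = (\<Sum>k\<in>UNIV. \<Sum>i\<in>UNIV. J * subst z (pd n0 (a i)) * (gr i k * pd k (z j)) + subst z (a i) * (prim (gr i k) * pd k (z j)))"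
    by (simp add: contract_def field_of_def prim_sum prim_mult prim_subst_z sum_distrib_right sum_distrib_left ring_distribs mult_ac)
  also have "\<dots> = (\<Sum>i\<in>UNIV. J * subst z (pd n0 (a i)) * contract (gr i) j + subst z (a i) * contract (\<lambda>k. prim (gr i k)) j)"
    by (subst sum.swap) (simp add: contract_def sum_distrib_left sum.distrib)
  also have "\<dots> = J * subst z (L a j)"
    by (simp add: Gm Bm L_def subst_simps sum_distrib_left algebra_simps)
  finally show ?thesis .
qed

lemma L_injective:
  assumes "\<And>j. L a j = 0"
  shows "a = (\<lambda>_. 0)"
proof -
  have "prim (field_of a k) = 0" for k
    by (rule cramer_J) (use contract_field_of[of a] assms in \<open>simp add: contract_def subst_simps\<close>)
  then have "field_of a k = 0" for k by (rule equivariant_prim_inj[OF equivariant_field_of])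
  then have "subst z (a i) = 0" for i
    using gr_independent[of "\<lambda>i. subst z (a i)"] by (simp add: field_of_def)
  then show ?thesis using subst_z_inj by blast
qed

lemma det_C_constant:
  assumes "det (C n) \<noteq> 0"
  shows "\<exists>c. det (C n) = Const c"
proof -
  have "hom ((d i - 1 - d n0) + (d j - 1)) (subst z (C n $ i $ j))" for i j
  proof -
    have "hom ((d i - 1) + (d j - 1) - d n0) (Const (of_nat n) * subst z (pd n0 (Gm i j)))"
      by (intro hom_Const_mult hom_pd_coordinate hom_Gm)
    then have "hom ((d i - 1 - d n0) + (d j - 1)) (Const (of_nat n) * subst z (pd n0 (Gm i j)))"
      by (simp add: algebra_simps)
    then show ?thesis
      unfolding C_def using hom_Bm[of i j] by (simp add: subst_simps Const_simps hom_add)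
  qed
  then have h: "hom ((\<Sum>i\<in>UNIV. d i - 1 - d n0) + (\<Sum>j\<in>UNIV. d j - 1)) (subst z (det (C n)))"
    unfolding ringhom_det[OF ringhom_subst] by (intro hom_det) simp
  \<comment> \<open>The left-hand side is twice the degree of \<open>J\<close> minus N h, hence at
    most twice the number of reflections minus N h.\<close>
  have "(\<Sum>i\<in>UNIV. d i - 1 - d n0) + (\<Sum>j\<in>UNIV. d j - 1) \<le> 0"
    using degree_J_le reflections_le_top_degree by (simp add: sum_subtractf)
  moreover have nz: "subst z (det (C n)) \<noteq> 0" using assms subst_z_inj by blast
  ultimately have "(\<Sum>i\<in>UNIV. d i - 1 - d n0) + (\<Sum>j\<in>UNIV. d j - 1) = 0"
    using hom_negative[OF h] by linarith
  then obtain c where "subst z (det (C n)) = Const c" using h hom_degree_0 by metis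
  then have "subst z (det (C n)) = subst z (Const c)" by simp
  then show ?thesis unfolding subst_z_inject by blast
qed

lemma det_Bm: "\<exists>c. c \<noteq> 0 \<and> det (\<chi> i j. Bm i j) = Const c"
proof -
  have "det (C 0) \<noteq> 0" using L_injective det_C_constant by (rule L_surjective(2))
  moreover have "C 0 = (\<chi> i j. Bm i j)" by (simp add: C_def)
  ultimately show ?thesis using det_C_constant[of 0] by auto
qed

text \<open>Otherwise \<open>\<alpha>\<^sup>N\<close> would divide \<open>J\<^sup>N\<^sup>-\<^sup>1 det B\<close>, where \<open>det B\<close> is a nonzero constant.\<close>

lemma pole:
  assumes s: "s \<in> reflections W"
  shows "\<not> lin (root_form s) dvd prim (lin (root_form s))"
proof
  let ?l = "lin (root_form s)"
  assume dvd: "?l dvd prim ?l"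
  have "?l dvd prim (gr i k)" for i k
  proof -
    obtain g where g: "subst (gr i) ?l = ?l * g"
      using equivariant_root_dvd[OF equivariant_gr s] by (auto simp: dvd_def)
    have "?l dvd prim (subst (gr i) ?l)"
      unfolding g prim_mult using dvd by (simp add: dvd_add dvd_mult2)
    then show ?thesis
      using equivariant_prim_dvd[OF equivariant_gr s, of i "axis k 1"] by (simp add: linear_form_axis)
  qed
  then have "\<exists>e. prim (gr i k) = ?l * e" for i k by (auto simp: dvd_def)
  then obtain e where e: "\<And>i k. prim (gr i k) = ?l * e i k" by metis
  obtain c where c: "c \<noteq> 0" "det (\<chi> i j. Bm i j) = Const c" using det_Bm by blast
  obtain J1 where J1: "J = ?l * J1" "\<not> ?l dvd J1" using J_order_one[OF s] by blast
  have l0: "?l \<noteq> 0" using prime_root[OF s] by auto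
  \<comment> \<open>One factor of the root cancels against the single one in
    \<open>J\<close>.\<close>
  have "J1 * subst z (Bm i j) = (\<Sum>k\<in>UNIV. e i k * pd k (z j))" for i j
  proof -
    have "?l * (J1 * subst z (Bm i j)) = ?l * (\<Sum>k\<in>UNIV. e i k * pd k (z j))"
      using Bm[of i j] by (simp add: contract_def e J1(1) sum_distrib_left mult.assoc)
    then show ?thesis by (rule mult_left_cancel[OF l0, THEN iffD1])
  qed
  then have "(\<chi> i. J1 *s (\<chi> j. subst z (Bm i j))) = (\<chi> i k. e i k) ** transpose (\<chi> j k. pd k (z j))"
    by (simp add: vec_eq_iff matrix_matrix_mult_def transpose_def)
  then have "det (\<chi> i. J1 *s (\<chi> j. subst z (Bm i j))) = det (\<chi> i k. e i k) * J"
    by (simp only: det_mul det_transpose J_def Jac_def)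
  then have "J1 ^ CARD('n) * subst z (det (\<chi> i j. Bm i j)) = det (\<chi> i k. e i k) * J"
    by (simp add: det_rows_mul ringhom_det[OF ringhom_subst])
  \<comment> \<open>On the right of the determinant identity \<open>J\<close> still contains the
    root, whereas the left is a power of \<open>J1\<close> times a nonzero constant.\<close>
  then have "?l dvd J1 ^ CARD('n) * Const c"
    by (simp add: c(2) J1(1))
  then show False
    using prime_elem_dvd_multD[OF prime_root[OF s]] prime_elem_dvd_power[OF prime_root[OF s]]
      prime_elem_not_dvd_Const[OF prime_root[OF s] c(1)] J1(2) by blast
qed

text \<open>Combinations of gradients already realise every system of invariant contractions, and a
  field is determined by its contractions since \<open>J\<close> is nonzero.\<close>

lemma prim_surjective:
  assumes "equivariant p"
  obtains q where "equivariant q" "\<And>k. prim (q k) = J * p k"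
proof -
  have "\<exists>P. contract p j = subst z P" for j
    using invariantE contract_invariant[OF assms] by metis
  then obtain c where c: "\<And>j. contract p j = subst z (c j)" by metis
  obtain a where a: "L a = c" using L_surjective(1)[OF L_injective det_C_constant] by metis
  have "prim (field_of a k) - J * p k = 0" for k
  proof (rule cramer_J)
    fix j
    have "(\<Sum>k\<in>UNIV. (prim (field_of a k) - J * p k) * pd k (z j))
        = contract (\<lambda>k. prim (field_of a k)) j - J * contract p j"
      by (simp add: contract_def left_diff_distrib sum_subtractf sum_distrib_left mult.assoc)
    then show "(\<Sum>k\<in>UNIV. (prim (field_of a k) - J * p k) * pd k (z j)) = 0"
      by (simp add: contract_field_of a c)
  qed
  then have "prim (field_of a k) = J * p k" for k by simp
  then show ?thesis by (rule that[OF equivariant_field_of])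
qed

end

section \<open>The isotypic component\<close>

lemma prime_elem_power_dvd_multD:
  fixes p :: "'a::idom"
  assumes "prime_elem p" "p ^ n dvd a * b" "\<not> p dvd a"
  shows "p ^ n dvd b"
  using assms(2)
proof (induction n)
  case (Suc n)
  then have "p ^ n dvd a * b" by (meson dvd_trans le_imp_power_dvd le_SucI order_refl)
  then obtain c where c: "b = p ^ n * c" using Suc.IH by (auto simp: dvd_def)
  have nz: "p \<noteq> 0" using assms(1) by (simp add: prime_elem_def)
  have "p ^ n * p dvd p ^ n * (a * c)" using Suc.prems c by (simp add: mult_ac)
  then have "p dvd a * c" using nz by simp
  then have "p dvd c" using prime_elem_dvd_multD[OF assms(1)] assms(3) by blast
  then show ?case using c by (auto simp: dvd_def mult_ac)
qed simp

lemma linear_form_sum: "linear_form (sum f I) = (\<Sum>i\<in>I. linear_form (f i))"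
  by (induction I rule: infinite_finite_induct) (simp_all add: linear_form_add)

lemma act_linear_form_ex: "\<exists>b. act w (linear_form a) = linear_form b"
  unfolding act_linear_form by blast

lemma subst_add_linear_form:
  "subst (\<lambda>k. p k + q k) (linear_form a) = subst p (linear_form a) + subst q (linear_form a)"
  by (simp add: subst_linear_form distrib_left sum.distrib)

lemma subst_scale_linear_form:
  "subst (\<lambda>k. Const c * p k) (linear_form a) = Const c * subst p (linear_form a)"
  by (simp add: subst_linear_form sum_distrib_left mult_ac)

context reflection_group
begin

text \<open>A form vanishing exactly on the mirror is a nonzero multiple of the chosen root, so that
  root can represent them all.\<close>

lemma quasi_invariants_iff:
  "f \<in> quasi_invariants W m \<longleftrightarrow>
    (\<forall>s\<in>reflections W. lin (root_form s) ^ (2 * m (mirror s)) dvd f - act s f)"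
proof
  assume f: "f \<in> quasi_invariants W m"
  show "\<forall>s\<in>reflections W. lin (root_form s) ^ (2 * m (mirror s)) dvd f - act s f"
  proof
    fix s assume s: "s \<in> reflections W"
    then have "mirror s \<in> arrangement W" by (simp add: arrangement_def)
    then show "lin (root_form s) ^ (2 * m (mirror s)) dvd f - act s f"
      using f s mirror_eq[OF reflectionD(1)[OF s]] unfolding quasi_invariants_def by simp
  qed
next
  assume f: "\<forall>s\<in>reflections W. lin (root_form s) ^ (2 * m (mirror s)) dvd f - act s f"
  have "linear_form a ^ (2 * m (mirror s)) dvd f - act s f"
    if s: "s \<in> reflections W" and a: "linear_form_kernel a = mirror s" for s a
  proof -
    note rs = root_coroot[OF reflectionD(1)[OF s]]
    have "linear_form_kernel a = linear_form_kernel (cvec (root_form s))"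
      using a mirror_eq[OF reflectionD(1)[OF s]] by simp
    moreover have "(\<Sum>i\<in>UNIV. cvec (root_form s) $ i * cvec (coroot s) $ i) = 2"
      using pairing_cvec[of "root_form s" "coroot s"] rs(1) by simp
    ultimately obtain c where c: "c \<noteq> 0" "a = c *s cvec (root_form s)"
      using linear_form_kernel_eq by blast
    have "linear_form a dvd lin (root_form s)"
      by (rule dvdI[of _ _ "Const (1 / c)"])
        (use c in \<open>simp add: linear_form_scale mult.left_commute[of _ "Const c"] flip: mult.assoc Const_simps\<close>)
    then have "linear_form a ^ (2 * m (mirror s)) dvd lin (root_form s) ^ (2 * m (mirror s))"
      by (rule dvd_power_same)
    then show ?thesis using f s dvd_trans by blast
  qed
  then show "f \<in> quasi_invariants W m" by (auto simp: quasi_invariants_def)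
qed

text \<open>The equivariant maps with quasi-invariant values, since p(a) - s p(a) is a multiple of
  the value at the root. That value is anti-invariant, so its order is odd and exponent 2m amounts
  to 2m + 1.\<close>

definition quasi_equivariant :: "((complex, 'n) vec set \<Rightarrow> nat) \<Rightarrow> ('n \<Rightarrow> 'n mpoly) \<Rightarrow> bool" where
  "quasi_equivariant m p \<longleftrightarrow> equivariant p \<and>
     (\<forall>s\<in>reflections W. lin (root_form s) ^ (2 * m (mirror s)) dvd subst p (lin (root_form s)))"

lemma equivariant_diff:
  assumes "equivariant p" "s \<in> reflections W"
  shows "subst p (linear_form a) - act s (subst p (linear_form a))
    = Const (pairing a (coroot s)) * subst p (lin (root_form s))"
  by (simp add: equivariant_reflection[OF assms])

lemma quasi_equivariant_in:
  "quasi_equivariant m p \<Longrightarrow> subst p (linear_form a) \<in> quasi_invariants W m"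
  unfolding quasi_invariants_iff quasi_equivariant_def by (auto simp: equivariant_diff)

lemma quasi_equivariantI:
  assumes p: "equivariant p" and q: "\<And>a. subst p (linear_form a) \<in> quasi_invariants W m"
  shows "quasi_equivariant m p"
  unfolding quasi_equivariant_def
proof (intro conjI ballI p)
  fix s assume s: "s \<in> reflections W"
  let ?l = "lin (root_form s)"
  have "?l ^ (2 * m (mirror s)) dvd subst p ?l - act s (subst p ?l)"
    using q s unfolding quasi_invariants_iff by blast
  also have "subst p ?l - act s (subst p ?l) = Const 2 * subst p ?l"
    unfolding equivariant_diff[OF p s] pairing_cvec root_coroot(1)[OF reflectionD(1)[OF s]] by simp
  finally have "?l ^ (2 * m (mirror s)) dvd Const (1 / 2) * (Const 2 * subst p ?l)" by (rule dvd_mult)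
  also have "Const (1 / 2) * (Const 2 * subst p ?l) = Const (1 / 2 * 2) * subst p ?l"
    by (simp only: Const_simps(4) mult.assoc)
  finally show "?l ^ (2 * m (mirror s)) dvd subst p ?l" by (simp add: Const_simps(2))
qed

lemma act_Var_linear_form: "\<exists>b. act w (Var k) = linear_form b"
  using act_linear_form_ex[of w "axis k 1"] by (simp add: linear_form_axis)

lemma equivariant_add: "equivariant p \<Longrightarrow> equivariant q \<Longrightarrow> equivariant (\<lambda>k. p k + q k)"
  unfolding equivariant_def
proof (intro ballI allI)
  fix w k assume pq: "\<forall>w\<in>W. \<forall>k. act w (p k) = subst p (act w (Var k))"
    "\<forall>w\<in>W. \<forall>k. act w (q k) = subst q (act w (Var k))" "w \<in> W"
  obtain b where "act w (Var k) = linear_form b" using act_Var_linear_form by blast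
  then show "act w (p k + q k) = subst (\<lambda>k. p k + q k) (act w (Var k))"
    using pq by (simp add: act_simps subst_add_linear_form)
qed

lemma equivariant_scale: "equivariant p \<Longrightarrow> equivariant (\<lambda>k. Const c * p k)"
  unfolding equivariant_def
proof (intro ballI allI)
  fix w k assume p: "\<forall>w\<in>W. \<forall>k. act w (p k) = subst p (act w (Var k))" "w \<in> W"
  obtain b where "act w (Var k) = linear_form b" using act_Var_linear_form by blast
  then show "act w (Const c * p k) = subst (\<lambda>k. Const c * p k) (act w (Var k))"
    using p by (simp add: act_simps subst_scale_linear_form)
qed

lemma quasi_equivariant_add:
  "quasi_equivariant m p \<Longrightarrow> quasi_equivariant m q \<Longrightarrow> quasi_equivariant m (\<lambda>k. p k + q k)"
  by (auto simp: quasi_equivariant_def equivariant_add subst_add_linear_form)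

lemma quasi_equivariant_scale:
  "quasi_equivariant m p \<Longrightarrow> quasi_equivariant m (\<lambda>k. Const c * p k)"
  by (auto simp: quasi_equivariant_def equivariant_scale subst_scale_linear_form)

lemma quasi_equivariant_0: "quasi_equivariant m (\<lambda>k. 0)"
  by (auto simp: quasi_equivariant_def equivariant_def subst_linear_form act_simps act_Var subst_simps)

lemma quasi_equivariant_sum:
  "(\<And>i. i \<in> I \<Longrightarrow> quasi_equivariant m (p i)) \<Longrightarrow> quasi_equivariant m (\<lambda>k. \<Sum>i\<in>I. p i k)"
  by (induction I rule: infinite_finite_induct) (auto simp: quasi_equivariant_0 quasi_equivariant_add)

lemma quasi_equivariant_mult_invariant:
  assumes "\<And>w. w \<in> W \<Longrightarrow> act w t = t" "quasi_equivariant m p"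
  shows "quasi_equivariant m (\<lambda>k. t * p k)"
proof -
  have s: "subst (\<lambda>k. t * p k) (linear_form a) = t * subst p (linear_form a)" for a
    by (simp add: subst_linear_form sum_distrib_left mult_ac)
  have "act w (t * p k) = subst (\<lambda>k. t * p k) (act w (Var k))" if w: "w \<in> W" for w k
  proof -
    obtain b where b: "act w (Var k) = linear_form b" using act_Var_linear_form by blast
    have "act w (p k) = subst p (act w (Var k))"
      using assms(2) w by (simp add: quasi_equivariant_def equivariant_def)
    then show ?thesis unfolding b s using assms(1)[OF w] by (simp add: act_simps b)
  qed
  then show ?thesis
    using assms(2) by (auto simp: quasi_equivariant_def equivariant_def s)
qed

text \<open>The image of the evaluation from equivariant maps tensored with the dual space: by
  linearity one map for each coordinate function is enough.\<close>

definition isotypic_part :: "((complex, 'n) vec set \<Rightarrow> nat) \<Rightarrow> 'n mpoly set" where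
  "isotypic_part m = {\<Sum>k\<in>UNIV. P k k | P. \<forall>k. quasi_equivariant m (P k)}"

lemma isotypic_part_subspace: "mpoly.subspace (isotypic_part m)"
  unfolding mpoly.subspace_def
proof (intro conjI ballI allI)
  show "0 \<in> isotypic_part m"
    unfolding isotypic_part_def
    by (rule CollectI, rule exI[of _ "\<lambda>_ _. 0"]) (simp add: quasi_equivariant_0)
next
  fix x y assume "x \<in> isotypic_part m" "y \<in> isotypic_part m"
  then obtain P Q where "x = (\<Sum>k\<in>UNIV. P k k)" "y = (\<Sum>k\<in>UNIV. Q k k)"
    "\<forall>k. quasi_equivariant m (P k)" "\<forall>k. quasi_equivariant m (Q k)"
    unfolding isotypic_part_def by blast
  then show "x + y \<in> isotypic_part m"
    unfolding isotypic_part_def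
    by (intro CollectI exI[of _ "\<lambda>k j. P k j + Q k j"]) (simp add: sum.distrib quasi_equivariant_add)
next
  fix c x assume "x \<in> isotypic_part m"
  then obtain P where "x = (\<Sum>k\<in>UNIV. P k k)" "\<forall>k. quasi_equivariant m (P k)"
    unfolding isotypic_part_def by blast
  then show "pscale c x \<in> isotypic_part m"
    unfolding isotypic_part_def
    by (intro CollectI exI[of _ "\<lambda>k j. Const c * P k j"])
      (simp add: pscale_def sum_distrib_left quasi_equivariant_scale)
qed

lemma isomorphic_module_equivariant:
  assumes \<phi>: "\<And>e e'. e \<in> dual_space \<Longrightarrow> e' \<in> dual_space \<Longrightarrow> \<phi> (e + e') = \<phi> e + \<phi> e'"
    "\<And>c e. e \<in> dual_space \<Longrightarrow> \<phi> (pscale c e) = pscale c (\<phi> e)"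
    "\<And>w e. w \<in> W \<Longrightarrow> e \<in> dual_space \<Longrightarrow> \<phi> (act w e) = act w (\<phi> e)"
  shows "\<phi> (linear_form a) = subst (\<lambda>k. \<phi> (Var k)) (linear_form a)" "equivariant (\<lambda>k. \<phi> (Var k))"
proof -
  have lf: "linear_form b \<in> dual_space" for b :: "(complex, 'n) vec" by (simp add: dual_space_def)
  have V: "Var k \<in> dual_space" for k :: 'n using lf[of "axis k 1"] by (simp add: linear_form_axis)
  have eq: "\<phi> (linear_form a) = subst (\<lambda>k. \<phi> (Var k)) (linear_form a)" for a
  proof -
    have "\<phi> (linear_form (\<Sum>i\<in>I. a $ i *s axis i 1)) = (\<Sum>i\<in>I. Const (a $ i) * \<phi> (Var i))"
      if "finite I" for I
      using that
    proof (induction I rule: finite_induct)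
      case (insert x F)
      have "linear_form (\<Sum>i\<in>insert x F. a $ i *s axis i 1)
          = pscale (a $ x) (Var x) + linear_form (\<Sum>i\<in>F. a $ i *s axis i 1)"
        using insert.hyps by (simp add: linear_form_add linear_form_scale linear_form_axis pscale_def)
      moreover have "pscale (a $ x) (Var x) \<in> dual_space"
        using lf[of "a $ x *s axis x 1"] by (simp add: linear_form_scale linear_form_axis pscale_def)
      ultimately show ?case
        using insert \<phi>(1)[OF _ lf] \<phi>(2)[OF V] by (simp add: pscale_def)
    next
      case empty
      have "\<phi> (pscale 0 (linear_form 0)) = pscale 0 (\<phi> (linear_form 0))" by (rule \<phi>(2)[OF lf])
      then show ?case by (simp add: pscale_def Const_simps)
    qed
    from this[of UNIV] show ?thesis by (simp add: basis_expansion subst_linear_form)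
  qed
  then show "\<phi> (linear_form a) = subst (\<lambda>k. \<phi> (Var k)) (linear_form a)" .
  show "equivariant (\<lambda>k. \<phi> (Var k))"
    unfolding equivariant_def
  proof (intro ballI allI)
    fix w k assume w: "w \<in> W"
    obtain b where b: "act w (Var k) = linear_form b" using act_Var_linear_form by blast
    have "act w (\<phi> (Var k)) = \<phi> (act w (Var k))" using \<phi>(3)[OF w V] by simp
    also have "\<dots> = subst (\<lambda>k. \<phi> (Var k)) (act w (Var k))" unfolding b by (rule eq)
    finally show "act w (\<phi> (Var k)) = subst (\<lambda>k. \<phi> (Var k)) (act w (Var k))" .
  qed
qed

lemma submodule_subset_isotypic_part:
  assumes "submodule_of W (quasi_invariants W m) U" "isomorphic_modules W dual_space U"
  shows "U \<subseteq> isotypic_part m"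
proof
  fix u assume u: "u \<in> U"
  obtain \<phi> where bij: "bij_betw \<phi> dual_space U"
    and \<phi>: "\<And>e e'. e \<in> dual_space \<Longrightarrow> e' \<in> dual_space \<Longrightarrow> \<phi> (e + e') = \<phi> e + \<phi> e'"
      "\<And>c e. e \<in> dual_space \<Longrightarrow> \<phi> (pscale c e) = pscale c (\<phi> e)"
      "\<And>w e. w \<in> W \<Longrightarrow> e \<in> dual_space \<Longrightarrow> \<phi> (act w e) = act w (\<phi> e)"
    using assms(2) unfolding isomorphic_modules_def by blast
  define p where "p k = \<phi> (Var k)" for k
  have p: "\<phi> (linear_form a) = subst p (linear_form a)" "equivariant p" for a
    using isomorphic_module_equivariant[of \<phi>, OF \<phi>] unfolding p_def by blast+
  have "subst p (linear_form a) \<in> quasi_invariants W m" for a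
  proof -
    have "\<phi> (linear_form a) \<in> U" using bij by (auto simp: bij_betw_def dual_space_def)
    then show ?thesis using assms(1) p(1) by (auto simp: submodule_of_def)
  qed
  then have qp: "quasi_equivariant m p" by (rule quasi_equivariantI[OF p(2)])
  obtain a where "u = \<phi> (linear_form a)" using u bij by (auto simp: bij_betw_def dual_space_def)
  then have "u = (\<Sum>k\<in>UNIV. Const (a $ k) * p k)" by (simp add: p(1) subst_linear_form)
  then show "u \<in> isotypic_part m"
    unfolding isotypic_part_def
    by (intro CollectI exI[of _ "\<lambda>k j. Const (a $ k) * p j"]) (simp add: quasi_equivariant_scale qp)
qed

text \<open>A nonzero equivariant map is injective, so its image is a copy of the dual
  space.\<close>

lemma quasi_equivariant_in_isotypic_component:
  assumes p: "quasi_equivariant m p"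
  shows "p k \<in> isotypic_component W dual_space (quasi_invariants W m)"
proof (cases "p k = 0")
  case True
  then show ?thesis unfolding isotypic_component_def by (simp add: mpoly.span_zero)
next
  case False
  have ep: "equivariant p" using p by (simp add: quasi_equivariant_def)
  let ?U = "range (\<lambda>a. subst p (linear_form a))"
  have act: "act w (subst p (linear_form a)) \<in> ?U" if "w \<in> W" for w a
  proof -
    obtain b where "act w (linear_form a) = linear_form b" using act_linear_form_ex by blast
    then show ?thesis using equivariant_act[OF ep that] by auto
  qed
  have "mpoly.subspace ?U"
    unfolding mpoly.subspace_def
  proof (intro conjI ballI allI)
    show "0 \<in> ?U" by (rule range_eqI[of _ _ 0]) (simp add: subst_simps)
    show "x + y \<in> ?U" if xy: "x \<in> ?U" "y \<in> ?U" for x y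
    proof -
      obtain a b where "x = subst p (linear_form a)" "y = subst p (linear_form b)" using xy by blast
      then show ?thesis by (intro range_eqI[of _ _ "a + b"]) (simp add: linear_form_add subst_simps)
    qed
    show "pscale c x \<in> ?U" if x: "x \<in> ?U" for c x
    proof -
      obtain a where "x = subst p (linear_form a)" using x by blast
      then show ?thesis
        by (intro range_eqI[of _ _ "c *s a"]) (simp add: linear_form_scale subst_simps pscale_def)
    qed
  qed
  then have "submodule_of W (quasi_invariants W m) ?U"
    using act quasi_equivariant_in[OF p] unfolding submodule_of_def by blast
  moreover have "isomorphic_modules W dual_space ?U"
    unfolding isomorphic_modules_def
  proof (intro exI[of _ "subst p"] conjI ballI allI)
    show "bij_betw (subst p) dual_space ?U"
      unfolding bij_betw_def dual_space_def
    proof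
      show "inj_on (subst p) (range linear_form)"
      proof (rule inj_onI, clarify)
        fix a b assume "subst p (linear_form a) = subst p (linear_form b)"
        then have "subst p (linear_form (a - b)) = 0" by (simp add: linear_form_diff subst_simps)
        then have "a - b = 0" using equivariant_kernel[OF ep, of "a - b" k] False by blast
        then show "linear_form a = linear_form b" by simp
      qed
    qed (simp add: image_image)
  qed (auto simp: subst_simps pscale_def equivariant_act[OF ep])
  ultimately have "?U \<subseteq> isotypic_component W dual_space (quasi_invariants W m)"
    unfolding isotypic_component_def by (intro subset_trans[OF _ mpoly.span_superset]) blast
  moreover have "p k \<in> ?U"
    by (rule range_eqI[of _ _ "axis k 1"]) (simp add: linear_form_axis)
  ultimately show ?thesis by blast
qed

lemma isotypic_component_eq:
  "isotypic_component W dual_space (quasi_invariants W m) = isotypic_part m"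
proof
  show "isotypic_component W dual_space (quasi_invariants W m) \<subseteq> isotypic_part m"
    unfolding isotypic_component_def
    by (rule mpoly.span_minimal[OF _ isotypic_part_subspace]) (use submodule_subset_isotypic_part in blast)
  show "isotypic_part m \<subseteq> isotypic_component W dual_space (quasi_invariants W m)"
  proof
    fix f assume "f \<in> isotypic_part m"
    then obtain P where P: "f = (\<Sum>k\<in>UNIV. P k k)" "\<forall>k. quasi_equivariant m (P k)"
      unfolding isotypic_part_def by blast
    have "P k k \<in> isotypic_component W dual_space (quasi_invariants W m)" for k
      using P(2) quasi_equivariant_in_isotypic_component by blast
    then show "f \<in> isotypic_component W dual_space (quasi_invariants W m)"
      unfolding P(1) isotypic_component_def by (intro mpoly.span_sum) simp
  qed
qed

text \<open>The sum is a linear form fixed by every reflection, so it pairs to zero with all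
  coroots.\<close>

lemma sum_act_linear_form: "(\<Sum>w\<in>W. act w (linear_form a)) = 0"
proof -
  have "\<forall>w. \<exists>b. act w (linear_form a) = linear_form b" using act_linear_form_ex by blast
  from choice[OF this] obtain b where b: "\<forall>w. act w (linear_form a) = linear_form (b w)" by (rule exE)
  have sum: "(\<Sum>w\<in>W. act w (linear_form a)) = linear_form (sum b W)" by (simp add: linear_form_sum b)
  have "pairing (sum b W) (coroot s) = 0" if s: "s \<in> reflections W" for s
  proof -
    have ss: "s ** (s ** w) = w" for w
      using reflectionD(1)[OF s] by (simp add: matrix_mul_assoc is_reflection_def)
    have "act s (linear_form (sum b W)) = (\<Sum>w\<in>W. act (s ** w) (linear_form a))"
      unfolding sum[symmetric] act_simps by (intro sum.cong refl) (simp add: act_group reflectionD s)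
    also have "\<dots> = (\<Sum>w\<in>W. act w (linear_form a))"
      by (rule sum.reindex_bij_witness[of _ "\<lambda>w. s ** w" "\<lambda>w. s ** w"])
        (auto simp: ss mult_W reflectionD s)
    also have "\<dots> = linear_form (sum b W)" by (rule sum)
    finally have "Const (pairing (sum b W) (coroot s)) * lin (root_form s) = 0"
      unfolding act_reflection_linear_form[OF reflectionD(1)[OF s]] by simp
    moreover have "lin (root_form s) \<noteq> 0" using root_nonzero[OF reflectionD(1)[OF s]] by simp
    ultimately show ?thesis by (simp del: sum_component of_real_mult)
  qed
  then have "sum b W = 0" by (rule pairing_coroots)
  then show ?thesis using sum by simp
qed

end

section \<open>The primitive derivation on the isotypic components\<close>

context invariant_generators
begin

lemma prim_subst_linear_form:
  assumes "\<And>k. prim (p k) = J * q k"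
  shows "prim (subst p (linear_form a)) = J * subst q (linear_form a)"
  by (simp add: subst_linear_form prim_sum prim_Const_mult assms sum_distrib_left mult.left_commute)

lemma prim_power_dvd: "l ^ n dvd prim (l ^ Suc n * g)"
proof -
  have "prim (l ^ Suc n * g) = l ^ n * (of_nat (Suc n) * (prim l * g) + l * prim g)"
    unfolding prim_mult prim_power by (simp add: algebra_simps)
  then show ?thesis by simp
qed

text \<open>From order 2m at the root, \<open>prim\<close> loses at most one and the division by
  \<open>J\<close> exactly one, leaving 2(m - 1).\<close>

lemma prim_maps:
  assumes p: "quasi_equivariant m p" and m: "\<And>s. s \<in> reflections W \<Longrightarrow> m (mirror s) \<ge> 1"
  obtains q where "quasi_equivariant (\<lambda>H. m H - 1) q" "\<And>k. prim (p k) = J * q k"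
proof -
  have ep: "equivariant p" using p by (simp add: quasi_equivariant_def)
  have high: "lin (root_form s) ^ Suc (2 * (m (mirror s) - 1)) dvd prim (subst p (lin (root_form s)))"
    if s: "s \<in> reflections W" for s
  proof -
    \<comment> \<open>Here \<open>m \<ge> 1\<close> makes the truncated subtraction exact.\<close>
    have e: "2 * m (mirror s) = Suc (Suc (2 * (m (mirror s) - 1)))" using m[OF s] by simp
    obtain g where "subst p (lin (root_form s)) = lin (root_form s) ^ (2 * m (mirror s)) * g"
      using p s unfolding quasi_equivariant_def dvd_def by blast
    then show ?thesis unfolding e using prim_power_dvd by metis
  qed
  have "J dvd prim (p k)" for k
  proof (rule J_dvd)
    fix s assume s: "s \<in> reflections W"
    have "lin (root_form s) dvd prim (subst p (lin (root_form s)))"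
      by (rule dvd_trans[OF _ high[OF s]]) simp
    then show "lin (root_form s) dvd prim (p k)"
      using equivariant_prim_dvd[OF ep s, of "axis k 1"] by (simp add: linear_form_axis)
  qed
  then have "\<forall>k. \<exists>q. prim (p k) = J * q" by (auto simp: dvd_def)
  from choice[OF this] obtain q where q: "\<forall>k. prim (p k) = J * q k" by (rule exE)
  have lf: "prim (subst p (linear_form a)) = J * subst q (linear_form a)" for a
    by (rule prim_subst_linear_form) (use q in blast)
  have "act w (q k) = subst q (act w (Var k))" if w: "w \<in> W" for w k
  proof -
    obtain b where b: "act w (Var k) = linear_form b" using act_Var_linear_form by blast
    have Jw: "Const (complex_of_real (det (matrix_inv w))) * act w J = J"
      using Jac_act[of w z, symmetric] by (simp add: J_def act_z w)
    have "Const (complex_of_real (det (matrix_inv w))) * act w (prim (p k))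
        = (Const (complex_of_real (det (matrix_inv w))) * act w J) * act w (q k)"
      by (simp add: q act_simps mult.assoc)
    then have "J * act w (q k) = Const (complex_of_real (det (matrix_inv w))) * act w (prim (p k))"
      by (simp only: Jw)
    also have "\<dots> = prim (subst p (act w (Var k)))"
      using ep w by (simp add: equivariant_def flip: prim_act[OF w])
    also have "\<dots> = J * subst q (act w (Var k))" unfolding b by (rule lf)
    finally show ?thesis using J_nonzero by simp
  qed
  then have eq: "equivariant q" by (simp add: equivariant_def)
  have "lin (root_form s) ^ (2 * (m (mirror s) - 1)) dvd subst q (lin (root_form s))"
    if s: "s \<in> reflections W" for s
  proof -
    let ?l = "lin (root_form s)" and ?n = "2 * (m (mirror s) - 1)"
    obtain J1 where J1: "J = ?l * J1" "\<not> ?l dvd J1" using J_order_one[OF s] by blast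
    have l0: "?l \<noteq> 0" using prime_root[OF s] by auto
    have "?l * ?l ^ ?n dvd ?l * (J1 * subst q ?l)"
      using high[OF s] unfolding lf J1(1) by (simp add: mult.assoc)
    then have d: "?l ^ ?n dvd J1 * subst q ?l" using l0 by simp
    show ?thesis by (rule prime_elem_power_dvd_multD[OF prime_root[OF s] d J1(2)])
  qed
  then have "quasi_equivariant (\<lambda>H. m H - 1) q" using eq by (simp add: quasi_equivariant_def)
  then show ?thesis using that q by blast
qed

text \<open>Any equivariant preimage has the right order automatically, because the pole along each
  mirror makes the loss of order exact.\<close>

lemma prim_onto:
  assumes q: "quasi_equivariant (\<lambda>H. m H - 1) q" and m: "\<And>s. s \<in> reflections W \<Longrightarrow> m (mirror s) \<ge> 1"
  obtains p where "quasi_equivariant m p" "\<And>k. prim (p k) = J * q k"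
proof -
  have "equivariant q" using q by (simp add: quasi_equivariant_def)
  then obtain p where p: "equivariant p" "\<And>k. prim (p k) = J * q k"
    by (rule prim_surjective) (rule that)
  have "lin (root_form s) ^ (2 * m (mirror s)) dvd subst p (lin (root_form s))"
    if s: "s \<in> reflections W" for s
  proof (cases "subst p (lin (root_form s)) = 0")
    case False
    let ?l = "lin (root_form s)" and ?n = "2 * (m (mirror s) - 1)"
    have l0: "cvec (root_form s) \<noteq> 0" using root_nonzero[OF reflectionD(1)[OF s]] by simp
    obtain k g where kg: "subst p ?l = ?l ^ k * g" "\<not> ?l dvd g"
      using linear_form_multiplicity[OF l0 False] by blast
    have "k \<noteq> 0" using equivariant_root_dvd[OF p(1) s] kg by (intro notI) simp
    then obtain k' where k': "k = Suc k'" by (cases k) auto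
    obtain h where h: "prim (subst p ?l) = ?l ^ k' * h" "\<not> ?l dvd h"
      using prim_exact_order[OF s pole[OF s] _ kg(2), of "subst p ?l" k'] kg(1) k' by blast
    obtain J1 where J1: "J = ?l * J1" using J_order_one[OF s] by blast
    have "?l ^ ?n dvd subst q ?l" using q s by (simp add: quasi_equivariant_def)
    then have "?l ^ Suc ?n dvd J * subst q ?l"
      unfolding J1 power_Suc by (simp add: mult_dvd_mono mult.assoc dvd_mult)
    then have d: "?l ^ Suc ?n dvd ?l ^ k' * h"
      using h(1) prim_subst_linear_form[of p q, OF p(2)] by simp
    \<comment> \<open>With k = k' + 1 this gives the order 2(m - 1) + 2 = 2m.\<close>
    have "Suc ?n \<le> k'"
    proof (rule ccontr)
      assume "\<not> ?thesis"
      then have "?l ^ Suc k' dvd ?l ^ k' * h" using d by (meson dvd_trans le_imp_power_dvd not_less_eq_eq)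
      then have "?l dvd h" using l0 by (simp add: mult.commute[of _ "?l ^ k'"])
      then show False using h(2) by simp
    qed
    then have "2 * m (mirror s) \<le> k" using k' m[OF s] by simp
    then show ?thesis unfolding kg(1) by (intro dvd_mult2 le_imp_power_dvd)
  qed simp
  then have "quasi_equivariant m p" using p(1) by (simp add: quasi_equivariant_def)
  then show ?thesis using p(2) by (rule that)
qed

text \<open>For a single polynomial \<open>f\<close> with zero derivative, f - s f is the value at
  the root of an equivariant map whose derivative vanishes there, so that map is zero. Thus
  \<open>f\<close> is invariant; but the dual space has no invariants, so averaging \<open>f\<close>
  over \<open>W\<close> gives zero.\<close>

lemma prim_injective:
  assumes f: "f \<in> isotypic_part m" and m: "\<And>s. s \<in> reflections W \<Longrightarrow> m (mirror s) \<ge> 1"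
    and zero: "prim f = 0"
  shows "f = 0"
proof -
  obtain P where P: "f = (\<Sum>k\<in>UNIV. P k k)" "\<And>k. quasi_equivariant m (P k)"
    using f unfolding isotypic_part_def by blast
  then have eP: "equivariant (P k)" for k by (simp add: quasi_equivariant_def)
  have PV: "P k k = subst (P k) (linear_form (axis k 1))" for k by (simp add: linear_form_axis)
  have "act s f = f" if s: "s \<in> reflections W" for s
  proof -
    let ?l = "lin (root_form s)"
    have l0: "cvec (root_form s) \<noteq> 0" using root_nonzero[OF reflectionD(1)[OF s]] by simp
    \<comment> \<open>Each \<open>P k\<close> contributes to f - s f its value at the root, weighted
      by the pairing of the k-th coordinate with the coroot.\<close>
    define p where "p j = (\<Sum>k\<in>UNIV. Const (pairing (axis k 1) (coroot s)) * P k j)" for j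
    have qp: "quasi_equivariant m p"
      unfolding p_def by (intro quasi_equivariant_sum quasi_equivariant_scale P)
    then have ep: "equivariant p" by (simp add: quasi_equivariant_def)
    have "f - act s f = (\<Sum>k\<in>UNIV. P k k - act s (P k k))"
      by (simp add: P(1) act_simps sum_subtractf)
    also have "\<dots> = (\<Sum>k\<in>UNIV. Const (pairing (axis k 1) (coroot s)) * subst (P k) ?l)"
      unfolding PV by (simp only: equivariant_diff[OF eP s])
    also have "\<dots> = subst p ?l"
      unfolding subst_linear_form p_def sum_distrib_left by (subst sum.swap) (simp only: mult.left_commute)
    finally have fp: "f - act s f = subst p ?l" .
    obtain q where q: "quasi_equivariant (\<lambda>H. m H - 1) q" "\<And>k. prim (p k) = J * q k"
      by (rule prim_maps[OF qp m]) (assumption | rule that)+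
    have "J * subst q ?l = prim (f - act s f)"
      unfolding fp by (rule prim_subst_linear_form[OF q(2), symmetric])
    also have "\<dots> = 0" by (simp add: prim_diff prim_act_reflection s zero act_simps)
    finally have "subst q ?l = 0" using J_nonzero by simp
    then have "q k = 0" for k
      using equivariant_kernel[OF _ l0] q(1) by (simp add: quasi_equivariant_def)
    then have "p k = 0" for k by (intro equivariant_prim_inj[OF ep]) (simp add: q(2))
    then have "subst p ?l = 0" by (simp add: subst_linear_form)
    then show ?thesis using fp by simp
  qed
  then have inv: "act w f = f" if "w \<in> W" for w
    using invariant_if_reflection_invariant that by blast
  have "of_nat (card W) * f = (\<Sum>w\<in>W. act w f)" by (simp add: inv)
  also have "\<dots> = (\<Sum>k\<in>UNIV. \<Sum>w\<in>W. act w (P k k))"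
    unfolding P(1) act_simps by (rule sum.swap)
  also have "\<dots> = (\<Sum>k\<in>UNIV. subst (P k) (\<Sum>w\<in>W. act w (linear_form (axis k 1))))"
    unfolding PV subst_simps by (intro sum.cong refl) (rule equivariant_act[OF eP])
  also have "\<dots> = 0" by (simp add: sum_act_linear_form subst_simps)
  finally show ?thesis using W_nonempty finite_W by (simp add: card_eq_0_iff)
qed

lemma isotypic_part_mult_invariant:
  assumes "\<And>w. w \<in> W \<Longrightarrow> act w t = t" "f \<in> isotypic_part m"
  shows "t * f \<in> isotypic_part m"
proof -
  obtain P where P: "f = (\<Sum>k\<in>UNIV. P k k)" "\<And>k. quasi_equivariant m (P k)"
    using assms(2) unfolding isotypic_part_def by blast
  have "t * f = (\<Sum>k\<in>UNIV. t * P k k)" by (simp add: P(1) sum_distrib_left)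
  then show ?thesis
    unfolding isotypic_part_def
    by (intro CollectI exI[of _ "\<lambda>k j. t * P k j"]) (simp add: quasi_equivariant_mult_invariant assms(1) P(2))
qed

lemma isotypic_part_prim:
  assumes "\<And>s. s \<in> reflections W \<Longrightarrow> m (mirror s) \<ge> 1"
  shows "f \<in> isotypic_part m \<Longrightarrow> \<exists>g\<in>isotypic_part (\<lambda>H. m H - 1). prim f = J * g"
    and "g \<in> isotypic_part (\<lambda>H. m H - 1) \<Longrightarrow> \<exists>f\<in>isotypic_part m. prim f = J * g"
proof -
  assume "f \<in> isotypic_part m"
  then obtain P where P: "f = (\<Sum>k\<in>UNIV. P k k)" "\<And>k. quasi_equivariant m (P k)"
    unfolding isotypic_part_def by blast
  have "\<forall>k. \<exists>q. quasi_equivariant (\<lambda>H. m H - 1) q \<and> (\<forall>j. prim (P k j) = J * q j)"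
  proof
    fix k
    show "\<exists>q. quasi_equivariant (\<lambda>H. m H - 1) q \<and> (\<forall>j. prim (P k j) = J * q j)"
      by (rule prim_maps[OF P(2)[of k] assms]) auto
  qed
  from choice[OF this] obtain Q where
    Q: "\<forall>k. quasi_equivariant (\<lambda>H. m H - 1) (Q k) \<and> (\<forall>j. prim (P k j) = J * Q k j)" by (rule exE)
  show "\<exists>g\<in>isotypic_part (\<lambda>H. m H - 1). prim f = J * g"
  proof (rule bexI)
    show "prim f = J * (\<Sum>k\<in>UNIV. Q k k)" by (simp add: P(1) prim_sum Q sum_distrib_left)
    show "(\<Sum>k\<in>UNIV. Q k k) \<in> isotypic_part (\<lambda>H. m H - 1)"
      unfolding isotypic_part_def using Q by blast
  qed
next
  assume "g \<in> isotypic_part (\<lambda>H. m H - 1)"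
  then obtain Q where Q: "g = (\<Sum>k\<in>UNIV. Q k k)" "\<And>k. quasi_equivariant (\<lambda>H. m H - 1) (Q k)"
    unfolding isotypic_part_def by blast
  have "\<forall>k. \<exists>p. quasi_equivariant m p \<and> (\<forall>j. prim (p j) = J * Q k j)"
  proof
    fix k
    show "\<exists>p. quasi_equivariant m p \<and> (\<forall>j. prim (p j) = J * Q k j)"
      by (rule prim_onto[OF Q(2)[of k] assms]) auto
  qed
  from choice[OF this] obtain P where
    P: "\<forall>k. quasi_equivariant m (P k) \<and> (\<forall>j. prim (P k j) = J * Q k j)" by (rule exE)
  show "\<exists>f\<in>isotypic_part m. prim f = J * g"
  proof (rule bexI)
    show "prim (\<Sum>k\<in>UNIV. P k k) = J * g" by (simp add: Q(1) prim_sum P sum_distrib_left)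
    show "(\<Sum>k\<in>UNIV. P k k) \<in> isotypic_part m"
      unfolding isotypic_part_def using P by blast
  qed
qed

text \<open>\<open>J D\<close> and \<open>prim\<close> are derivations agreeing on all
  \<open>z j\<close>, and the differentials of the \<open>z j\<close> are independent over the field
  of fractions.\<close>

lemma derivation_eq_prim:
  assumes D: "derivation D" and Dz: "\<And>i. D (to_frac (z i)) = (if i = n0 then 1 else 0)"
  shows "to_frac J * D (to_frac p) = to_frac (prim p)"
proof -
  have chain: "D (to_frac p) = (\<Sum>k\<in>UNIV. to_frac (pd k p) * D (to_frac (Var k)))" for p
    by (rule derivation_chain[of "\<lambda>p. D (to_frac p)"])
      (use D in \<open>simp_all add: derivation_def to_frac_simps ringhom_to_frac\<close>)
  have "to_frac J * D (to_frac (Var k)) - to_frac (prim (Var k)) = 0" for k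
  proof (rule cramer_J_fract)
    fix j
    have "(\<Sum>k\<in>UNIV. (to_frac J * D (to_frac (Var k)) - to_frac (prim (Var k))) * to_frac (pd k (z j)))
        = to_frac J * D (to_frac (z j)) - to_frac (\<Sum>k\<in>UNIV. pd k (z j) * prim (Var k))"
      by (subst chain[of "z j"])
        (simp add: ring_distribs sum_subtractf sum_distrib_left to_frac_simps mult_ac)
    also have "(\<Sum>k\<in>UNIV. pd k (z j) * prim (Var k)) = prim (z j)" by (rule prim_eq[symmetric])
    finally show "(\<Sum>k\<in>UNIV. (to_frac J * D (to_frac (Var k)) - to_frac (prim (Var k))) * to_frac (pd k (z j))) = 0"
      by (simp add: Dz prim_z to_frac_simps)
  qed
  then have "to_frac J * D (to_frac (Var k)) = to_frac (prim (Var k))" for k by simp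
  then have "to_frac J * D (to_frac p) = (\<Sum>k\<in>UNIV. to_frac (pd k p * prim (Var k)))"
    by (subst chain)
      (simp only: sum_distrib_left mult.left_commute[of "to_frac J"] to_frac_simps)
  also have "\<dots> = to_frac (prim p)" by (subst prim_eq) (simp add: to_frac_simps)
  finally show ?thesis .
qed

theorem module_isomorphism_isotypic_part:
  assumes D: "derivation D" and Dz: "\<And>i. D (to_frac (z i)) = (if i = n0 then 1 else 0)"
    and m: "\<And>s. s \<in> reflections W \<Longrightarrow> m (mirror s) \<ge> 1"
    and T: "\<And>t w. t \<in> T \<Longrightarrow> w \<in> W \<Longrightarrow> act w t = t" "\<And>t. t \<in> T \<Longrightarrow> D (to_frac t) = 0"
  shows "module_isomorphism (to_frac ` T) D (to_frac ` isotypic_part m)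
    (to_frac ` isotypic_part (\<lambda>H. m H - 1))"
proof -
  have Dadd: "D (f + g) = D f + D g" and Dmult: "D (f * g) = D f * g + f * D g" for f g
    using D by (auto simp: derivation_def)
  have mod: "is_module_over (to_frac ` T) (to_frac ` isotypic_part k)" for k
  proof -
    have "to_frac 0 \<in> to_frac ` isotypic_part k"
      using isotypic_part_subspace mpoly.subspace_0 by blast
    moreover have "to_frac f + to_frac g \<in> to_frac ` isotypic_part k"
      if "f \<in> isotypic_part k" "g \<in> isotypic_part k" for f g
      using mpoly.subspace_add[OF isotypic_part_subspace that] by (simp flip: to_frac_simps)
    moreover have "to_frac t * to_frac f \<in> to_frac ` isotypic_part k"
      if "t \<in> T" "f \<in> isotypic_part k" for t f
      using isotypic_part_mult_invariant[OF T(1) that(2)] that(1) by (simp flip: to_frac_simps)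
    ultimately show ?thesis by (auto simp: is_module_over_def to_frac_simps)
  qed
  have DJ: "D (to_frac f) = to_frac g" if "prim f = J * g" for f g
  proof -
    have "to_frac J * D (to_frac f) = to_frac J * to_frac g"
      by (simp add: derivation_eq_prim[OF D Dz] that to_frac_simps)
    then show ?thesis using J_nonzero by simp
  qed
  have "bij_betw D (to_frac ` isotypic_part m) (to_frac ` isotypic_part (\<lambda>H. m H - 1))"
    unfolding bij_betw_def
  proof
    show "inj_on D (to_frac ` isotypic_part m)"
    proof (rule inj_onI, clarify)
      fix f g assume fg: "f \<in> isotypic_part m" "g \<in> isotypic_part m" "D (to_frac f) = D (to_frac g)"
      then have "to_frac (prim f) = to_frac (prim g)"
        by (simp flip: derivation_eq_prim[OF D Dz])
      then have "prim (f - g) = 0" by (simp add: prim_diff)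
      with mpoly.subspace_diff[OF isotypic_part_subspace fg(1,2)] m have "f - g = 0"
        by (rule prim_injective)
      then show "to_frac f = to_frac g" by simp
    qed
    show "D ` to_frac ` isotypic_part m = to_frac ` isotypic_part (\<lambda>H. m H - 1)"
    proof
      show "D ` to_frac ` isotypic_part m \<subseteq> to_frac ` isotypic_part (\<lambda>H. m H - 1)"
      proof clarify
        fix f assume "f \<in> isotypic_part m"
        then obtain g where "g \<in> isotypic_part (\<lambda>H. m H - 1)" "prim f = J * g"
          using isotypic_part_prim(1)[of m, OF m] by blast
        then show "D (to_frac f) \<in> to_frac ` isotypic_part (\<lambda>H. m H - 1)" using DJ by blast
      qed
      show "to_frac ` isotypic_part (\<lambda>H. m H - 1) \<subseteq> D ` to_frac ` isotypic_part m"
      proof clarify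
        fix g assume "g \<in> isotypic_part (\<lambda>H. m H - 1)"
        then obtain f where f: "f \<in> isotypic_part m" "prim f = J * g"
          using isotypic_part_prim(2)[of m, OF m] by blast
        then show "to_frac g \<in> D ` to_frac ` isotypic_part m" using DJ[OF f(2)] by (metis imageI)
      qed
    qed
  qed
  moreover have "D (t * f) = t * D f" if "t \<in> to_frac ` T" for t f
    using that T(2) by (auto simp: Dmult)
  ultimately show ?thesis using mod by (simp add: module_isomorphism_def Dadd)
qed

end

section \<open>Variables of a polynomial, and the return to the numbering 1 to N\<close>

lemma vars_add: "vars (p + q) \<subseteq> vars p \<union> vars q"
  using keys_add[of p q] by (auto simp: vars_def)

lemma vars_mult: "vars (p * q) \<subseteq> vars p \<union> vars q"
proof
  fix i assume "i \<in> vars (p * q)"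
  then obtain k where k: "k \<in> Poly_Mapping.keys (p * q)" "i \<in> Poly_Mapping.keys k"
    by (auto simp: vars_def)
  then obtain a b where "k = a + b" "a \<in> Poly_Mapping.keys p" "b \<in> Poly_Mapping.keys q"
    using keys_mult[of p q] by auto
  then show "i \<in> vars p \<union> vars q"
    using k(2) keys_add[of a b] by (auto simp: vars_def)
qed

lemma vars_Const: "vars (Const c) = {}"
  by (auto simp: vars_def Const_def)

lemma vars_Var: "vars (Var i) = {i}"
  by (auto simp: vars_def Var_def)

lemma vars_subst_Var: "vars (subst (\<lambda>i. Var (e i)) p) \<subseteq> range e"
proof (induction p rule: mpoly_induct)
  case (add p q)
  then show ?case using vars_add[of "subst (\<lambda>i. Var (e i)) p" "subst (\<lambda>i. Var (e i)) q"]
    by (auto simp: subst_simps)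
next
  case (mult p q)
  then show ?case using vars_mult[of "subst (\<lambda>i. Var (e i)) p" "subst (\<lambda>i. Var (e i)) q"]
    by (auto simp: subst_simps)
qed (auto simp: vars_Const vars_Var)

text \<open>The kernel of a derivation is a subalgebra. The argument allows an infinite index type,
  as for the invariants numbered by \<open>nat\<close>.\<close>

lemma derivation_generated:
  fixes y :: "'i \<Rightarrow> 'v::{finite,linorder} mpoly"
  assumes D: "derivation D" and y: "\<And>i. i \<in> vars P \<Longrightarrow> D (to_frac (y i)) = 0"
  shows "D (to_frac (subst y P)) = 0"
proof -
  let ?Z = "{p. D (to_frac p) = 0}"
  have add: "p + q \<in> ?Z" and mult: "p * q \<in> ?Z" if "p \<in> ?Z" "q \<in> ?Z" for p q
    using D that by (auto simp: derivation_def to_frac_simps)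
  have const: "Const c \<in> ?Z" for c using D by (auto simp: derivation_def)
  have zero: "0 \<in> ?Z" and one: "1 \<in> ?Z" using const[of 0] const[of 1] by (auto simp: Const_simps)
  have sum: "sum f A \<in> ?Z" if "\<And>x. x \<in> A \<Longrightarrow> f x \<in> ?Z" for f :: "('i \<Rightarrow>\<^sub>0 nat) \<Rightarrow> _" and A
    using that
  proof (induction A rule: infinite_finite_induct)
    case (insert x F)
    then show ?case using add[of "f x" "sum f F"] by simp
  qed (use zero in simp_all)
  have power: "p ^ n \<in> ?Z" if "p \<in> ?Z" for p and n :: nat
    by (induction n) (use that one mult in auto)
  have prod: "prod f A \<in> ?Z" if "\<And>x. x \<in> A \<Longrightarrow> f x \<in> ?Z" for f :: "'i \<Rightarrow> _" and A
    using that one mult by (induction A rule: infinite_finite_induct) auto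
  have "subst y P \<in> ?Z"
    unfolding subst_def
  proof (intro sum mult const prod power)
    fix k i assume "k \<in> Poly_Mapping.keys P" "i \<in> Poly_Mapping.keys k"
    then show "y i \<in> ?Z" using y by (auto simp: vars_def)
  qed
  then show ?thesis by simp
qed

theorem theorem4p5:
  fixes W :: "(real^'n::{finite,linorder}^'n::{finite,linorder}) set"
    and m :: "(complex^'n::{finite,linorder}) set \<Rightarrow> nat"
    and y :: "nat \<Rightarrow> 'n::{finite,linorder} mpoly"
    and D :: "'n::{finite,linorder} mpoly fract \<Rightarrow> 'n::{finite,linorder} mpoly fract"
  assumes "irreducible_reflection_group W"
    and "invariant_multiplicity W m"
    and "\<forall>H\<in>arrangement W. m H \<ge> 1"
    and "basic_invariants W y"
    and "\<forall>i j. 1 \<le> i \<and> i \<le> j \<and> j \<le> CARD('n) \<longrightarrow> total_degree (y i) \<le> total_degree (y j)"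
    and "primitive_derivation y D"
  shows "module_isomorphism
           (to_frac ` generated_algebra y {1..<CARD('n)})
           D
           (to_frac ` isotypic_component W dual_space (quasi_invariants W m))
           (to_frac ` isotypic_component W dual_space (quasi_invariants W (\<lambda>H. m H - 1)))"
proof -
  let ?N = "CARD('n)"
  interpret reflection_group W by unfold_locales (rule assms(1))
  \<comment> \<open>\<open>e\<close> transports the numbering 1 to N to the coordinate type;
    \<open>n0\<close> is the index it carries to N, so its invariant has highest degree by the
    ordering of degrees.\<close>
  obtain e :: "'n \<Rightarrow> nat" where e: "bij_betw e UNIV {1..?N}"
    using bij_betw_iff_card[of "UNIV :: 'n set" "{1..?N}"] by auto
  then have e_inj: "inj e" and e_range: "range e = {1..?N}" by (auto simp: bij_betw_def)
  obtain n0 where n0: "e n0 = ?N"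
  proof -
    have "?N \<in> range e" unfolding e_range by (simp add: Suc_leI)
    then show ?thesis using that by auto
  qed
  define z where "z i = y (e i)" for i
  define d where "d i = int (total_degree (z i))" for i
  have z_subst: "subst z P = subst y (subst (\<lambda>i. Var (e i)) P)" for P
    by (simp add: subst_subst z_def[abs_def])
  have indep: "algebraically_independent y {1..?N}"
    and gen: "generated_algebra y {1..?N} = invariants W"
    using assms(4) by (auto simp: basic_invariants_def)
  have invariant_generators: "invariant_generators W z d n0"
  proof
    fix i
    have "e i \<in> {1..?N}" using e_range by blast
    then show "hom (d i) (z i)"
      using assms(4) unfolding d_def z_def by (intro homogeneous_imp_hom) (auto simp: basic_invariants_def)
    show "d i \<le> d n0"
      using assms(5) \<open>e i \<in> {1..?N}\<close> by (simp add: d_def z_def n0)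
  next
    fix P assume "subst z P = 0"
    then have "subst (\<lambda>i. Var (e i)) P = 0"
      using indep vars_subst_Var[of e P] unfolding algebraically_independent_def e_range z_subst by blast
    then have "subst (\<lambda>j. Var (inv e j)) (subst (\<lambda>i. Var (e i)) P) = 0" by (simp add: subst_simps)
    then show "P = 0" by (simp add: subst_subst inv_f_f[OF e_inj])
  next
    show "range (subst z) = invariants W"
    proof
      show "range (subst z) \<subseteq> invariants W"
      proof clarify
        fix P
        have "subst z P \<in> generated_algebra y {1..?N}"
          unfolding generated_algebra_def z_subst using vars_subst_Var[of e P] e_range by blast
        then show "subst z P \<in> invariants W" unfolding gen .
      qed
      show "invariants W \<subseteq> range (subst z)"
      proof
        fix f assume "f \<in> invariants W"
        then have "f \<in> generated_algebra y {1..?N}" unfolding gen .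
        then obtain P where P: "f = subst y P" "vars P \<subseteq> {1..?N}"
          unfolding generated_algebra_def by blast
        have "subst z (subst (\<lambda>j. Var (inv e j)) P) = subst (\<lambda>j. y (e (inv e j))) P"
          by (simp add: subst_subst z_def)
        also have "\<dots> = subst y P"
        proof (rule subst_cong)
          fix j assume "j \<in> vars P"
          then have "j \<in> range e" using P(2) e_range by blast
          then show "y (e (inv e j)) = y j" by (simp add: f_inv_into_f)
        qed
        finally show "f \<in> range (subst z)" using P(1) by (metis rangeI)
      qed
    qed
  qed
  then interpret invariant_generators W z d n0 .
  have D: "derivation D" "\<And>i. i \<in> {1..?N} \<Longrightarrow> D (to_frac (y i)) = (if i = ?N then 1 else 0)"
    using assms(6) by (auto simp: primitive_derivation_def)
  show ?thesis
    unfolding isotypic_component_eq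
  proof (rule module_isomorphism_isotypic_part[OF D(1)])
    show "D (to_frac (z i)) = (if i = n0 then 1 else 0)" for i
    proof -
      have "e i \<in> {1..?N}" using e_range by blast
      moreover have "e i = ?N \<longleftrightarrow> i = n0" using n0 injD[OF e_inj] by metis
      ultimately show ?thesis using D(2) by (simp add: z_def)
    qed
    show "1 \<le> m (mirror s)" if "s \<in> reflections W" for s
      using assms(3) that by (simp add: arrangement_def)
  next
    fix t w assume t: "t \<in> generated_algebra y {1..<?N}" and w: "w \<in> W"
    obtain P where P: "t = subst y P" "vars P \<subseteq> {1..<?N}"
      using t unfolding generated_algebra_def by blast
    then have "t \<in> generated_algebra y {1..?N}"
      unfolding generated_algebra_def using ivl_subset[of 1 ?N] by force
    then show "act w t = t" using w unfolding gen invariants_def by blast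
  next
    fix t assume "t \<in> generated_algebra y {1..<?N}"
    then obtain P where P: "t = subst y P" "vars P \<subseteq> {1..<?N}"
      unfolding generated_algebra_def by blast
    show "D (to_frac t) = 0"
      unfolding P(1)
    proof (rule derivation_generated[OF D(1)])
      fix i assume "i \<in> vars P"
      then have "i \<in> {1..<?N}" using P(2) by blast
      then show "D (to_frac (y i)) = 0" using D(2)[of i] by simp
    qed
  qed
qed

end
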